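(* Let $\mathbf u\in H^1(\Omega,\mathbb R^d)$. Assume that $\nabla^s\mathbf u\in L^\infty(\Omega,\mathbb R^{d\times d}_{\mathrm{sym}})\cap W^{1,p}(\Omega,\mathbb R^{d\times d})$ for some $p>d$ and that there is a constant $c>0$ such that $|\det\nabla^s\mathbf u|\ge c$ almost everywhere in $\Omega$. Then the space $$K_{\mathbf u}:=\{\mu\in L^2(\Omega):\ \nabla\cdot(\mu\,\nabla^s\mathbf u)=0\}$$ is of dimension zero or one. In the second case, there exists a positive continuous function $\mu_0$ on $\Omega$ such that $K_{\mathbf u}=\mathrm{span}\{\mu_0\}$. If moreover $\Omega$ is Lipschitz, then $\mu_0$ belongs to $W^{1,p}(\Omega)$.
   Context: $d\in\{2,3\}$ and $\Omega\subset\mathbb R^d$ is a bounded domain (open and connected). $\mathbb R^{d\times d}_{\mathrm{sym}}$ is the space of real symmetric $d\times d$ matrices, and $\nabla^s\mathbf u:=(\nabla\mathbf u+\nabla\mathbf u^T)/2$. The divergence of a matrix field is taken row by row; the equation $\nabla\cdot(\mu\nabla^s\mathbf u)=0$ is understood in the sense of distributions (equivalently in $H^{-1}(\Omega,\mathbb R^d)$), i.e. $\int_\Omega\mu\,\nabla^s\mathbf u:\nabla^s\mathbf v=0$ for all $\mathbf v\in H^1_0(\Omega,\mathbb R^d)$, where $A:B=\sum_{ij}A_{ij}B_{ij}$. $W^{1,p}$ is the usual Sobolev space. *)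

theory Defs
  imports "HOL-Analysis.Analysis"
begin

definition Lp :: "'a::euclidean_space set \<Rightarrow> ennreal \<Rightarrow> ('a \<Rightarrow> 'b::euclidean_space) set"
  where "Lp \<Omega> p = {f \<in> borel_measurable (lebesgue_on \<Omega>).
     if p = \<infinity> then \<exists>C. AE x in lebesgue_on \<Omega>. norm (f x) \<le> C
     else integrable (lebesgue_on \<Omega>) (\<lambda>x. norm (f x) powr enn2real p)}"

definition partial_deriv :: "'d::finite \<Rightarrow> (real^'d \<Rightarrow> 'b::real_normed_vector) \<Rightarrow> real^'d \<Rightarrow> 'b"
  where "partial_deriv i f x = frechet_derivative f (at x) (axis i 1)"

primrec times_diff :: "nat \<Rightarrow> (real^'d::finite \<Rightarrow> 'b::real_normed_vector) \<Rightarrow> bool"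
  where
    "times_diff 0 f \<longleftrightarrow> continuous_on UNIV f"
  | "times_diff (Suc k) f \<longleftrightarrow>
       (\<forall>x. f differentiable (at x)) \<and> (\<forall>i. times_diff k (partial_deriv i f))"

(* C_c^infinity of an open set, its elements being extended by zero to the whole space *)
definition test_functions ::
    "(real^'d::finite) set \<Rightarrow> (real^'d \<Rightarrow> 'b::real_normed_vector) set"
  where "test_functions \<Omega> = {\<phi>. (\<forall>k. times_diff k \<phi>) \<and>
     compact (closure {x. \<phi> x \<noteq> 0}) \<and> closure {x. \<phi> x \<noteq> 0} \<subseteq> \<Omega>}"

definition locally_integrable ::
    "'a::euclidean_space set \<Rightarrow> ('a \<Rightarrow> 'b::euclidean_space) \<Rightarrow> bool"
  where "locally_integrable \<Omega> f \<longleftrightarrow>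
     (\<forall>K. compact K \<and> K \<subseteq> \<Omega> \<longrightarrow> f absolutely_integrable_on K)"

definition has_weak_partial ::
    "(real^'d::finite) set \<Rightarrow> 'd \<Rightarrow> (real^'d \<Rightarrow> 'b::euclidean_space) \<Rightarrow> (real^'d \<Rightarrow> 'b) \<Rightarrow> bool"
  where "has_weak_partial \<Omega> i f g \<longleftrightarrow> locally_integrable \<Omega> f \<and> locally_integrable \<Omega> g \<and>
     (\<forall>\<phi> \<in> test_functions \<Omega>.
        (LINT x|lebesgue_on \<Omega>. partial_deriv i \<phi> x *\<^sub>R f x) =
        - (LINT x|lebesgue_on \<Omega>. \<phi> x *\<^sub>R g x))"

(* One representative; weak derivatives are unique only up to null sets, and every use
   below is insensitive to the choice. *)
definition weak_partial ::
    "(real^'d::finite) set \<Rightarrow> 'd \<Rightarrow> (real^'d \<Rightarrow> 'b::euclidean_space) \<Rightarrow> real^'d \<Rightarrow> 'b"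
  where "weak_partial \<Omega> i f = (SOME g. has_weak_partial \<Omega> i f g)"

definition W1p :: "(real^'d::finite) set \<Rightarrow> ennreal \<Rightarrow> (real^'d \<Rightarrow> 'b::euclidean_space) set"
  where "W1p \<Omega> p = {f \<in> Lp \<Omega> p. \<forall>i. \<exists>g \<in> Lp \<Omega> p. has_weak_partial \<Omega> i f g}"

abbreviation H1 :: "(real^'d::finite) set \<Rightarrow> (real^'d \<Rightarrow> 'b::euclidean_space) set"
  where "H1 \<Omega> \<equiv> W1p \<Omega> 2"

definition H1_norm :: "(real^'d::finite) set \<Rightarrow> (real^'d \<Rightarrow> 'b::euclidean_space) \<Rightarrow> real"
  where "H1_norm \<Omega> f = sqrt ((LINT x|lebesgue_on \<Omega>. (norm (f x))\<^sup>2) +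
     (\<Sum>i\<in>UNIV. LINT x|lebesgue_on \<Omega>. (norm (weak_partial \<Omega> i f x))\<^sup>2))"

definition H10 :: "(real^'d::finite) set \<Rightarrow> (real^'d \<Rightarrow> 'b::euclidean_space) set"
  where "H10 \<Omega> = {v \<in> H1 \<Omega>. \<exists>\<phi>. (\<forall>n. \<phi> n \<in> test_functions \<Omega>) \<and>
     (\<lambda>n. H1_norm \<Omega> (\<lambda>x. \<phi> n x - v x)) \<longlonglongrightarrow> 0}"

definition sym_grad :: "(real^'d::finite) set \<Rightarrow> (real^'d \<Rightarrow> real^'d) \<Rightarrow> real^'d \<Rightarrow> real^'d^'d"
  where "sym_grad \<Omega> u x =
     (\<chi> i j. (weak_partial \<Omega> j u x $ i + weak_partial \<Omega> i u x $ j) / 2)"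

(* Locally, after a choice of the unit vector n as last coordinate axis, \<Omega> is the strict
   epigraph of a Lipschitz function on the hyperplane orthogonal to n. *)
definition lipschitz_domain :: "'a::euclidean_space set \<Rightarrow> bool"
  where "lipschitz_domain \<Omega> \<longleftrightarrow> open \<Omega> \<and> connected \<Omega> \<and> bounded \<Omega> \<and>
     (\<forall>x\<in>frontier \<Omega>. \<exists>r>0. \<exists>n g L. norm n = 1 \<and> L-lipschitz_on {y. y \<bullet> n = 0} g \<and>
        (\<forall>y\<in>ball x r. y \<in> \<Omega> \<longleftrightarrow> g (y - (y \<bullet> n) *\<^sub>R n) < y \<bullet> n))"

(* Real functions modulo equality almost everywhere.  A function on \<Omega> is identified with its
   extension by zero, so that subspaces of L^2(\<Omega>) become subspaces of this vector space. *)
quotient_type (overloaded) 'a ae_fun =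
    "'a::euclidean_space \<Rightarrow> real" / "\<lambda>f g. AE x in lebesgue. f x = g x"
proof (rule equivpI)
  show "reflp (\<lambda>f g :: 'a \<Rightarrow> real. AE x in lebesgue. f x = g x)"
    by (rule reflpI) simp
  show "symp (\<lambda>f g :: 'a \<Rightarrow> real. AE x in lebesgue. f x = g x)"
    by (rule sympI) (auto elim: eventually_mono)
  show "transp (\<lambda>f g :: 'a \<Rightarrow> real. AE x in lebesgue. f x = g x)"
  proof (rule transpI)
    fix f g h :: "'a \<Rightarrow> real"
    assume "AE x in lebesgue. f x = g x" "AE x in lebesgue. g x = h x"
    then show "AE x in lebesgue. f x = h x" by eventually_elim simp
  qed
qed

instantiation ae_fun :: (euclidean_space) real_vector
begin

lift_definition zero_ae_fun :: "'a ae_fun" is "\<lambda>x. 0" .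

lift_definition plus_ae_fun :: "'a ae_fun \<Rightarrow> 'a ae_fun \<Rightarrow> 'a ae_fun"
  is "\<lambda>f g x. f x + g x" by (erule (1) eventually_elim2) simp

lift_definition minus_ae_fun :: "'a ae_fun \<Rightarrow> 'a ae_fun \<Rightarrow> 'a ae_fun"
  is "\<lambda>f g x. f x - g x" by (erule (1) eventually_elim2) simp

lift_definition uminus_ae_fun :: "'a ae_fun \<Rightarrow> 'a ae_fun"
  is "\<lambda>f x. - f x" by (erule eventually_mono) simp

lift_definition scaleR_ae_fun :: "real \<Rightarrow> 'a ae_fun \<Rightarrow> 'a ae_fun"
  is "\<lambda>c f x. c * f x" by (erule eventually_mono) simp

instance
  by standard (transfer; simp add: algebra_simps)+

end

definition ae_class :: "'a::euclidean_space set \<Rightarrow> ('a \<Rightarrow> real) \<Rightarrow> 'a ae_fun"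
  where "ae_class \<Omega> f = abs_ae_fun (\<lambda>x. if x \<in> \<Omega> then f x else 0)"

(* The inner product of two matrices is the sum of the products of their entries. *)
definition K_space :: "(real^'d::finite) set \<Rightarrow> (real^'d \<Rightarrow> real^'d) \<Rightarrow> (real^'d) ae_fun set"
  where "K_space \<Omega> u = {ae_class \<Omega> \<mu> | \<mu>. \<mu> \<in> Lp \<Omega> 2 \<and>
     (\<forall>v \<in> H10 \<Omega>. (LINT x|lebesgue_on \<Omega>. (\<mu> x *\<^sub>R sym_grad \<Omega> u x) \<bullet> sym_grad \<Omega> v x) = 0)}"

(* The finiteness clause is needed because dim is 0 for infinite-dimensional subspaces. *)
definition has_dim :: "'v::real_vector set \<Rightarrow> nat \<Rightarrow> bool"
  where "has_dim V n \<longleftrightarrow> subspace V \<and> (\<exists>B. finite B \<and> V \<subseteq> span B) \<and> dim V = n"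

end

theory Submission
  imports Defs
begin

text \<open>Write \<open>S\<close> for the strain \<open>\<nabla>\<^sup>s u\<close>.  Formally, the equation \<open>div (\<mu> S) = 0\<close> is
  \<open>S \<nabla>\<mu> = - \<mu> div S\<close>, and as \<open>S\<close> is invertible it becomes \<open>\<nabla>\<mu> = \<mu> b\<close> with a vector field \<open>b\<close> that
  depends on \<open>S\<close> only and lies in \<open>L\<^sup>p\<close>.  Thus \<open>ln \<bar>\<mu>\<bar>\<close> has a gradient in \<open>L\<^sup>p\<close> with \<open>p > d\<close>, so that
  Morrey's estimate makes it Hoelder continuous: a solution that is small somewhere is small nearby.
  Everything else follows from this.

  The linear equation for the gradient (\<open>stress_solution_gradient\<close>, \<open>wd_stress_solution\<close>) is obtained
  by testing with \<open>\<phi> Q\<close>, where \<open>Q\<close> is a column of \<open>S\<^sup>-\<^sup>1\<close>.  This field is weakly differentiable by the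
  chain rule (\<open>wd_chain\<close>), applied to the pair of \<open>S\<close> and \<open>det S\<close>.  The determinant has to keep
  away from zero with a constant sign for this; it does because it is a function in \<open>W\<^sup>1\<^sup>,\<^sup>p\<close>, hence
  continuous, on a connected set (\<open>det_constant_sign\<close>).  As \<open>\<phi> Q\<close> is not smooth, it has to be shown to
  be a limit of test functions (\<open>H10_compact_support\<close>).

  The logarithm is not available before it is known that \<open>\<mu>\<close> has no zeros.  But \<open>ln (\<mu>\<^sup>2 + e) / 2\<close> has a
  gradient bounded by \<open>\<bar>b\<bar>\<close>, uniformly in \<open>e > 0\<close>.  Morrey's estimate (\<open>morrey_wd\<close>) on a compact
  convex set \<open>K\<close> therefore yields, for \<open>e \<longlonglongrightarrow> 0\<close>, Harnack's inequality \<open>\<bar>\<mu> x\<bar> \<le> C \<bar>\<mu> y\<bar>\<close> for almost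
  all \<open>x\<close>, \<open>y\<close> in \<open>K\<close>, with a constant that depends on the diameter and the volume of \<open>K\<close> (\<open>harnack\<close>).
  In particular \<open>\<mu>\<close> is locally bounded, so \<open>\<nabla>\<mu> = \<mu> b\<close> is locally in \<open>L\<^sup>p\<close> and \<open>\<mu>\<close> is continuous; and
  its zero set is open and closed (\<open>zero_or_nowhere_zero\<close>).  If \<open>\<mu>\<close> and \<open>\<nu>\<close> are solutions, the
  combination \<open>\<mu>(x) \<nu> - \<nu>(x) \<mu>\<close> is a solution that vanishes at \<open>x\<close>, hence everywhere, so the space of
  solutions is at most one dimensional and a nonzero solution has a constant sign.

  A Lipschitz domain contains with every point \<open>x\<close> a compact convex set \<open>K \<ni> x\<close> whose volume is
  bounded from below (\<open>lipschitz_domain_cells\<close>).  Squaring Harnack's inequality and integrating over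
  \<open>K\<close> bounds \<open>\<mu>(x)\<^sup>2\<close> by the \<open>L\<^sup>2\<close> norm of \<open>\<mu>\<close>.  So \<open>\<mu>\<close> is bounded and \<open>\<mu> b\<close> is in \<open>L\<^sup>p\<close>.\<close>

section \<open>Smooth functions and mollifiers\<close>

abbreviation smooth :: "(real^'d::finite \<Rightarrow> 'b::real_normed_vector) \<Rightarrow> bool"
  where "smooth f \<equiv> \<forall>k. times_diff k f"

lemma partial_deriv_eq:
  assumes "(f has_derivative f') (at x)"
  shows "partial_deriv i f x = f' (axis i 1)"
  unfolding partial_deriv_def using frechet_derivative_at[OF assms] by simp

lemma has_derivative_partials:
  fixes f :: "real^'d::finite \<Rightarrow> 'b::real_normed_vector"
  assumes "f differentiable at x"
  shows "(f has_derivative (\<lambda>h. \<Sum>i\<in>UNIV. (h $ i) *\<^sub>R partial_deriv i f x)) (at x)"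
proof -
  have f: "(f has_derivative frechet_derivative f (at x)) (at x)"
    using assms frechet_derivative_works by blast
  then interpret linear "frechet_derivative f (at x)"
    by (rule has_derivative_linear)
  have "frechet_derivative f (at x) h = (\<Sum>i\<in>UNIV. (h $ i) *\<^sub>R partial_deriv i f x)" for h
  proof -
    have "frechet_derivative f (at x) h = frechet_derivative f (at x) (\<Sum>i\<in>UNIV. (h $ i) *\<^sub>R axis i 1)"
      by (simp add: basis_expansion flip: scalar_mult_eq_scaleR)
    then show ?thesis
      by (simp add: sum scale partial_deriv_def)
  qed
  with f show ?thesis
    by (metis (no_types, lifting) ext)
qed

lemma times_diff_continuous: "times_diff k f \<Longrightarrow> continuous_on UNIV f"
  by (cases k) (auto simp: continuous_on_eq_continuous_within
      intro: differentiable_imp_continuous_within)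

lemma times_diff_SucD: "times_diff (Suc k) f \<Longrightarrow> times_diff k f"
proof (induction k arbitrary: f)
  case 0
  then show ?case using times_diff_continuous[of "Suc 0" f] by simp
qed auto

lemma smoothD:
  assumes "smooth f"
  shows "continuous_on UNIV f" "f differentiable (at x)" "smooth (partial_deriv i f)"
  using assms times_diff_continuous times_diff.simps(2) by blast+

lemma times_diff_const: "times_diff k (\<lambda>x::real^'d::finite. c :: 'b::real_normed_vector)"
proof (induction k arbitrary: c)
  case (Suc k)
  have "partial_deriv i (\<lambda>x::real^'d. c) = (\<lambda>x. 0)" for i
    by (rule ext, subst partial_deriv_eq[OF has_derivative_const]) simp
  then show ?case using Suc by simp
qed simp

lemma times_diff_add:
  "times_diff k f \<Longrightarrow> times_diff k g \<Longrightarrow> times_diff k (\<lambda>x. f x + g x)"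
proof (induction k arbitrary: f g)
  case 0 then show ?case by (auto intro: continuous_intros)
next
  case (Suc k)
  have "partial_deriv i (\<lambda>x. f x + g x) = (\<lambda>x. partial_deriv i f x + partial_deriv i g x)" for i
  proof
    fix x
    have "(f has_derivative frechet_derivative f (at x)) (at x)"
         "(g has_derivative frechet_derivative g (at x)) (at x)"
      using Suc.prems by (auto simp flip: frechet_derivative_works)
    then show "partial_deriv i (\<lambda>x. f x + g x) x = partial_deriv i f x + partial_deriv i g x"
      by (subst partial_deriv_eq[OF has_derivative_add]) (auto simp: partial_deriv_def)
  qed
  with Suc show ?case by (auto intro!: differentiable_add)
qed

lemma partial_deriv_scaleR:
  assumes "f differentiable (at x)" "g differentiable (at x)"
  shows "partial_deriv i (\<lambda>x. f x *\<^sub>R g x) x =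
      f x *\<^sub>R partial_deriv i g x + partial_deriv i f x *\<^sub>R g x"
proof -
  have "(f has_derivative frechet_derivative f (at x)) (at x)"
       "(g has_derivative frechet_derivative g (at x)) (at x)"
    using assms frechet_derivative_works by auto
  from partial_deriv_eq[OF has_derivative_scaleR[OF this]] show ?thesis
    by (simp add: partial_deriv_def)
qed

lemma times_diff_scaleR:
  fixes f :: "real^'d::finite \<Rightarrow> real"
  shows "times_diff k f \<Longrightarrow> times_diff k g \<Longrightarrow> times_diff k (\<lambda>x. f x *\<^sub>R g x)"
proof (induction k arbitrary: f g)
  case 0 then show ?case by (auto intro: continuous_intros)
next
  case (Suc k)
  have "partial_deriv i (\<lambda>x. f x *\<^sub>R g x) =
      (\<lambda>x. f x *\<^sub>R partial_deriv i g x + partial_deriv i f x *\<^sub>R g x)" for i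
    by (rule ext) (use Suc.prems in \<open>auto intro!: partial_deriv_scaleR\<close>)
  moreover have "times_diff k f" "times_diff k g"
    using Suc.prems by (auto intro: times_diff_SucD simp del: times_diff.simps)
  ultimately show ?case
    using Suc by (auto intro!: times_diff_add differentiable_scaleR)
qed

text \<open>Differentiation leads from \<open>D n\<close> to \<open>D (Suc n)\<close>, so the claim for all derivatives of the outer function
  has to be proved at once.\<close>

lemma times_diff_compose:
  fixes q :: "real^'d::finite \<Rightarrow> real"
  assumes D: "\<And>n t. (D n has_real_derivative D (Suc n) t) (at t)" and q: "smooth q"
  shows "times_diff k (\<lambda>x. D n (q x))"
proof (induction k arbitrary: n)
  case 0
  have "continuous_on UNIV (D n)"
    by (meson D DERIV_continuous_on has_field_derivative_at_within)
  then show ?case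
    using smoothD(1)[OF q] by (auto intro: continuous_on_compose2)
next
  case (Suc k)
  have der: "((\<lambda>x. D n (q x)) has_derivative (\<lambda>h. D (Suc n) (q x) * frechet_derivative q (at x) h)) (at x)" for x
  proof -
    have "(q has_derivative frechet_derivative q (at x)) (at x)"
      using smoothD(2)[OF q] frechet_derivative_works by auto
    then have "((D n \<circ> q) has_derivative ((*) (D (Suc n) (q x))) \<circ> frechet_derivative q (at x)) (at x)"
      using D[of n "q x"] unfolding has_field_derivative_def by (intro diff_chain_at)
    then show ?thesis by (simp add: o_def)
  qed
  have "partial_deriv i (\<lambda>x. D n (q x)) = (\<lambda>x. D (Suc n) (q x) *\<^sub>R partial_deriv i q x)" for i
    by (rule ext, subst partial_deriv_eq[OF der]) (simp add: partial_deriv_def)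
  then show ?case
    using der smoothD(3)[OF q] Suc by (auto simp: differentiable_def intro!: times_diff_scaleR simp del: real_scaleR_def)
qed

text \<open>The function that is the exponential of \<open>-1/t\<close> for positive \<open>t\<close> and zero elsewhere is the
  source of all bump functions.  Each of its derivatives has the form
  \<open>p(1/t) exp(-1/t)\<close> with a polynomial \<open>p\<close>, so that all of them tend to zero at \<open>0\<close>.\<close>

primrec flat_poly :: "nat \<Rightarrow> real poly" where
  "flat_poly 0 = 1"
| "flat_poly (Suc n) = [:0, 0, 1:] * (flat_poly n - pderiv (flat_poly n))"

definition flat_exp :: "nat \<Rightarrow> real \<Rightarrow> real"
  where "flat_exp n t = (if t > 0 then poly (flat_poly n) (inverse t) * exp (- inverse t) else 0)"

lemma power_poly_div_exp_tendsto_0: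
  "((\<lambda>x::real. x ^ k * poly p x / exp x) \<longlongrightarrow> 0) at_top"
proof (induction p arbitrary: k)
  case (pCons a p)
  have "((\<lambda>x. a * (x ^ k / exp x) + x ^ Suc k * poly p x / exp x) \<longlongrightarrow> a * 0 + 0) at_top"
    by (intro tendsto_intros pCons.IH tendsto_power_div_exp_0)
  then show ?case by (simp add: field_simps)
qed simp

lemma flat_exp_derivative: "(flat_exp n has_real_derivative flat_exp (Suc n) t) (at t)"
proof (cases t "0::real" rule: linorder_cases)
  case greater
  let ?f = "\<lambda>t. poly (flat_poly n) (inverse t) * exp (- inverse t)"
  have "(?f has_real_derivative flat_exp (Suc n) t) (at t)"
    using greater
    by (auto intro!: derivative_eq_intros DERIV_chain'[OF _ poly_DERIV]
        simp: flat_exp_def power2_eq_square algebra_simps)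
  then show ?thesis
    by (rule has_field_derivative_transform_within_open[where S="{0<..}"])
      (use greater in \<open>auto simp: flat_exp_def\<close>)
next
  case less
  have "((\<lambda>t. 0::real) has_real_derivative 0) (at t)" by simp
  then have "(flat_exp n has_real_derivative 0) (at t)"
    by (rule has_field_derivative_transform_within_open[where S="{..<0}"])
      (use less in \<open>auto simp: flat_exp_def\<close>)
  then show ?thesis using less by (simp add: flat_exp_def)
next
  case equal
  have 1: "((\<lambda>h. flat_exp n h / h) \<longlongrightarrow> 0) (at_right 0)"
  proof -
    have "((\<lambda>x::real. x ^ 1 * poly (flat_poly n) x / exp x) \<longlongrightarrow> 0) at_top"
      by (rule power_poly_div_exp_tendsto_0)
    then have "((\<lambda>h::real. inverse h * poly (flat_poly n) (inverse h) / exp (inverse h)) \<longlongrightarrow> 0) (at_right 0)"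
      unfolding at_top_to_right filterlim_filtermap by simp
    then show ?thesis
      by (rule Lim_transform_eventually)
        (auto simp: eventually_at_filter flat_exp_def exp_minus field_simps)
  qed
  have 2: "((\<lambda>h. flat_exp n h / h) \<longlongrightarrow> 0) (at_left 0)"
    by (rule tendsto_eventually) (auto simp: eventually_at_filter flat_exp_def)
  have "((\<lambda>h. flat_exp n h / h) \<longlongrightarrow> 0) (at 0)"
    using 1 2 by (simp add: filterlim_split_at)
  then show ?thesis
    using equal by (simp add: DERIV_def flat_exp_def)
qed

lemma flat_exp_0: "flat_exp 0 t = (if t > 0 then exp (- inverse t) else 0)"
  by (simp add: flat_exp_def)

lemma smooth_affine: "smooth (\<lambda>x::real^'d::finite. a + b \<bullet> x :: real)"
proof
  fix k
  show "times_diff k (\<lambda>x::real^'d::finite. a + b \<bullet> x :: real)"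
  proof (cases k)
    case (Suc m)
    have der: "((\<lambda>x::real^'d. a + b \<bullet> x) has_derivative (\<lambda>h. b \<bullet> h)) (at x)" for x
      by (auto intro!: derivative_eq_intros)
    have "partial_deriv i (\<lambda>x::real^'d. a + b \<bullet> x) = (\<lambda>x. b \<bullet> axis i 1)" for i
      by (rule ext, subst partial_deriv_eq[OF der]) simp
    then show ?thesis
      using der by (auto simp: Suc times_diff_const differentiable_def)
  qed (auto intro!: continuous_intros)
qed

lemma smooth_square_norm: "smooth (\<lambda>x::real^'d::finite. a + b * (x \<bullet> x) :: real)"
proof
  fix k
  show "times_diff k (\<lambda>x::real^'d::finite. a + b * (x \<bullet> x) :: real)"
  proof (cases k)
    case (Suc m)
    have der: "((\<lambda>x::real^'d. a + b * (x \<bullet> x)) has_derivative (\<lambda>h. b * (2 * (x \<bullet> h)))) (at x)" for x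
      by (auto intro!: derivative_eq_intros simp: inner_commute)
    have "partial_deriv i (\<lambda>x::real^'d. a + b * (x \<bullet> x)) = (\<lambda>x. 0 + (2 * b) *\<^sub>R axis i 1 \<bullet> x)" for i
      by (rule ext, subst partial_deriv_eq[OF der]) (simp add: inner_commute)
    then show ?thesis
      using der smooth_affine[of 0] by (auto simp: Suc differentiable_def simp del: inner_scaleR_left)
  qed (auto intro!: continuous_intros)
qed

lemma test_functionsD:
  assumes "\<phi> \<in> test_functions \<Omega>"
  shows "smooth \<phi>" "compact (closure {x. \<phi> x \<noteq> 0})" "closure {x. \<phi> x \<noteq> 0} \<subseteq> \<Omega>"
  using assms by (simp_all add: test_functions_def)

lemma test_functionsI:
  assumes "smooth \<phi>" "compact K" "K \<subseteq> \<Omega>" "\<And>x. x \<notin> K \<Longrightarrow> \<phi> x = 0"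
  shows "\<phi> \<in> test_functions \<Omega>"
proof -
  have "{x. \<phi> x \<noteq> 0} \<subseteq> K" using assms(4) by blast
  then have *: "closure {x. \<phi> x \<noteq> 0} \<subseteq> K"
    using compact_imp_closed[OF assms(2)] by (rule closure_minimal)
  have "compact (K \<inter> closure {x. \<phi> x \<noteq> 0})"
    using assms(2) by (intro compact_Int_closed) auto
  then have c: "compact (closure {x. \<phi> x \<noteq> 0})"
    using * by (simp add: Int_absorb1)
  show ?thesis
    unfolding test_functions_def
    by (intro CollectI conjI) (rule assms(1) c order_trans[OF * assms(3)])+
qed

lemma test_functions_support:
  assumes "\<phi> \<in> test_functions \<Omega>" "x \<notin> closure {x. \<phi> x \<noteq> 0}"
  shows "\<phi> x = 0" "partial_deriv i \<phi> x = 0"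
proof -
  let ?U = "- closure {x. \<phi> x \<noteq> 0}"
  have z: "0 = \<phi> y" if "y \<in> ?U" for y
    using that closure_subset[of "{x. \<phi> x \<noteq> 0}"] by fastforce
  have x: "x \<in> ?U" using assms(2) by blast
  show "\<phi> x = 0" using z[OF x] by (rule sym)
  have "((\<lambda>y. 0) has_derivative (\<lambda>h. 0)) (at x)" by simp
  then have "(\<phi> has_derivative (\<lambda>h. 0)) (at x)"
    by (rule has_derivative_transform_within_open[OF _ _ x z]) (rule open_Compl, rule closed_closure)
  then show "partial_deriv i \<phi> x = 0" by (subst partial_deriv_eq) auto
qed

lemma test_functions_partial:
  assumes "\<phi> \<in> test_functions \<Omega>"
  shows "partial_deriv i \<phi> \<in> test_functions \<Omega>"
proof (rule test_functionsI)
  show "smooth (partial_deriv i \<phi>)"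
    by (rule smoothD(3)[OF test_functionsD(1)[OF assms]])
qed (use test_functionsD(2,3)[OF assms] test_functions_support(2)[OF assms] in blast)+

lemma test_functions_scaleR:
  fixes \<phi> :: "real^'d::finite \<Rightarrow> real"
  assumes "\<phi> \<in> test_functions \<Omega>" "smooth g"
  shows "(\<lambda>x. \<phi> x *\<^sub>R g x) \<in> test_functions \<Omega>"
proof (rule test_functionsI)
  show "smooth (\<lambda>x. \<phi> x *\<^sub>R g x)"
    using test_functionsD(1)[OF assms(1)] assms(2) times_diff_scaleR by blast
  show "\<phi> x *\<^sub>R g x = 0" if "x \<notin> closure {x. \<phi> x \<noteq> 0}" for x
    using test_functions_support(1)[OF assms(1) that] by simp
qed (use test_functionsD(2,3)[OF assms(1)] in auto)

lemma integrable_continuous_compact_support: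
  fixes f :: "'a::euclidean_space \<Rightarrow> 'b::euclidean_space"
  assumes "continuous_on UNIV f" "compact K" "\<And>x. x \<notin> K \<Longrightarrow> f x = 0"
  shows "integrable lborel f"
proof -
  have "integrable lborel (\<lambda>x. indicator K x *\<^sub>R f x)"
    using assms by (intro borel_integrable_compact) (auto intro: continuous_on_subset)
  moreover have "(\<lambda>x. indicator K x *\<^sub>R f x) = f"
    using assms(3) by (auto simp: indicator_def)
  ultimately show ?thesis by simp
qed

lemma bounded_continuous_compact_support:
  fixes f :: "'a::euclidean_space \<Rightarrow> 'b::euclidean_space"
  assumes "continuous_on UNIV f" "compact K" "\<And>x. x \<notin> K \<Longrightarrow> f x = 0"
  obtains B where "B \<ge> 0" "\<And>x. norm (f x) \<le> B"
proof -
  have "bounded (f ` K)"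
    using assms by (meson compact_continuous_image compact_imp_bounded continuous_on_subset subset_UNIV)
  then obtain B where "\<And>x. x \<in> K \<Longrightarrow> norm (f x) \<le> B"
    by (auto simp: bounded_iff)
  then have "norm (f x) \<le> max B 0" for x
    using assms(3)[of x] by (cases "x \<in> K") (auto simp: le_max_iff_disj)
  then show ?thesis using that[of "max B 0"] by auto
qed

lemma test_function_bounded:
  fixes \<phi> :: "real^'d::finite \<Rightarrow> 'b::euclidean_space"
  assumes "\<phi> \<in> test_functions \<Omega>"
  obtains B where "B \<ge> 0" "\<And>x. norm (\<phi> x) \<le> B" "\<And>x i. norm (partial_deriv i \<phi> x) \<le> B"
proof -
  have "\<exists>B\<ge>0. \<forall>x. norm (\<psi> x) \<le> B" if "\<psi> \<in> test_functions \<Omega>" for \<psi> :: "real^'d::finite \<Rightarrow> 'b"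
    using bounded_continuous_compact_support[OF smoothD(1) test_functionsD(2), OF test_functionsD(1)]
      that test_functions_support(1)[OF that] by metis
  note * = this
  obtain A where A: "A \<ge> 0" "\<And>x. norm (\<phi> x) \<le> A"
    using *[OF assms] by blast
  have "\<forall>i. \<exists>B\<ge>0. \<forall>x. norm (partial_deriv i \<phi> x) \<le> B"
    using *[OF test_functions_partial[OF assms]] by blast
  then obtain C where C: "\<And>i. C i \<ge> 0" "\<And>x i. norm (partial_deriv i \<phi> x) \<le> C i"
    by metis
  have "C i \<le> A + sum C UNIV" for i
    using A(1) C(1) by (simp add: add_increasing member_le_sum)
  then show ?thesis
    using that[of "A + sum C UNIV"] A C by (meson add_increasing2 order_trans sum_nonneg)
qed

lemma test_function_integrable:
  fixes \<phi> :: "real^'d::finite \<Rightarrow> 'b::euclidean_space"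
  assumes "\<phi> \<in> test_functions \<Omega>"
  shows "integrable lborel \<phi>"
  using integrable_continuous_compact_support[OF smoothD(1) test_functionsD(2)]
    assms test_functionsD(1)[OF assms] test_functions_support(1)[OF assms] by blast

lemma test_function_measurable [measurable_dest]:
  fixes \<phi> :: "real^'d::finite \<Rightarrow> 'b::euclidean_space"
  assumes "\<phi> \<in> test_functions \<Omega>"
  shows "\<phi> \<in> borel_measurable borel"
  using borel_measurable_continuous_onI smoothD(1) test_functionsD(1)[OF assms] by blast

text \<open>The bridge between almost everywhere statements and continuity, which produces nonempty open sets.\<close>

lemma AE_point_in_open:
  fixes U :: "'a::euclidean_space set"
  assumes "open U" "U \<noteq> {}" "AE x in lborel. x \<in> U \<longrightarrow> P x"
  obtains x where "x \<in> U" "P x"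
proof (rule ccontr)
  assume "\<not> thesis"
  then have "AE x in lborel. x \<notin> U"
    using assms(3) that by (auto elim: eventually_mono)
  then have "U \<in> null_sets lborel"
    using assms(1) by (subst AE_iff_null_sets) auto
  then show False
    using assms open_not_negligible null_sets_completionI negligible_iff_null_sets
    by (metis)
qed

definition mollifier :: "real \<Rightarrow> (real^'d::finite \<Rightarrow> real) \<Rightarrow> bool"
  where "mollifier r \<rho> \<longleftrightarrow> \<rho> \<in> test_functions UNIV \<and> (\<forall>x. \<rho> x \<ge> 0) \<and>
     (\<forall>x. norm x \<ge> r \<longrightarrow> \<rho> x = 0) \<and> integral\<^sup>L lborel \<rho> = 1"

lemma mollifier_exists:
  assumes "r > 0"
  shows "\<exists>\<rho> :: real^'d::finite \<Rightarrow> real. mollifier r \<rho>"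
proof -
  define \<psi> :: "real^'d \<Rightarrow> real" where "\<psi> x = flat_exp 0 (r\<^sup>2 + (-1) * (x \<bullet> x))" for x
  have sm: "smooth \<psi>"
    unfolding \<psi>_def by (intro allI times_diff_compose[where D=flat_exp] flat_exp_derivative smooth_square_norm)
  have supp: "\<psi> x = 0" if "norm x \<ge> r" for x
    using that assms power_mono[of r "norm x" 2] by (auto simp: \<psi>_def flat_exp_0 power2_norm_eq_inner)
  have pos: "\<psi> x > 0" if "norm x < r" for x
    using that assms power_strict_mono[of "norm x" r 2] by (auto simp: \<psi>_def flat_exp_0 power2_norm_eq_inner)
  have nonneg: "\<psi> x \<ge> 0" for x by (auto simp: \<psi>_def flat_exp_0)
  have test: "\<psi> \<in> test_functions UNIV"
  proof (rule test_functionsI[OF sm])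
    show "\<psi> x = 0" if "x \<notin> cball 0 r" for x using that by (intro supp) auto
  qed auto
  have int: "integrable lborel \<psi>" by (rule test_function_integrable[OF test])
  have "integral\<^sup>L lborel \<psi> \<noteq> 0"
  proof
    assume "integral\<^sup>L lborel \<psi> = 0"
    then have "AE x in lborel. \<psi> x = 0"
      using integral_nonneg_eq_0_iff_AE[OF int] nonneg by simp
    then have "AE x in lborel. x \<in> ball 0 r \<longrightarrow> \<psi> x = 0" by auto
    then obtain x where "x \<in> ball 0 r" "\<psi> x = 0"
      using AE_point_in_open[of "ball (0::real^'d) r" "\<lambda>x. \<psi> x = 0"] assms by auto
    then show False using pos by fastforce
  qed
  then have I: "integral\<^sup>L lborel \<psi> > 0"
    using nonneg by (metis Bochner_Integration.integral_nonneg order_le_less)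
  have "(\<lambda>x. \<psi> x *\<^sub>R (1 / integral\<^sup>L lborel \<psi>)) \<in> test_functions UNIV"
    by (rule test_functions_scaleR[OF test]) (simp add: times_diff_const)
  then have "mollifier r (\<lambda>x. \<psi> x *\<^sub>R (1 / integral\<^sup>L lborel \<psi>))"
    unfolding mollifier_def
    using I by (intro conjI) (simp_all add: nonneg supp)
  then show ?thesis by blast
qed

definition moll :: "nat \<Rightarrow> real^'d::finite \<Rightarrow> real"
  where "moll n = (SOME \<rho>. mollifier (inverse (real (Suc n))) \<rho>)"

lemma mollifier_moll: "mollifier (inverse (real (Suc n))) (moll n)"
  unfolding moll_def by (rule someI_ex[OF mollifier_exists]) simp

lemma moll_test: "moll n \<in> test_functions UNIV"
  and moll_nonneg: "moll n x \<ge> 0"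
  and moll_eq_0: "norm x \<ge> inverse (real (Suc n)) \<Longrightarrow> moll n x = 0"
  and integral_moll: "integral\<^sup>L lborel (moll n) = 1"
  using mollifier_moll[of n] by (auto simp: mollifier_def)

lemma moll_measurable [measurable]: "moll n \<in> borel_measurable borel"
  by (rule test_function_measurable[OF moll_test])

lemma moll_integrable: "integrable lborel (moll n)"
  by (rule test_function_integrable[OF moll_test])

lemma nn_integral_moll: "(\<integral>\<^sup>+x. ennreal (moll n x) \<partial>lborel) = 1"
  by (subst nn_integral_eq_integral) (auto simp: moll_integrable moll_nonneg integral_moll)

section \<open>Convolution with a mollifier\<close>

lemma lborel_distr_reflect:
  "distr lborel borel (\<lambda>x::'a::euclidean_space. c - x) = lborel"
  using lborel_affine[of "-1" c] by (simp add: density_1)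

lemma integral_reflect_borel:
  fixes f :: "'a::euclidean_space \<Rightarrow> 'b::euclidean_space"
  assumes [measurable]: "f \<in> borel_measurable borel"
  shows "(LBINT x. f (c - x)) = (LBINT x. f x)"
  by (subst (2) lborel_distr_reflect[symmetric, of c]) (simp add: integral_distr)

lemma integrable_reflect_borel:
  fixes f :: "'a::euclidean_space \<Rightarrow> 'b::euclidean_space"
  assumes "integrable lborel f"
  shows "integrable lborel (\<lambda>x. f (c - x))"
proof -
  have "integrable (distr lborel borel (\<lambda>x. c - x)) f"
    using assms by (simp add: lborel_distr_reflect)
  then show ?thesis by (rule integrable_distr[rotated]) simp
qed

lemma lborel_distr_shift:
  "distr lborel borel (\<lambda>x::'a::euclidean_space. x - c) = lborel"
proof -
  have "(+) (- c) = (\<lambda>x. x - c)" by auto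
  then show ?thesis using lborel_distr_plus[of "-c"] by simp
qed

lemma nn_integral_shift:
  fixes f :: "'a::euclidean_space \<Rightarrow> ennreal"
  assumes [measurable]: "f \<in> borel_measurable borel"
  shows "(\<integral>\<^sup>+x. f (x - c) \<partial>lborel) = (\<integral>\<^sup>+x. f x \<partial>lborel)"
  by (subst (2) lborel_distr_shift[symmetric, of c]) (simp add: nn_integral_distr)

lemma integral_shift_borel:
  fixes f :: "'a::euclidean_space \<Rightarrow> 'b::euclidean_space"
  assumes [measurable]: "f \<in> borel_measurable borel"
  shows "(LBINT x. f (x - c)) = (LBINT x. f x)"
  by (subst (2) lborel_distr_shift[symmetric, of c]) (simp add: integral_distr)

lemma integrable_shift_borel:
  fixes f :: "'a::euclidean_space \<Rightarrow> 'b::euclidean_space"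
  assumes "integrable lborel f"
  shows "integrable lborel (\<lambda>x. f (x - c))"
proof -
  have "integrable (distr lborel borel (\<lambda>x. x - c)) f"
    using assms by (simp add: lborel_distr_shift)
  then show ?thesis by (rule integrable_distr[rotated]) simp
qed

subsection \<open>Continuity of translations in the mean\<close>

text \<open>The limit is taken along sequences of translations, to which dominated convergence applies.\<close>

definition L1_shift_continuous :: "('a::euclidean_space \<Rightarrow> 'b::euclidean_space) \<Rightarrow> bool"
  where "L1_shift_continuous f \<longleftrightarrow> (\<forall>Z. Z \<longlonglongrightarrow> 0 \<longrightarrow>
     (\<lambda>n::nat. LBINT x. norm (f (x - Z n) - f x)) \<longlonglongrightarrow> 0)"

text \<open>Translation preserves the distance of \<open>f\<close> and \<open>g\<close> in the mean, so that the property is inherited by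
  limits.\<close>

lemma L1_shift_continuous_approx:
  fixes f :: "'a::euclidean_space \<Rightarrow> 'b::euclidean_space"
  assumes f: "integrable lborel f"
    and approx: "\<And>e. e > 0 \<Longrightarrow>
      \<exists>g. integrable lborel g \<and> L1_shift_continuous g \<and> (LBINT x. norm (f x - g x)) \<le> e"
  shows "L1_shift_continuous f"
  unfolding L1_shift_continuous_def
proof (intro allI impI)
  fix Z :: "nat \<Rightarrow> 'a" assume Z: "Z \<longlonglongrightarrow> 0"
  show "(\<lambda>n. LBINT x. norm (f (x - Z n) - f x)) \<longlonglongrightarrow> 0"
  proof (rule tendstoI)
    fix e :: real assume "e > 0"
    then obtain g where g: "integrable lborel g" "L1_shift_continuous g"
      and fg: "(LBINT x. norm (f x - g x)) \<le> e/4"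
      using approx[of "e/4"] by auto
    have [measurable]: "f \<in> borel_measurable borel" "g \<in> borel_measurable borel"
      using f g by auto
    have ev: "\<forall>\<^sub>F n in sequentially. dist (LBINT x. norm (g (x - Z n) - g x)) 0 < e/4"
    proof (rule tendstoD)
      show "(\<lambda>n. LBINT x. norm (g (x - Z n) - g x)) \<longlonglongrightarrow> 0"
        using g(2) Z unfolding L1_shift_continuous_def by blast
    qed (use \<open>e > 0\<close> in simp)
    show "\<forall>\<^sub>F n in sequentially. dist (LBINT x. norm (f (x - Z n) - f x)) 0 < e"
      using ev
    proof eventually_elim
      case (elim n)
      let ?h = "\<lambda>x. norm (f x - g x)"
      have fgi: "integrable lborel ?h" using f g by auto
      note i = integrable_shift_borel[OF f, of "Z n"] integrable_shift_borel[OF g(1), of "Z n"]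
        integrable_shift_borel[OF fgi, of "Z n"]
      have "(LBINT x. norm (f (x - Z n) - f x)) \<le>
          (LBINT x. (?h (x - Z n) + norm (g (x - Z n) - g x)) + ?h x)"
      proof (rule integral_mono)
        show "norm (f (x - Z n) - f x) \<le> (?h (x - Z n) + norm (g (x - Z n) - g x)) + ?h x" for x
        proof -
          have eq: "f (x - Z n) - f x = (f (x - Z n) - g (x - Z n)) + (g (x - Z n) - g x) + (g x - f x)"
            by simp
          show ?thesis
            unfolding eq by (intro order_trans[OF norm_triangle_ineq] add_mono order_refl) (simp add: norm_minus_commute)
        qed
      qed (use f g i in auto)
      also have "\<dots> = (LBINT x. ?h (x - Z n)) + (LBINT x. norm (g (x - Z n) - g x)) + (LBINT x. ?h x)"
        using f g i fgi by simp
      also have "(LBINT x. ?h (x - Z n)) = (LBINT x. ?h x)"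
        by (rule integral_shift_borel) measurable
      also have "(LBINT x. ?h x) + (LBINT x. norm (g (x - Z n) - g x)) + (LBINT x. ?h x) < e"
        using elim fg \<open>e > 0\<close> by simp
      finally show ?case by simp
    qed
  qed
qed

lemma L1_shift_continuous_open:
  fixes c :: "'b::euclidean_space" and U :: "'a::euclidean_space set"
  assumes U: "open U" and fin: "emeasure lborel U < \<infinity>"
  shows "L1_shift_continuous (\<lambda>x. indicat_real U x *\<^sub>R c)"
  unfolding L1_shift_continuous_def
proof (intro allI impI)
  fix Z :: "nat \<Rightarrow> 'a" assume Z: "Z \<longlonglongrightarrow> 0"
  have [measurable]: "U \<in> sets borel" using U by simp
  let ?u = "indicat_real U"
  have iu: "integrable lborel ?u" using fin by (simp add: integrable_indicator_iff)
  note ius = integrable_shift_borel[OF iu]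
  \<comment> \<open>The two functions have the same integral, so that only the positive part of the difference matters.\<close>
  have "(LBINT x. norm (?u (x - Z n) *\<^sub>R c - ?u x *\<^sub>R c)) = 2 * norm c * (LBINT x. max 0 (?u x - ?u (x - Z n)))" for n
  proof -
    have "(LBINT x. norm (?u (x - Z n) *\<^sub>R c - ?u x *\<^sub>R c)) =
       (LBINT x. norm c * (2 * max 0 (?u x - ?u (x - Z n)) + (?u (x - Z n) - ?u x)))"
      by (rule Bochner_Integration.integral_cong) (auto simp: indicator_def)
    also have "\<dots> = norm c * (2 * (LBINT x. max 0 (?u x - ?u (x - Z n))) + ((LBINT x. ?u (x - Z n)) - (LBINT x. ?u x)))"
      using iu ius[of "Z n"] by simp
    also have "(LBINT x. ?u (x - Z n)) = (LBINT x. ?u x)"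
      by (rule integral_shift_borel) measurable
    finally show ?thesis by simp
  qed
  moreover have "(\<lambda>n. LBINT x. max 0 (?u x - ?u (x - Z n))) \<longlonglongrightarrow> (LBINT x::'a. 0)"
  proof (rule integral_dominated_convergence[where w="?u"])
    show "AE x in lborel. (\<lambda>n. max 0 (?u x - ?u (x - Z n))) \<longlonglongrightarrow> 0"
    proof (rule AE_I2)
      fix x
      show "(\<lambda>n. max 0 (?u x - ?u (x - Z n))) \<longlonglongrightarrow> 0"
      proof (cases "x \<in> U")
        case True
        have "(\<lambda>n. x - Z n) \<longlonglongrightarrow> x - 0" by (intro tendsto_intros Z)
        then have "\<forall>\<^sub>F n in sequentially. x - Z n \<in> U"
          using U True by (auto simp: tendsto_def)
        then show ?thesis
          using True by (intro tendsto_eventually) (auto elim!: eventually_mono)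
      qed (simp add: indicator_def)
    qed
  qed (use iu in \<open>auto simp: indicator_def\<close>)
  ultimately show "(\<lambda>n. LBINT x. norm (?u (x - Z n) *\<^sub>R c - ?u x *\<^sub>R c)) \<longlonglongrightarrow> 0"
    by (simp add: tendsto_mult_right_zero)
qed

text \<open>Outer regularity reduces indicator functions of Borel sets to those of open sets; linear
  combinations and limits exhaust the integrable functions.\<close>

lemma L1_shift_continuous:
  fixes f :: "'a::euclidean_space \<Rightarrow> 'b::euclidean_space"
  assumes "integrable lborel f"
  shows "L1_shift_continuous f"
  using assms
proof (induction rule: integrable_induct)
  case (base A c)
  have A: "A \<in> sets borel" using base by simp
  show ?case
  proof (rule L1_shift_continuous_approx)
    show "integrable lborel (\<lambda>x. indicat_real A x *\<^sub>R c)" using base by simp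
    fix e :: real assume e: "e > 0"
    define d where "d = e / (norm c + 1)"
    have d: "d > 0" using e by (auto simp: d_def intro!: divide_pos_pos add_nonneg_pos)
    obtain U where U: "open U" "A \<subseteq> U" "emeasure lborel (U - A) < ennreal d"
      using outer_regular_lborel[OF A, of d] d by auto
    have fin: "emeasure lborel U < \<infinity>"
    proof -
      have "emeasure lborel U = emeasure lborel A + emeasure lborel (U - A)"
        using U A by (subst plus_emeasure) (auto simp: Un_absorb1 intro!: arg_cong2[where f=emeasure])
      then show ?thesis using base(2) U(3) by (auto simp: less_top[symmetric])
    qed
    have "(LBINT x. norm (indicat_real A x *\<^sub>R c - indicat_real U x *\<^sub>R c)) = (LBINT x. norm c * indicat_real (U - A) x)"
      by (rule Bochner_Integration.integral_cong) (use U(2) in \<open>auto simp: indicator_def\<close>)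
    also have "\<dots> = norm c * measure lborel (U - A)" by simp
    also have "\<dots> \<le> norm c * d"
      using U(3) d by (intro mult_left_mono) (auto simp: measure_def enn2real_leI)
    also have "\<dots> \<le> e"
    proof -
      have "norm c + 1 > 0" by (simp add: add_nonneg_pos)
      moreover have "norm c * e \<le> (norm c + 1) * e" by (rule mult_right_mono) (use e in auto)
      ultimately show ?thesis by (simp add: d_def pos_divide_le_eq mult.commute)
    qed
    finally show "\<exists>g. integrable lborel g \<and> L1_shift_continuous g \<and>
        (LBINT x. norm (indicat_real A x *\<^sub>R c - g x)) \<le> e"
      using L1_shift_continuous_open[OF U(1) fin, of c] fin U(1)
      by (intro exI[of _ "\<lambda>x. indicat_real U x *\<^sub>R c"]) auto
  qed
next
  case (add f g)
  show ?case
    unfolding L1_shift_continuous_def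
  proof (intro allI impI)
    fix Z :: "nat \<Rightarrow> 'a" assume Z: "Z \<longlonglongrightarrow> 0"
    note i = integrable_shift_borel[OF add(1)] integrable_shift_borel[OF add(2)] add(1,2)
    have lim: "(\<lambda>n. (LBINT x. norm (f (x - Z n) - f x)) + (LBINT x. norm (g (x - Z n) - g x))) \<longlonglongrightarrow> 0 + 0"
      using add Z unfolding L1_shift_continuous_def by (intro tendsto_add) auto
    show "(\<lambda>n. LBINT x. norm (f (x - Z n) + g (x - Z n) - (f x + g x))) \<longlonglongrightarrow> 0"
    proof (rule tendsto_sandwich[OF _ _ tendsto_const])
      have "(LBINT x. norm (f (x - Z n) + g (x - Z n) - (f x + g x))) \<le>
        (LBINT x. norm (f (x - Z n) - f x) + norm (g (x - Z n) - g x))" for n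
        by (rule integral_mono) (use i in \<open>auto simp: norm_diff_triangle_ineq\<close>)
      then show "\<forall>\<^sub>F n in sequentially. (LBINT x. norm (f (x - Z n) + g (x - Z n) - (f x + g x))) \<le>
        (LBINT x. norm (f (x - Z n) - f x)) + (LBINT x. norm (g (x - Z n) - g x))"
        using i by (intro always_eventually allI) simp
      show "(\<lambda>n. (LBINT x. norm (f (x - Z n) - f x)) + (LBINT x. norm (g (x - Z n) - g x))) \<longlonglongrightarrow> 0"
        using lim by simp
    qed simp
  qed
next
  case (lim f s)
  have [measurable]: "f \<in> borel_measurable borel" "s i \<in> borel_measurable borel" for i
    using lim by auto
  have s_lim: "(\<lambda>i. s i x) \<longlonglongrightarrow> f x" and s_bound: "norm (s i x) \<le> 2 * norm (f x)"
    and s_int: "integrable lborel (s i)" and s_IH: "L1_shift_continuous (s i)"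
    and f_int: "integrable lborel f" for i x
    using lim by simp_all
  have "(\<lambda>i. LBINT x. norm (f x - s i x)) \<longlonglongrightarrow> (LBINT x::'a. 0)"
  proof (rule integral_dominated_convergence[where w="\<lambda>x. 3 * norm (f x)"])
    show "AE x in lborel. (\<lambda>i. norm (f x - s i x)) \<longlonglongrightarrow> 0"
      by (intro AE_I2 tendsto_norm_zero) (auto intro!: tendsto_eq_intros s_lim)
    have "norm (f x - s i x) \<le> 3 * norm (f x)" for i x
      using s_bound[of i x] norm_triangle_ineq4[of "f x" "s i x"] by simp
    then show "AE x in lborel. norm (norm (f x - s i x)) \<le> 3 * norm (f x)" for i by simp
  qed (use f_int in auto)
  then have l: "(\<lambda>i. LBINT x. norm (f x - s i x)) \<longlonglongrightarrow> 0" by simp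
  show ?case
  proof (rule L1_shift_continuous_approx[OF f_int])
    fix e :: real assume "e > 0"
    with l have "\<forall>\<^sub>F i in sequentially. (LBINT x. norm (f x - s i x)) < e"
      by (rule order_tendstoD)
    then obtain i where "(LBINT x. norm (f x - s i x)) < e"
      using eventually_happens'[OF sequentially_bot] by blast
    then show "\<exists>g. integrable lborel g \<and> L1_shift_continuous g \<and> (LBINT x. norm (f x - g x)) \<le> e"
      using s_int s_IH by (intro exI[of _ "s i"]) auto
  qed
qed

lemma norm_three_squares:
  fixes a b c :: "'a::real_inner"
  shows "(norm (a + b + c))\<^sup>2 \<le> 3 * ((norm a)\<^sup>2 + (norm b)\<^sup>2 + (norm c)\<^sup>2)"
proof -
  have "(norm (a + b + c))\<^sup>2 \<le> (norm a + norm b + norm c)\<^sup>2"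
    by (intro power_mono order_trans[OF norm_triangle_ineq] add_mono norm_triangle_ineq order_refl) simp
  also have "\<dots> \<le> 3 * ((norm a)\<^sup>2 + (norm b)\<^sup>2 + (norm c)\<^sup>2)"
    using sum_squares_bound[of "norm a" "norm b"] sum_squares_bound[of "norm a" "norm c"]
      sum_squares_bound[of "norm b" "norm c"] by (simp add: power2_eq_square algebra_simps)
  finally show ?thesis .
qed

text \<open>Square integrable functions reduce to bounded ones, for which the squared \<open>L\<^sup>2\<close> distance is
  controlled by the \<open>L\<^sup>1\<close> distance.\<close>

lemma L2_shift_continuous:
  fixes f :: "'a::euclidean_space \<Rightarrow> 'b::euclidean_space"
  assumes f: "integrable lborel f" and f2: "integrable lborel (\<lambda>x. (norm (f x))\<^sup>2)"
    and Z: "Z \<longlonglongrightarrow> 0"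
  shows "(\<lambda>n. LBINT x. (norm (f (x - Z n) - f x))\<^sup>2) \<longlonglongrightarrow> 0"
proof (rule tendstoI)
  fix e :: real assume e: "e > 0"
  have [measurable]: "f \<in> borel_measurable borel" using f by auto
  define g where "g m x = (if norm (f x) \<le> real m then f x else 0)" for m x
  have [measurable]: "g m \<in> borel_measurable borel" for m unfolding g_def by measurable
  have "(\<lambda>m. LBINT x. (norm (f x - g m x))\<^sup>2) \<longlonglongrightarrow> (LBINT x::'a. 0)"
  proof (rule integral_dominated_convergence[OF _ _ f2])
    show "AE x in lborel. (\<lambda>m. (norm (f x - g m x))\<^sup>2) \<longlonglongrightarrow> 0"
    proof (rule AE_I2)
      fix x
      obtain m0 where "norm (f x) \<le> real m0" using real_arch_simple by blast
      then have "\<forall>\<^sub>F m in sequentially. g m x = f x"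
        unfolding eventually_sequentially by (intro exI[of _ m0]) (auto simp: g_def)
      then show "(\<lambda>m. (norm (f x - g m x))\<^sup>2) \<longlonglongrightarrow> 0"
        by (intro tendsto_eventually) (auto elim!: eventually_mono)
    qed
  qed (auto simp: g_def)
  then have "(\<lambda>m. LBINT x. (norm (f x - g m x))\<^sup>2) \<longlonglongrightarrow> 0" by simp
  then have "\<forall>\<^sub>F m in sequentially. (LBINT x. (norm (f x - g m x))\<^sup>2) < e/12"
    using e by (intro order_tendstoD) auto
  then obtain m where m: "(LBINT x. (norm (f x - g m x))\<^sup>2) < e/12"
    using eventually_happens'[OF sequentially_bot] by blast
  let ?h = "\<lambda>x. (norm (f x - g m x))\<^sup>2"
  have gi: "integrable lborel (g m)"
    by (rule Bochner_Integration.integrable_bound[OF f]) (auto simp: g_def)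
  have hi: "integrable lborel ?h"
    by (rule Bochner_Integration.integrable_bound[OF f2]) (auto simp: g_def)
  have "(\<lambda>n. LBINT x. norm (g m (x - Z n) - g m x)) \<longlonglongrightarrow> 0"
    using L1_shift_continuous[OF gi] Z by (auto simp: L1_shift_continuous_def)
  then have "\<forall>\<^sub>F n in sequentially. (LBINT x. norm (g m (x - Z n) - g m x)) < e / (12 * (real m + 1))"
    using e by (intro order_tendstoD) auto
  then show "\<forall>\<^sub>F n in sequentially. dist (LBINT x. (norm (f (x - Z n) - f x))\<^sup>2) 0 < e"
  proof eventually_elim
    case (elim n)
    note i = integrable_shift_borel[OF hi, of "Z n"] integrable_shift_borel[OF gi, of "Z n"]
      integrable_shift_borel[OF f2, of "Z n"]
    let ?R = "\<lambda>x. 3 * (?h (x - Z n) + 2 * real m * norm (g m (x - Z n) - g m x) + ?h x)"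
    have pt: "(norm (f (x - Z n) - f x))\<^sup>2 \<le> ?R x" for x
    proof -
      let ?a = "f (x - Z n) - g m (x - Z n)" and ?b = "g m (x - Z n) - g m x" and ?c = "g m x - f x"
      have "norm ?b \<le> 2 * real m"
        using norm_triangle_ineq4[of "g m (x - Z n)" "g m x"] by (auto simp: g_def split: if_splits)
      then have "(norm ?b)\<^sup>2 \<le> 2 * real m * norm ?b"
        unfolding power2_eq_square by (intro mult_right_mono) auto
      then show ?thesis
        using norm_three_squares[of ?a ?b ?c] by (simp add: norm_minus_commute)
    qed
    have Ri: "integrable lborel ?R" using i hi gi by auto
    have "(LBINT x. (norm (f (x - Z n) - f x))\<^sup>2) \<le> (LBINT x. ?R x)"
      using pt by (intro integral_mono Ri Bochner_Integration.integrable_bound[OF Ri]) (auto intro: order_trans)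
    also have "\<dots> = 3 * ((LBINT x. ?h (x - Z n)) + 2 * real m * (LBINT x. norm (g m (x - Z n) - g m x)) + (LBINT x. ?h x))"
      using i hi gi by simp
    also have "(LBINT x. ?h (x - Z n)) = (LBINT x. ?h x)"
      by (rule integral_shift_borel) measurable
    also have "3 * ((LBINT x. ?h x) + 2 * real m * (LBINT x. norm (g m (x - Z n) - g m x)) + (LBINT x. ?h x)) < e"
    proof -
      have "2 * real m * (LBINT x. norm (g m (x - Z n) - g m x)) \<le> 2 * real m * (e / (12 * (real m + 1)))"
        using elim by (intro mult_left_mono) auto
      also have "\<dots> \<le> e / 6" using e by (simp add: field_simps)
      finally show ?thesis using m by (simp add: field_simps)
    qed
    finally show ?case by simp
  qed
qed

subsection \<open>Smoothness of the convolution\<close>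

definition conv :: "(real^'d::finite \<Rightarrow> real) \<Rightarrow> (real^'d \<Rightarrow> 'b::euclidean_space) \<Rightarrow> real^'d \<Rightarrow> 'b"
  where "conv \<rho> f x = (LBINT y. \<rho> (x - y) *\<^sub>R f y)"

lemma integrable_bounded_scaleR:
  fixes f :: "'a::euclidean_space \<Rightarrow> 'b::euclidean_space" and a :: "'a \<Rightarrow> real"
  assumes "integrable lborel f" "a \<in> borel_measurable borel" "\<And>y. \<bar>a y\<bar> \<le> B"
  shows "integrable lborel (\<lambda>y. a y *\<^sub>R f y)"
proof (rule Bochner_Integration.integrable_bound[of _ "\<lambda>y. B * norm (f y)"])
  have "\<bar>a y\<bar> * norm (f y) \<le> B * norm (f y)" for y
    using assms(3)[of y] by (intro mult_right_mono) auto
  then show "AE y in lborel. norm (a y *\<^sub>R f y) \<le> norm (B * norm (f y))"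
    by (auto intro: order_trans[OF _ abs_ge_self])
qed (use assms in auto)

lemma conv_integrable:
  fixes f :: "real^'d::finite \<Rightarrow> 'b::euclidean_space"
  assumes "\<rho> \<in> test_functions UNIV" "integrable lborel f"
  shows "integrable lborel (\<lambda>y. \<rho> (x - y) *\<^sub>R f y)"
proof -
  obtain B where "\<And>x. norm (\<rho> x) \<le> B" using test_function_bounded[OF assms(1)] by metis
  moreover have [measurable]: "\<rho> \<in> borel_measurable borel"
    by (rule test_function_measurable[OF assms(1)])
  ultimately show ?thesis
    by (intro integrable_bounded_scaleR[OF assms(2), of _ B]) auto
qed

lemma conv_reflect:
  fixes f :: "real^'d::finite \<Rightarrow> 'b::euclidean_space"
  assumes [measurable]: "\<rho> \<in> borel_measurable borel" "f \<in> borel_measurable borel"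
  shows "conv \<rho> f x = (LBINT z. \<rho> z *\<^sub>R f (x - z))"
  using integral_reflect_borel[of "\<lambda>y. \<rho> (x - y) *\<^sub>R f y" x] by (simp add: conv_def)

lemma test_function_Lipschitz:
  fixes \<rho> :: "real^'d::finite \<Rightarrow> real"
  assumes "\<rho> \<in> test_functions \<Omega>" and B: "\<And>x i. \<bar>partial_deriv i \<rho> x\<bar> \<le> B"
  shows "\<bar>\<rho> x - \<rho> y\<bar> \<le> real CARD('d) * B * norm (x - y)"
proof -
  have "norm (\<rho> x - \<rho> y) \<le> (real CARD('d) * B) * norm (x - y)"
  proof (rule differentiable_bound[where S=UNIV])
    fix x :: "real^'d"
    show "(\<rho> has_derivative (\<lambda>h. \<Sum>i\<in>UNIV. (h $ i) *\<^sub>R partial_deriv i \<rho> x)) (at x within UNIV)"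
      using has_derivative_partials[OF smoothD(2)[OF test_functionsD(1)[OF assms(1)]]] by simp
    have "norm (\<Sum>i\<in>UNIV. (h $ i) *\<^sub>R partial_deriv i \<rho> x) \<le> (\<Sum>i\<in>(UNIV::'d set). norm h * B)" for h
      using B component_le_norm_cart by (intro sum_norm_le) (auto simp: abs_mult intro!: mult_mono)
    then show "onorm (\<lambda>h. \<Sum>i\<in>UNIV. (h $ i) *\<^sub>R partial_deriv i \<rho> x) \<le> real CARD('d) * B"
      by (intro onorm_le) (simp add: mult.commute mult.left_commute)
  qed auto
  then show ?thesis by simp
qed

text \<open>The difference quotients of \<open>\<rho>\<close> converge pointwise and are bounded by its Lipschitz constant, so
  dominated convergence allows differentiation under the integral.\<close>

lemma conv_has_derivative:
  fixes f :: "real^'d::finite \<Rightarrow> 'b::euclidean_space"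
  assumes \<rho>: "\<rho> \<in> test_functions UNIV" and f: "integrable lborel f"
  shows "(conv \<rho> f has_derivative (\<lambda>h. \<Sum>i\<in>UNIV. (h $ i) *\<^sub>R conv (partial_deriv i \<rho>) f x)) (at x)"
proof -
  define D where "D h = (\<Sum>i\<in>UNIV. (h $ i) *\<^sub>R conv (partial_deriv i \<rho>) f x)" for h :: "real^'d"
  obtain B where B: "B \<ge> 0" "\<And>x i. \<bar>partial_deriv i \<rho> x\<bar> \<le> B"
    using test_function_bounded[OF \<rho>] by (metis real_norm_def)
  have [measurable]: "f \<in> borel_measurable borel" "\<rho> \<in> borel_measurable borel"
      "partial_deriv i \<rho> \<in> borel_measurable borel" for i
    using f test_function_measurable[OF \<rho>] test_function_measurable[OF test_functions_partial[OF \<rho>]] by auto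
  define k where "k h y = (\<rho> (x + h - y) - \<rho> (x - y) - (\<Sum>i\<in>UNIV. (h $ i) * partial_deriv i \<rho> (x - y))) / norm h"
    for h y :: "real^'d"
  have [measurable]: "k h \<in> borel_measurable borel" for h unfolding k_def by measurable
  let ?C = "2 * (real CARD('d) * B)"
  have kb: "\<bar>k h y\<bar> \<le> ?C" for h y
  proof (cases "h = 0")
    case False
    have 1: "\<bar>\<rho> (x + h - y) - \<rho> (x - y)\<bar> \<le> real CARD('d) * B * norm h"
      using test_function_Lipschitz[OF \<rho> B(2), of "x + h - y" "x - y"] by simp
    have 2: "\<bar>\<Sum>i\<in>UNIV. (h $ i) * partial_deriv i \<rho> (x - y)\<bar> \<le> (\<Sum>i\<in>(UNIV::'d set). norm h * B)"
      using B component_le_norm_cart[of h] by (intro order_trans[OF sum_abs] sum_mono)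
        (auto simp: abs_mult intro!: mult_mono)
    have "\<bar>k h y\<bar> * norm h \<le> ?C * norm h"
      using 1 2 False by (simp add: k_def abs_divide mult.commute mult.left_commute)
    then show ?thesis using False by simp
  qed (simp add: k_def B)
  have kf: "integrable lborel (\<lambda>y. k h y *\<^sub>R f y)" for h
    by (rule integrable_bounded_scaleR[OF f _ kb]) measurable
  have D_eq: "(conv \<rho> f (x + h) - conv \<rho> f x - D h) /\<^sub>R norm h = (LBINT y. k h y *\<^sub>R f y)" for h
  proof -
    note i = conv_integrable[OF \<rho> f] conv_integrable[OF test_functions_partial[OF \<rho>] f]
    have "conv \<rho> f (x + h) - conv \<rho> f x - D h =
      (LBINT y. \<rho> (x + h - y) *\<^sub>R f y - \<rho> (x - y) *\<^sub>R f y - (\<Sum>i\<in>UNIV. (h $ i) *\<^sub>R (partial_deriv i \<rho> (x - y) *\<^sub>R f y)))"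
      using i by (simp add: conv_def D_def del: scaleR_scaleR)
    then have "(conv \<rho> f (x + h) - conv \<rho> f x - D h) /\<^sub>R norm h = (LBINT y.
      (\<rho> (x + h - y) *\<^sub>R f y - \<rho> (x - y) *\<^sub>R f y - (\<Sum>i\<in>UNIV. (h $ i) *\<^sub>R (partial_deriv i \<rho> (x - y) *\<^sub>R f y))) /\<^sub>R norm h)"
      by simp
    also have "\<dots> = (LBINT y. k h y *\<^sub>R f y)"
      by (rule Bochner_Integration.integral_cong)
        (auto simp: k_def scaleR_sum_left scaleR_sum_right sum_distrib_left divide_inverse algebra_simps scaleR_diff_right)
    finally show ?thesis .
  qed
  have "((\<lambda>h. LBINT y. k h y *\<^sub>R f y) \<longlongrightarrow> 0) (at 0)"
    unfolding tendsto_at_iff_sequentially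
  proof (intro allI impI)
    fix Z :: "nat \<Rightarrow> real^'d"
    assume Z: "\<forall>n. Z n \<in> UNIV - {0}" "Z \<longlonglongrightarrow> 0"
    have "(\<lambda>n. LBINT y. k (Z n) y *\<^sub>R f y) \<longlonglongrightarrow> (LBINT y::real^'d. 0)"
    proof (rule integral_dominated_convergence[where w="\<lambda>y. ?C * norm (f y)"])
      show "AE y in lborel. (\<lambda>n. k (Z n) y *\<^sub>R f y) \<longlonglongrightarrow> 0"
      proof (rule AE_I2)
        fix y
        have "(\<rho> has_derivative (\<lambda>h. \<Sum>i\<in>UNIV. (h $ i) *\<^sub>R partial_deriv i \<rho> (x - y))) (at (x - y))"
          using has_derivative_partials[OF smoothD(2)[OF test_functionsD(1)[OF \<rho>]]] .
        then have "(\<lambda>h. norm (\<rho> (x - y + h) - \<rho> (x - y) - (\<Sum>i\<in>UNIV. (h $ i) *\<^sub>R partial_deriv i \<rho> (x - y))) / norm h)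
            \<midarrow>0\<rightarrow> 0"
          by (simp add: has_derivative_at)
        then have "((\<lambda>h. \<bar>k h y\<bar>) \<longlongrightarrow> 0) (at 0)"
          by (simp add: k_def abs_divide add.commute add_diff_eq)
        then have "((\<lambda>h. k h y) \<longlongrightarrow> 0) (at 0)"
          by (simp add: tendsto_rabs_zero_iff)
        then have "(\<lambda>n. k (Z n) y) \<longlonglongrightarrow> 0"
          using Z by (auto simp: tendsto_at_iff_sequentially o_def)
        then show "(\<lambda>n. k (Z n) y *\<^sub>R f y) \<longlonglongrightarrow> 0"
          by (auto intro!: tendsto_eq_intros)
      qed
      show "AE y in lborel. norm (k (Z n) y *\<^sub>R f y) \<le> ?C * norm (f y)" for n
        using kb by (auto intro!: mult_right_mono simp del: mult_le_cancel_right)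
    qed (use f in auto)
    then show "((\<lambda>h. LBINT y. k h y *\<^sub>R f y) \<circ> Z) \<longlonglongrightarrow> 0" by (simp add: o_def)
  qed
  then have "((\<lambda>h. (conv \<rho> f (x + h) - conv \<rho> f x - D h) /\<^sub>R norm h) \<longlongrightarrow> 0) (at 0)"
    by (simp only: D_eq)
  then have "((\<lambda>h. norm ((conv \<rho> f (x + h) - conv \<rho> f x - D h) /\<^sub>R norm h)) \<longlongrightarrow> 0) (at 0)"
    by (rule tendsto_norm_zero)
  then have l: "((\<lambda>h. norm (conv \<rho> f (x + h) - conv \<rho> f x - D h) / norm h) \<longlongrightarrow> 0) (at 0)"
    by (simp add: divide_inverse mult.commute)
  have "bounded_linear D"
    unfolding D_def by (intro bounded_linear_sum bounded_linear_scaleR_left[THEN bounded_linear_compose] bounded_linear_vec_nth)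
  with l have "(conv \<rho> f has_derivative D) (at x)"
    by (simp add: has_derivative_at)
  then show ?thesis by (simp add: D_def[abs_def])
qed

lemma partial_deriv_conv:
  fixes f :: "real^'d::finite \<Rightarrow> 'b::euclidean_space"
  assumes "\<rho> \<in> test_functions UNIV" "integrable lborel f"
  shows "partial_deriv i (conv \<rho> f) = conv (partial_deriv i \<rho>) f"
proof
  fix x
  have "partial_deriv i (conv \<rho> f) x = (\<Sum>j\<in>UNIV. (if j = i then conv (partial_deriv j \<rho>) f x else 0))"
    unfolding partial_deriv_eq[OF conv_has_derivative[OF assms]]
    by (rule sum.cong) (auto simp: axis_def)
  then show "partial_deriv i (conv \<rho> f) x = conv (partial_deriv i \<rho>) f x" by simp
qed

lemma smooth_conv:
  fixes f :: "real^'d::finite \<Rightarrow> 'b::euclidean_space"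
  assumes "\<rho> \<in> test_functions UNIV" and f: "integrable lborel f"
  shows "smooth (conv \<rho> f)"
proof
  fix k show "times_diff k (conv \<rho> f)"
    using assms(1)
  proof (induction k arbitrary: \<rho>)
    case 0
    have "continuous_on UNIV (conv \<rho> f)"
      by (intro continuous_at_imp_continuous_on ballI has_derivative_continuous[OF conv_has_derivative[OF 0 f]])
    then show ?case by simp
  next
    case (Suc k)
    then show ?case
      using conv_has_derivative[OF Suc.prems f] test_functions_partial[OF Suc.prems]
      by (auto simp: partial_deriv_conv f differentiable_def)
  qed
qed

lemma conv_eq_0:
  assumes "\<And>y. y \<in> K \<Longrightarrow> \<rho> (x - y) = 0" "\<And>y. y \<notin> K \<Longrightarrow> f y = 0"
  shows "conv \<rho> f x = 0"
proof -
  have "(\<lambda>y. \<rho> (x - y) *\<^sub>R f y) = (\<lambda>y. 0)"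
    by (rule ext, metis assms scale_eq_0_iff)
  then show ?thesis by (simp add: conv_def)
qed

subsection \<open>Convergence of mollified functions\<close>

lemma tendsto_0_if_eventually_le_ennreal:
  fixes f :: "nat \<Rightarrow> ennreal"
  assumes "\<And>e. e > 0 \<Longrightarrow> \<forall>\<^sub>F n in sequentially. f n \<le> ennreal e"
  shows "f \<longlonglongrightarrow> 0"
proof (rule order_tendstoI)
  fix a :: ennreal assume "0 < a"
  then obtain e where "0 < ennreal e" "ennreal e < a" "0 \<le> e"
    by (metis dense ennreal_cases order_less_imp_not_less top_greatest not_le)
  then show "\<forall>\<^sub>F n in sequentially. f n < a"
    using assms[of e] by (auto elim!: eventually_mono)
qed simp

text \<open>Jensen's inequality for the square: a variance is not negative.\<close>

lemma weighted_mean_square: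
  fixes w a :: "'a \<Rightarrow> real"
  assumes "integrable M w" "\<And>x. w x \<ge> 0" "integral\<^sup>L M w = 1"
    and "integrable M (\<lambda>x. w x * a x)" "integrable M (\<lambda>x. w x * (a x)\<^sup>2)"
  shows "(integral\<^sup>L M (\<lambda>x. w x * a x))\<^sup>2 \<le> integral\<^sup>L M (\<lambda>x. w x * (a x)\<^sup>2)"
proof -
  let ?m = "integral\<^sup>L M (\<lambda>x. w x * a x)"
  have "0 \<le> integral\<^sup>L M (\<lambda>x. w x * (a x - ?m)\<^sup>2)"
    using assms(2) by (intro Bochner_Integration.integral_nonneg) auto
  also have "(\<lambda>x. w x * (a x - ?m)\<^sup>2) = (\<lambda>x. w x * (a x)\<^sup>2 - (2 * ?m) * (w x * a x) + ?m\<^sup>2 * w x)"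
    by (auto simp: power2_eq_square algebra_simps)
  also have "integral\<^sup>L M \<dots> = integral\<^sup>L M (\<lambda>x. w x * (a x)\<^sup>2) - (2 * ?m) * ?m + ?m\<^sup>2 * 1"
    using assms by simp
  finally show ?thesis by (simp add: power2_eq_square)
qed

text \<open>The exponent \<open>1\<close> serves the chain rule, the exponent \<open>2\<close> the approximation in the norm of \<open>H\<^sup>1\<close>.\<close>

lemma conv_moll_diff_bound:
  fixes f :: "real^'d::finite \<Rightarrow> 'b::euclidean_space"
  assumes f: "integrable lborel f" and k: "k \<in> {1, 2}"
  shows "ennreal (norm (conv (moll n) f x - f x) ^ k) \<le>
     (\<integral>\<^sup>+z. ennreal (moll n z) * ennreal (norm (f (x - z) - f x) ^ k) \<partial>lborel)"
proof -
  have [measurable]: "f \<in> borel_measurable borel" using f by auto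
  let ?\<rho> = "moll n"
  have i1: "integrable lborel (\<lambda>z. ?\<rho> z *\<^sub>R f (x - z))"
  proof -
    have "integrable lborel (\<lambda>z. (\<lambda>y. ?\<rho> (x - y) *\<^sub>R f y) (x - z))"
      by (rule integrable_reflect_borel[OF conv_integrable[OF moll_test f]])
    then show ?thesis by simp
  qed
  have i2: "integrable lborel (\<lambda>z. ?\<rho> z *\<^sub>R f x)" using moll_integrable by auto
  have eq: "conv ?\<rho> f x - f x = (LBINT z. ?\<rho> z *\<^sub>R (f (x - z) - f x))"
    using i1 i2 by (simp add: conv_reflect scaleR_diff_right integral_moll moll_integrable)
  have i3: "integrable lborel (\<lambda>z. ?\<rho> z *\<^sub>R (f (x - z) - f x))"
    unfolding scaleR_diff_right by (rule Bochner_Integration.integrable_diff[OF i1 i2])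
  have i4: "integrable lborel (\<lambda>z. ?\<rho> z * norm (f (x - z) - f x))"
    using integrable_norm[OF i3] by (simp add: abs_of_nonneg moll_nonneg)
  have b: "norm (conv ?\<rho> f x - f x) \<le> (LBINT z. ?\<rho> z * norm (f (x - z) - f x))"
    using integral_norm_bound[of lborel "\<lambda>z. ?\<rho> z *\<^sub>R (f (x - z) - f x)"]
    by (simp add: eq abs_of_nonneg moll_nonneg)
  let ?N = "\<integral>\<^sup>+z. ennreal (?\<rho> z) * ennreal (norm (f (x - z) - f x) ^ k) \<partial>lborel"
  have N: "?N = (\<integral>\<^sup>+z. ennreal (?\<rho> z * norm (f (x - z) - f x) ^ k) \<partial>lborel)"
    by (intro nn_integral_cong) (simp add: ennreal_mult moll_nonneg)
  have main: "norm (conv ?\<rho> f x - f x) ^ k \<le> (LBINT z. ?\<rho> z * norm (f (x - z) - f x) ^ k)"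
    if i: "integrable lborel (\<lambda>z. ?\<rho> z * norm (f (x - z) - f x) ^ k)"
  proof (cases "k = 1")
    case False
    then have [simp]: "k = 2" using k by simp
    have "norm (conv ?\<rho> f x - f x) ^ 2 \<le> (LBINT z. ?\<rho> z * norm (f (x - z) - f x)) ^ 2"
      using b by (intro power_mono) auto
    also have "\<dots> \<le> (LBINT z. ?\<rho> z * (norm (f (x - z) - f x))\<^sup>2)"
      using i by (intro weighted_mean_square i4 moll_integrable moll_nonneg integral_moll) auto
    finally show ?thesis by simp
  qed (use b in auto)
  show ?thesis
  proof (cases "?N = \<infinity>")
    case False
    then have i: "integrable lborel (\<lambda>z. ?\<rho> z * norm (f (x - z) - f x) ^ k)"
      unfolding N by (intro integrableI_nonneg) (auto simp: less_top moll_nonneg)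
    show ?thesis
      unfolding N using main[OF i]
      by (subst nn_integral_eq_integral[OF i]) (auto intro!: ennreal_leI simp: moll_nonneg)
  qed simp
qed

text \<open>By Tonelli's theorem the error is at most a mean of the distances between \<open>f\<close> and its translates by
  vectors shorter than the radius of the mollifier.\<close>

lemma conv_tendsto_power:
  fixes f :: "real^'d::finite \<Rightarrow> 'b::euclidean_space"
  assumes f: "integrable lborel f" and k: "k \<in> {1, 2}"
    and fk: "integrable lborel (\<lambda>x. norm (f x) ^ k)"
  shows "(\<lambda>n. \<integral>\<^sup>+x. ennreal (norm (conv (moll n) f x - f x) ^ k) \<partial>lborel) \<longlonglongrightarrow> 0"
proof -
  have [measurable]: "f \<in> borel_measurable borel" using f by auto
  define \<omega> where "\<omega> z = (LBINT x. norm (f (x - z) - f x) ^ k)" for z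
  have \<omega>i: "integrable lborel (\<lambda>x. norm (f (x - z) - f x) ^ k)" for z
  proof (rule Bochner_Integration.integrable_bound)
    show "integrable lborel (\<lambda>x. 3 * (norm (f (x - z)) ^ k + norm (f x) ^ k))"
      using fk integrable_shift_borel[OF fk, of z] by auto
    show "AE x in lborel. norm (norm (f (x - z) - f x) ^ k) \<le> norm (3 * (norm (f (x - z)) ^ k + norm (f x) ^ k))"
    proof (rule AE_I2)
      fix x
      have "norm (f (x - z) - f x) \<le> norm (f (x - z)) + norm (f x)" by (rule norm_triangle_ineq4)
      moreover have "(norm (f (x - z) - f x))\<^sup>2 \<le> 3 * ((norm (f (x - z)))\<^sup>2 + (norm (f x))\<^sup>2)"
        using norm_three_squares[of "f (x - z)" "- f x" 0] by simp
      ultimately show "norm (norm (f (x - z) - f x) ^ k) \<le> norm (3 * (norm (f (x - z)) ^ k + norm (f x) ^ k))"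
        using k norm_ge_zero[of "f x"] norm_ge_zero[of "f (x - z)"]
        by (auto simp del: norm_ge_zero)
    qed
  qed measurable
  have \<omega>0: "\<omega> 0 = 0" using k by (auto simp: \<omega>_def)
  have seq: "(\<lambda>n. \<omega> (Z n)) \<longlonglongrightarrow> 0" if "Z \<longlonglongrightarrow> 0" for Z
    using k L1_shift_continuous[OF f] L2_shift_continuous[OF f _ that] fk that
    by (auto simp: \<omega>_def L1_shift_continuous_def)
  have cont: "continuous (at 0) \<omega>"
    unfolding continuous_at_sequentially using seq \<omega>0 by (auto simp: o_def)
  show ?thesis
  proof (rule tendsto_0_if_eventually_le_ennreal)
    fix e :: real assume e: "e > 0"
    then obtain d where d: "d > 0" "\<And>z. norm z < d \<Longrightarrow> \<bar>\<omega> z\<bar> < e"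
      using cont \<omega>0 unfolding continuous_at_eps_delta by (auto simp: dist_norm)
    obtain n0 where n0: "inverse (real (Suc n0)) < d"
      using reals_Archimedean[OF d(1)] by auto
    show "\<forall>\<^sub>F n in sequentially. (\<integral>\<^sup>+x. ennreal (norm (conv (moll n) f x - f x) ^ k) \<partial>lborel) \<le> ennreal e"
      unfolding eventually_sequentially
    proof (intro exI[of _ n0] allI impI)
      fix n assume n: "n0 \<le> n"
      have "(\<integral>\<^sup>+x. ennreal (norm (conv (moll n) f x - f x) ^ k) \<partial>lborel) \<le>
          (\<integral>\<^sup>+x. (\<integral>\<^sup>+z. ennreal (moll n z) * ennreal (norm (f (x - z) - f x) ^ k) \<partial>lborel) \<partial>lborel)"
        by (intro nn_integral_mono conv_moll_diff_bound f k)
      also have "\<dots> = (\<integral>\<^sup>+z. (\<integral>\<^sup>+x. ennreal (moll n z) * ennreal (norm (f (x - z) - f x) ^ k) \<partial>lborel) \<partial>lborel)"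
        by (rule lborel_pair.Fubini') measurable
      also have "\<dots> = (\<integral>\<^sup>+z. ennreal (moll n z) * ennreal (\<omega> z) \<partial>lborel)"
        unfolding \<omega>_def by (subst nn_integral_cmult) (auto simp: nn_integral_eq_integral[OF \<omega>i])
      also have "\<dots> \<le> (\<integral>\<^sup>+(z::real^'d). ennreal (moll n z) * ennreal e \<partial>lborel)"
      proof (rule nn_integral_mono)
        fix z :: "real^'d"
        show "ennreal (moll n z) * ennreal (\<omega> z) \<le> ennreal (moll n z) * ennreal e"
        proof (cases "norm z < d")
          case True
          then show ?thesis using d(2)[OF True] by (intro mult_left_mono ennreal_leI) auto
        next
          case False
          have "inverse (real (Suc n)) \<le> inverse (real (Suc n0))" using n by auto
          then have "moll n z = 0" using False n0 by (intro moll_eq_0) linarith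
          then show ?thesis by simp
        qed
      qed
      also have "\<dots> = ennreal e"
        by (subst nn_integral_multc) (auto simp: nn_integral_moll)
      finally show "(\<integral>\<^sup>+x. ennreal (norm (conv (moll n) f x - f x) ^ k) \<partial>lborel) \<le> ennreal e" .
    qed
  qed
qed

section \<open>Weak derivatives and the chain rule\<close>

text \<open>Weak derivatives for Borel functions that are integrable over the whole space, to which convolution
  and Fubini's theorem apply directly.  Test functions vanish outside \<open>U\<close>, so the values there only
  have to be integrable.\<close>

definition wd :: "(real^'d::finite) set \<Rightarrow> 'd \<Rightarrow> (real^'d \<Rightarrow> 'b::euclidean_space) \<Rightarrow> (real^'d \<Rightarrow> 'b) \<Rightarrow> bool"
  where "wd U i f g \<longleftrightarrow> integrable lborel f \<and> integrable lborel g \<and>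
     (\<forall>\<phi>\<in>test_functions U. (LBINT x. partial_deriv i \<phi> x *\<^sub>R f x) = - (LBINT x. \<phi> x *\<^sub>R g x))"

lemma wdD:
  assumes "wd U i f g"
  shows "integrable lborel f" "integrable lborel g"
    "f \<in> borel_measurable borel" "g \<in> borel_measurable borel"
    "\<phi> \<in> test_functions U \<Longrightarrow> (LBINT x. partial_deriv i \<phi> x *\<^sub>R f x) = - (LBINT x. \<phi> x *\<^sub>R g x)"
  using assms by (auto simp: wd_def)

lemma test_functions_mono: "V \<subseteq> U \<Longrightarrow> \<phi> \<in> test_functions V \<Longrightarrow> \<phi> \<in> test_functions U"
  by (auto simp: test_functions_def)

lemma wd_subset: "wd U i f g \<Longrightarrow> V \<subseteq> U \<Longrightarrow> wd V i f g"
  unfolding wd_def using test_functions_mono by blast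

lemma test_functions_eq_0:
  assumes "\<phi> \<in> test_functions U" "x \<notin> U"
  shows "\<phi> x = 0" "partial_deriv i \<phi> x = 0"
proof -
  have "x \<notin> closure {x. \<phi> x \<noteq> 0}" using test_functionsD(3)[OF assms(1)] assms(2) by blast
  then show "\<phi> x = 0" "partial_deriv i \<phi> x = 0" using test_functions_support[OF assms(1)] by blast+
qed

lemma test_function_scaleR_integrable:
  fixes h :: "real^'d::finite \<Rightarrow> 'b::euclidean_space" and \<psi> :: "real^'d \<Rightarrow> real"
  assumes "integrable lborel h" and \<psi>: "\<psi> \<in> test_functions U"
  shows "integrable lborel (\<lambda>x. \<psi> x *\<^sub>R h x)"
proof -
  obtain B where "\<And>x. norm (\<psi> x) \<le> B" using test_function_bounded[OF \<psi>] by metis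
  then show ?thesis by (intro integrable_bounded_scaleR[OF assms(1) test_function_measurable[OF \<psi>]]) auto
qed

lemma wd_cong:
  assumes fg: "wd U i f g" and f': "integrable lborel f'" and g': "integrable lborel g'"
    and ff: "AE x in lborel. x \<in> U \<longrightarrow> f x = f' x" and gg: "AE x in lborel. x \<in> U \<longrightarrow> g x = g' x"
  shows "wd U i f' g'"
  unfolding wd_def
proof (intro conjI ballI f' g')
  fix \<phi> :: "real^'a \<Rightarrow> real" assume \<phi>: "\<phi> \<in> test_functions U"
  note [measurable] = test_function_measurable[OF \<phi>] test_function_measurable[OF test_functions_partial[OF \<phi>]]
    wdD(3,4)[OF fg]
  have [measurable]: "f' \<in> borel_measurable borel" "g' \<in> borel_measurable borel" using f' g' by auto
  have "(LBINT x. partial_deriv i \<phi> x *\<^sub>R f x) = (LBINT x. partial_deriv i \<phi> x *\<^sub>R f' x)"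
  proof (rule integral_cong_AE)
    show "AE x in lborel. partial_deriv i \<phi> x *\<^sub>R f x = partial_deriv i \<phi> x *\<^sub>R f' x"
      using ff test_functions_eq_0(2)[OF \<phi>] by (auto elim!: eventually_mono)
  qed measurable
  moreover have "(LBINT x. \<phi> x *\<^sub>R g x) = (LBINT x. \<phi> x *\<^sub>R g' x)"
  proof (rule integral_cong_AE)
    show "AE x in lborel. \<phi> x *\<^sub>R g x = \<phi> x *\<^sub>R g' x"
      using gg test_functions_eq_0(1)[OF \<phi>] by (auto elim!: eventually_mono)
  qed measurable
  ultimately show "(LBINT x. partial_deriv i \<phi> x *\<^sub>R f' x) = - (LBINT x. \<phi> x *\<^sub>R g' x)"
    using wdD(5)[OF fg \<phi>] by simp
qed

lemma wd_bounded_linear: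
  fixes f g :: "real^'d::finite \<Rightarrow> 'a::euclidean_space" and L :: "'a \<Rightarrow> 'b::euclidean_space"
  assumes L: "bounded_linear L" and fg: "wd U i f g"
  shows "wd U i (\<lambda>x. L (f x)) (\<lambda>x. L (g x))"
  unfolding wd_def
proof (intro conjI ballI)
  interpret bounded_linear L by fact
  show "integrable lborel (\<lambda>x. L (f x))" "integrable lborel (\<lambda>x. L (g x))"
    using wdD(1,2)[OF fg] by (auto intro: integrable_bounded_linear[OF L])
  fix \<phi> :: "real^'d \<Rightarrow> real" assume \<phi>: "\<phi> \<in> test_functions U"
  have "(LBINT x. L (partial_deriv i \<phi> x *\<^sub>R f x)) = L (LBINT x. partial_deriv i \<phi> x *\<^sub>R f x)"
    by (rule integral_bounded_linear[OF L test_function_scaleR_integrable[OF wdD(1)[OF fg] test_functions_partial[OF \<phi>]]])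
  moreover have "(LBINT x. L (\<phi> x *\<^sub>R g x)) = L (LBINT x. \<phi> x *\<^sub>R g x)"
    by (rule integral_bounded_linear[OF L test_function_scaleR_integrable[OF wdD(2)[OF fg] \<phi>]])
  ultimately show "(LBINT x. partial_deriv i \<phi> x *\<^sub>R L (f x)) = - (LBINT x. \<phi> x *\<^sub>R L (g x))"
    using wdD(5)[OF fg \<phi>] by (simp add: scaleR neg)
qed

lemma wd_add:
  fixes f g f' g' :: "real^'d::finite \<Rightarrow> 'b::euclidean_space"
  assumes fg: "wd U i f g" and fg': "wd U i f' g'"
  shows "wd U i (\<lambda>x. f x + f' x) (\<lambda>x. g x + g' x)"
  unfolding wd_def
proof (intro conjI ballI)
  show "integrable lborel (\<lambda>x. f x + f' x)" "integrable lborel (\<lambda>x. g x + g' x)"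
    using wdD(1,2)[OF fg] wdD(1,2)[OF fg'] by auto
  fix \<phi> :: "real^'d \<Rightarrow> real" assume \<phi>: "\<phi> \<in> test_functions U"
  note ip = test_function_scaleR_integrable[OF _ test_functions_partial[OF \<phi>, of i]]
    and ii = test_function_scaleR_integrable[OF _ \<phi>]
  show "(LBINT x. partial_deriv i \<phi> x *\<^sub>R (f x + f' x)) = - (LBINT x. \<phi> x *\<^sub>R (g x + g' x))"
    unfolding scaleR_add_right
    using ip[OF wdD(1)[OF fg]] ip[OF wdD(1)[OF fg']] ii[OF wdD(2)[OF fg]] ii[OF wdD(2)[OF fg']]
      wdD(5)[OF fg \<phi>] wdD(5)[OF fg' \<phi>] by simp
qed

lemma wd_Pair:
  fixes f g :: "real^'d::finite \<Rightarrow> 'a::euclidean_space" and f' g' :: "real^'d \<Rightarrow> 'b::euclidean_space"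
  assumes "wd U i f g" "wd U i f' g'"
  shows "wd U i (\<lambda>x. (f x, f' x)) (\<lambda>x. (g x, g' x))"
proof -
  have "bounded_linear (\<lambda>x::'a. (x, 0::'b))" "bounded_linear (\<lambda>x::'b. (0::'a, x))"
    by (intro bounded_linear_Pair bounded_linear_ident bounded_linear_zero)+
  from wd_add[OF wd_bounded_linear[OF this(1) assms(1)] wd_bounded_linear[OF this(2) assms(2)]]
  show ?thesis by simp
qed

subsection \<open>Mollification commutes with weak derivatives\<close>

lemma times_diff_minus:
  fixes f :: "real^'d::finite \<Rightarrow> 'b::real_normed_vector"
  assumes "times_diff k f"
  shows "times_diff k (\<lambda>x. - f x)"
  using times_diff_scaleR[OF times_diff_const assms, of "-1"] by simp

lemma times_diff_reflect:
  fixes f :: "real^'d::finite \<Rightarrow> 'b::real_normed_vector"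
  shows "times_diff k f \<Longrightarrow> times_diff k (\<lambda>y. f (x - y))"
proof (induction k arbitrary: f)
  case 0
  then show ?case by (auto intro!: continuous_on_compose2[of UNIV f] continuous_intros)
next
  case (Suc k)
  have der: "((\<lambda>y. f (x - y)) has_derivative (\<lambda>h. frechet_derivative f (at (x - y)) (- h))) (at y)" for y
  proof -
    have "(f has_derivative frechet_derivative f (at (x - y))) (at (x - y))"
      using Suc.prems by (auto simp flip: frechet_derivative_works)
    moreover have "((\<lambda>y. x - y) has_derivative (\<lambda>h. - h)) (at y)"
      by (auto intro!: derivative_eq_intros)
    ultimately have "((f \<circ> (\<lambda>y. x - y)) has_derivative (frechet_derivative f (at (x - y)) \<circ> (\<lambda>h. - h))) (at y)"
      by (rule diff_chain_at[rotated])
    then show ?thesis by (simp add: o_def)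
  qed
  have "partial_deriv i (\<lambda>y. f (x - y)) = (\<lambda>y. (-1) *\<^sub>R partial_deriv i f (x - y))" for i
  proof
    fix y
    have "linear (frechet_derivative f (at (x - y)))"
      using Suc.prems by (intro linear_frechet_derivative) auto
    then show "partial_deriv i (\<lambda>y. f (x - y)) y = (-1) *\<^sub>R partial_deriv i f (x - y)"
      by (subst partial_deriv_eq[OF der]) (simp add: partial_deriv_def linear_neg)
  qed
  with Suc der show ?case
    by (auto simp: differentiable_def intro!: times_diff_minus)
qed

lemma partial_deriv_reflect:
  fixes f :: "real^'d::finite \<Rightarrow> 'b::real_normed_vector"
  assumes "f differentiable (at (x - y))"
  shows "partial_deriv i (\<lambda>y. f (x - y)) y = - partial_deriv i f (x - y)"
proof -
  have "((f \<circ> (\<lambda>y. x - y)) has_derivative (frechet_derivative f (at (x - y)) \<circ> (\<lambda>h. - h))) (at y)"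
    using assms by (intro diff_chain_at) (auto intro!: derivative_eq_intros simp flip: frechet_derivative_works)
  then have "((\<lambda>y. f (x - y)) has_derivative (\<lambda>h. frechet_derivative f (at (x - y)) (- h))) (at y)"
    by (simp add: o_def)
  from partial_deriv_eq[OF this] show ?thesis
    using linear_neg[OF linear_frechet_derivative[OF assms]] by (simp add: partial_deriv_def)
qed

lemma moll_reflect_test:
  assumes "cball x (inverse (real (Suc n))) \<subseteq> U"
  shows "(\<lambda>y. moll n (x - y)) \<in> test_functions U"
proof (rule test_functionsI[OF _ compact_cball assms])
  show "smooth (\<lambda>y. moll n (x - y))"
    using test_functionsD(1)[OF moll_test] times_diff_reflect by blast
  show "moll n (x - y) = 0" if "y \<notin> cball x (inverse (real (Suc n)))" for y
    using that by (intro moll_eq_0) (auto simp: dist_norm)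
qed

text \<open>The reflected mollifier \<open>\<lambda>y. moll n (x - y)\<close> is a test function.\<close>

lemma wd_conv:
  assumes fg: "wd U i f g" and x: "cball x (inverse (real (Suc n))) \<subseteq> U"
  shows "partial_deriv i (conv (moll n) f) x = conv (moll n) g x"
proof -
  have "partial_deriv i (\<lambda>y. moll n (x - y)) y = - partial_deriv i (moll n) (x - y)" for y
    by (rule partial_deriv_reflect) (rule smoothD(2)[OF test_functionsD(1)[OF moll_test]])
  then show ?thesis
    using wdD(5)[OF fg moll_reflect_test[OF x]]
    by (simp add: partial_deriv_conv[OF moll_test wdD(1)[OF fg]]) (simp add: conv_def)
qed

lemma conv_measurable [measurable]:
  fixes f :: "real^'d::finite \<Rightarrow> 'b::euclidean_space"
  assumes "integrable lborel f"
  shows "conv (moll n) f \<in> borel_measurable borel"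
  by (rule borel_measurable_continuous_onI) (rule smoothD(1)[OF smooth_conv[OF moll_test assms]])

text \<open>Keeping the set \<open>A\<close> in place turns bounds that hold for all translates of a set into bounds for the
  convolution.\<close>

lemma nn_integral_conv_le:
  fixes f :: "real^'d::finite \<Rightarrow> 'b::euclidean_space"
  assumes f: "integrable lborel f" and [measurable]: "A \<in> sets borel"
  shows "(\<integral>\<^sup>+x. indicator A x * ennreal (norm (conv (moll n) f x)) \<partial>lborel) \<le>
    (\<integral>\<^sup>+z. ennreal (moll n z) * (\<integral>\<^sup>+x. indicator A x * ennreal (norm (f (x - z))) \<partial>lborel) \<partial>lborel)"
proof -
  have [measurable]: "f \<in> borel_measurable borel" using f by auto
  have b: "ennreal (norm (conv (moll n) f x)) \<le> (\<integral>\<^sup>+z. ennreal (moll n z) * ennreal (norm (f (x - z))) \<partial>lborel)" for x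
  proof -
    have i: "integrable lborel (\<lambda>z. moll n z *\<^sub>R f (x - z))"
      using integrable_reflect_borel[OF conv_integrable[OF moll_test f], of n x x] by simp
    show ?thesis
      using integral_norm_bound_ennreal[OF i]
      by (simp add: conv_reflect ennreal_mult moll_nonneg abs_of_nonneg)
  qed
  have "(\<integral>\<^sup>+x. indicator A x * ennreal (norm (conv (moll n) f x)) \<partial>lborel) \<le>
     (\<integral>\<^sup>+x. indicator A x * (\<integral>\<^sup>+z. ennreal (moll n z) * ennreal (norm (f (x - z))) \<partial>lborel) \<partial>lborel)"
    by (intro nn_integral_mono mult_left_mono b) auto
  also have "\<dots> = (\<integral>\<^sup>+x. (\<integral>\<^sup>+z. indicator A x * (ennreal (moll n z) * ennreal (norm (f (x - z)))) \<partial>lborel) \<partial>lborel)"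
    by (intro nn_integral_cong nn_integral_cmult[symmetric]) measurable
  also have "\<dots> = (\<integral>\<^sup>+z. (\<integral>\<^sup>+x. indicator A x * (ennreal (moll n z) * ennreal (norm (f (x - z)))) \<partial>lborel) \<partial>lborel)"
    by (rule lborel_pair.Fubini') measurable
  also have "\<dots> = (\<integral>\<^sup>+z. ennreal (moll n z) * (\<integral>\<^sup>+x. indicator A x * ennreal (norm (f (x - z))) \<partial>lborel) \<partial>lborel)"
    by (subst nn_integral_cmult[symmetric]) (auto simp: ac_simps)
  finally show ?thesis .
qed

lemma integrable_conv:
  fixes f :: "real^'d::finite \<Rightarrow> 'b::euclidean_space"
  assumes f: "integrable lborel f"
  shows "integrable lborel (conv (moll n) f)"
proof (rule integrableI_bounded)
  have [measurable]: "f \<in> borel_measurable borel" using f by auto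
  have "(\<integral>\<^sup>+x. ennreal (norm (conv (moll n) f x)) \<partial>lborel) \<le>
     (\<integral>\<^sup>+z. ennreal (moll n z) * (\<integral>\<^sup>+x. ennreal (norm (f (x - z))) \<partial>lborel) \<partial>lborel)"
    using nn_integral_conv_le[OF f, of UNIV n] by simp
  also have "(\<lambda>z. \<integral>\<^sup>+x. ennreal (norm (f (x - z))) \<partial>lborel) = (\<lambda>z. \<integral>\<^sup>+x. ennreal (norm (f x)) \<partial>lborel)"
    by (rule ext, rule nn_integral_shift) measurable
  also have "(\<integral>\<^sup>+z. ennreal (moll n z) * (\<integral>\<^sup>+x. ennreal (norm (f x)) \<partial>lborel) \<partial>lborel) = (\<integral>\<^sup>+x. ennreal (norm (f x)) \<partial>lborel)"
    by (subst nn_integral_multc) (auto simp: nn_integral_moll)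
  also have "\<dots> < \<infinity>" using f by (simp add: integrable_iff_bounded)
  finally show "(\<integral>\<^sup>+x. ennreal (norm (conv (moll n) f x)) \<partial>lborel) < \<infinity>" .
qed (use f in measurable)

lemma conv_tendsto_L1:
  fixes f :: "real^'d::finite \<Rightarrow> 'b::euclidean_space"
  assumes f: "integrable lborel f"
  shows "(\<lambda>n. LBINT x. norm (conv (moll n) f x - f x)) \<longlonglongrightarrow> 0"
proof -
  have i: "integrable lborel (\<lambda>x. norm (conv (moll n) f x - f x))" for n
    using integrable_conv[OF f] f by auto
  have "(\<lambda>n. ennreal (LBINT x. norm (conv (moll n) f x - f x))) \<longlonglongrightarrow> ennreal 0"
    using conv_tendsto_power[OF f, of 1] f by (simp add: nn_integral_eq_integral[OF i])
  then show ?thesis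
    by (subst (asm) tendsto_ennreal_iff) (auto intro!: Bochner_Integration.integral_nonneg)
qed

lemma conv_AE_subseq:
  fixes f :: "real^'d::finite \<Rightarrow> 'b::euclidean_space"
  assumes f: "integrable lborel f"
  obtains r where "strict_mono r" "AE x in lborel. (\<lambda>n. conv (moll (r n)) f x) \<longlonglongrightarrow> f x"
proof -
  have i: "integrable lborel (\<lambda>x. conv (moll n) f x - f x)" for n
    using integrable_conv[OF f] f by auto
  obtain r where r: "strict_mono r" "AE x in lborel. (\<lambda>n. conv (moll (r n)) f x - f x) \<longlonglongrightarrow> 0"
    using tendsto_L1_AE_subseq[OF i conv_tendsto_L1[OF f]] by blast
  from r(2) have "AE x in lborel. (\<lambda>n. conv (moll (r n)) f x) \<longlonglongrightarrow> f x"
    by eventually_elim (simp add: Lim_null[symmetric])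
  with r(1) that show thesis by blast
qed

lemma moll_radius_small:
  assumes "\<delta> > 0"
  obtains N where "\<And>n. n \<ge> N \<Longrightarrow> inverse (real (Suc n)) \<le> \<delta>"
proof -
  obtain N where "inverse (real (Suc N)) < \<delta>" using reals_Archimedean[OF assms] by auto
  then have "inverse (real (Suc n)) \<le> \<delta>" if "n \<ge> N" for n
  proof -
    have "inverse (real (Suc n)) \<le> inverse (real (Suc N))"
      by (rule le_imp_inverse_le) (use that in auto)
    then show ?thesis using \<open>inverse (real (Suc N)) < \<delta>\<close> by linarith
  qed
  then show ?thesis using that by blast
qed

text \<open>A function that annihilates all test functions is the almost everywhere limit of its
  mollifications, which vanish.\<close>

lemma fundamental_lemma:
  fixes h :: "real^'d::finite \<Rightarrow> 'b::euclidean_space"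
  assumes U: "open U" and h: "integrable lborel h"
    and 0: "\<And>\<phi>. \<phi> \<in> test_functions U \<Longrightarrow> (LBINT x. \<phi> x *\<^sub>R h x) = 0"
  shows "AE x in lborel. x \<in> U \<longrightarrow> h x = 0"
proof -
  obtain r where r: "strict_mono r" "AE x in lborel. (\<lambda>n. conv (moll (r n)) h x) \<longlonglongrightarrow> h x"
    using conv_AE_subseq[OF h] .
  from r(2) show ?thesis
  proof eventually_elim
    case (elim x)
    show ?case
    proof
      assume "x \<in> U"
      then obtain \<delta> where \<delta>: "\<delta> > 0" "cball x \<delta> \<subseteq> U"
        using U open_contains_cball by blast
      obtain N where N: "\<And>n. n \<ge> N \<Longrightarrow> inverse (real (Suc n)) \<le> \<delta>"
        using moll_radius_small[OF \<delta>(1)] by blast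
      have "conv (moll (r n)) h x = 0" if "n \<ge> N" for n
      proof -
        have "r n \<ge> N" using seq_suble[OF r(1), of n] that by simp
        then have "cball x (inverse (real (Suc (r n)))) \<subseteq> U"
          by (intro order_trans[OF subset_cball[OF N] \<delta>(2)])
        from 0[OF moll_reflect_test[OF this]] show ?thesis by (simp add: conv_def)
      qed
      then have "(\<lambda>n. conv (moll (r n)) h x) \<longlonglongrightarrow> 0"
        by (intro tendsto_eventually) (auto simp: eventually_sequentially)
      then show "h x = 0" using elim LIMSEQ_unique by blast
    qed
  qed
qed

subsection \<open>Integration by parts\<close>

lemma integrable_bounded_compact_support:
  fixes w :: "'a::euclidean_space \<Rightarrow> 'b::euclidean_space"
  assumes "w \<in> borel_measurable borel" "compact K" "\<And>x. x \<notin> K \<Longrightarrow> w x = 0" "\<And>x. norm (w x) \<le> C"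
  shows "integrable lborel w"
proof (rule Bochner_Integration.integrable_bound[of _ "\<lambda>x. C * indicat_real K x"])
  have "K \<in> sets lborel" "emeasure lborel K < \<infinity>"
    using assms(2) emeasure_bounded_finite[OF compact_imp_bounded] by (auto intro: borel_compact)
  then show "integrable lborel (\<lambda>x. C * indicat_real K x)" by auto
  have "norm (w x) \<le> norm (C * indicat_real K x)" for x
    using assms(3)[of x] order_trans[OF assms(4)[of x] abs_ge_self] by (cases "x \<in> K") auto
  then show "AE x in lborel. norm (w x) \<le> norm (C * indicat_real K x)" by simp
qed (use assms(1) in auto)

text \<open>The integral of a difference quotient vanishes by translation invariance.\<close>

lemma integral_directional_derivative:
  fixes w w' :: "'a::euclidean_space \<Rightarrow> 'b::euclidean_space"
  assumes w: "integrable lborel w"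
    and der: "\<And>x. ((\<lambda>t. w (x + t *\<^sub>R e)) has_vector_derivative w' x) (at 0)"
    and B: "\<And>x. norm (w' x) \<le> B" and R: "\<And>x. norm x > R \<Longrightarrow> w x = 0"
  shows "(LBINT x. w' x) = 0"
proof -
  have [measurable]: "w \<in> borel_measurable borel" using w by auto
  have B0: "B \<ge> 0" using B[of 0] norm_ge_zero order_trans by blast
  define q where "q n x = (w (x + inverse (real (Suc n)) *\<^sub>R e) - w x) /\<^sub>R inverse (real (Suc n))" for n x
  have [measurable]: "q n \<in> borel_measurable borel" for n unfolding q_def by measurable
  have der': "((\<lambda>t. w (x + t *\<^sub>R e)) has_derivative (\<lambda>s. s *\<^sub>R w' (x + t *\<^sub>R e))) (at t)" for x t
  proof -
    have "((\<lambda>s. w ((x + t *\<^sub>R e) + s *\<^sub>R e)) has_derivative (\<lambda>s. s *\<^sub>R w' (x + t *\<^sub>R e))) (at (t - t))"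
      using der[of "x + t *\<^sub>R e"] by (simp add: has_vector_derivative_def)
    moreover have "((\<lambda>s. s - t) has_derivative (\<lambda>s. s)) (at t)"
      by (auto intro!: derivative_eq_intros)
    ultimately have "(((\<lambda>s. w ((x + t *\<^sub>R e) + s *\<^sub>R e)) \<circ> (\<lambda>s. s - t)) has_derivative
        ((\<lambda>s. s *\<^sub>R w' (x + t *\<^sub>R e)) \<circ> (\<lambda>s. s))) (at t)"
      by (intro diff_chain_at)
    then show ?thesis by (simp add: o_def algebra_simps)
  qed
  have lip: "norm (w (x + t *\<^sub>R e) - w x) \<le> B * \<bar>t\<bar>" for x t
  proof -
    have "norm (w (x + t *\<^sub>R e) - w (x + 0 *\<^sub>R e)) \<le> B * norm (t - 0)"
    proof (rule differentiable_bound[where S=UNIV and f="\<lambda>t. w (x + t *\<^sub>R e)"])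
      show "onorm (\<lambda>s. s *\<^sub>R w' (x + t *\<^sub>R e)) \<le> B" for t
      proof (rule onorm_le)
        fix s :: real
        show "norm (s *\<^sub>R w' (x + t *\<^sub>R e)) \<le> B * norm s"
          using mult_right_mono[OF B[of "x + t *\<^sub>R e"], of "\<bar>s\<bar>"] by (simp add: mult.commute)
      qed
    qed (use der' has_derivative_at_withinI in auto)
    then show ?thesis by simp
  qed
  have qb: "norm (q n x) \<le> B" for n x
  proof -
    have "norm (q n x) = norm (w (x + inverse (real (Suc n)) *\<^sub>R e) - w x) * real (Suc n)"
      by (simp add: q_def)
    also have "\<dots> \<le> (B * \<bar>inverse (real (Suc n))\<bar>) * real (Suc n)"
      by (intro mult_right_mono lip) simp
    also have "\<dots> = B" by simp
    finally show ?thesis .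
  qed
  have q0: "q n x = 0" if "x \<notin> cball 0 (R + norm e)" for n x
  proof -
    have *: "norm x > R + norm e" using that by simp
    have "norm (inverse (real (Suc n)) *\<^sub>R e) \<le> norm e" by (simp add: field_simps)
    moreover have "norm x \<le> norm (x + inverse (real (Suc n)) *\<^sub>R e) + norm (inverse (real (Suc n)) *\<^sub>R e)"
      using norm_triangle_ineq4[of "x + inverse (real (Suc n)) *\<^sub>R e" "inverse (real (Suc n)) *\<^sub>R e"] by simp
    ultimately have "norm (x + inverse (real (Suc n)) *\<^sub>R e) > R" using * by simp
    moreover have "norm x > R" using * norm_ge_zero[of e] by linarith
    ultimately show ?thesis using R by (simp add: q_def)
  qed
  have lim: "(\<lambda>n. q n x) \<longlonglongrightarrow> w' x" for x
  proof -
    have "((\<lambda>h. (w (x + h *\<^sub>R e) - w x) /\<^sub>R h) \<longlongrightarrow> w' x) (at 0)"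
    proof (rule tendsto_norm_zero_cancel[THEN Lim_null[THEN iffD2]])
      have "((\<lambda>h. norm (w (x + h *\<^sub>R e) - w x - h *\<^sub>R w' x) / norm h) \<longlongrightarrow> 0) (at 0)"
        using der[of x] by (simp add: has_vector_derivative_def has_derivative_at)
      then show "((\<lambda>h. norm ((w (x + h *\<^sub>R e) - w x) /\<^sub>R h - w' x)) \<longlongrightarrow> 0) (at 0)"
      proof (rule Lim_transform_eventually)
        have "norm (w (x + h *\<^sub>R e) - w x - h *\<^sub>R w' x) / norm h = norm ((w (x + h *\<^sub>R e) - w x) /\<^sub>R h - w' x)"
          if "h \<noteq> 0" for h :: real
        proof -
          have "(w (x + h *\<^sub>R e) - w x) /\<^sub>R h - w' x = (w (x + h *\<^sub>R e) - w x - h *\<^sub>R w' x) /\<^sub>R h"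
            using that by (simp add: scaleR_diff_right)
          then show ?thesis by (simp add: divide_inverse mult.commute)
        qed
        then show "\<forall>\<^sub>F h in at 0. norm (w (x + h *\<^sub>R e) - w x - h *\<^sub>R w' x) / norm h =
            norm ((w (x + h *\<^sub>R e) - w x) /\<^sub>R h - w' x)"
          by (auto simp: eventually_at_filter)
      qed
    qed
    then show ?thesis
      using LIMSEQ_inverse_real_of_nat
      unfolding tendsto_at_iff_sequentially q_def
      by (elim allE[of _ "\<lambda>n. inverse (real (Suc n))"]) (auto simp: o_def)
  qed
  have [measurable]: "w' \<in> borel_measurable borel"
    by (rule borel_measurable_LIMSEQ_metric[OF _ lim]) measurable
  have "(\<lambda>n. LBINT x. q n x) \<longlonglongrightarrow> (LBINT x. w' x)"
  proof (rule integral_dominated_convergence[where w="\<lambda>x. B * indicat_real (cball 0 (R + norm e)) x"])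
    show "integrable lborel (\<lambda>x::'a. B * indicat_real (cball 0 (R + norm e)) x)"
      by (rule integrable_bounded_compact_support[where C=B and K="cball 0 (R + norm e)"]) (use B0 in \<open>auto simp: indicator_def\<close>)
    show "AE x in lborel. norm (q n x) \<le> B * indicat_real (cball 0 (R + norm e)) x" for n
      using qb[of n] q0[of _ n] by (intro AE_I2) (auto simp: indicator_def)
  qed (use lim in auto)
  moreover have "(LBINT x. q n x) = 0" for n
  proof -
    have "(LBINT x. w (x - (- inverse (real (Suc n)) *\<^sub>R e))) = (LBINT x. w x)"
      by (rule integral_shift_borel) measurable
    moreover have "integrable lborel (\<lambda>x. w (x - (- inverse (real (Suc n)) *\<^sub>R e)))"
      by (rule integrable_shift_borel[OF w])
    ultimately show ?thesis using w by (simp add: q_def)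
  qed
  ultimately have "(\<lambda>n. 0) \<longlonglongrightarrow> (LBINT x. w' x)" by simp
  then show ?thesis using LIMSEQ_unique tendsto_const by blast
qed

lemma has_vector_derivative_along:
  fixes w :: "real^'d::finite \<Rightarrow> 'b::real_normed_vector"
  assumes "(w has_derivative w') (at x)"
  shows "((\<lambda>t. w (x + t *\<^sub>R e)) has_vector_derivative w' e) (at 0)"
proof -
  have "((\<lambda>t::real. x + t *\<^sub>R e) has_derivative (\<lambda>t. t *\<^sub>R e)) (at 0)"
    by (auto intro!: derivative_eq_intros)
  then have "((w \<circ> (\<lambda>t::real. x + t *\<^sub>R e)) has_derivative (w' \<circ> (\<lambda>t. t *\<^sub>R e))) (at 0)"
    using assms by (intro diff_chain_at) auto
  moreover have "linear w'" using assms by (rule has_derivative_linear)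
  ultimately show ?thesis
    by (simp add: has_vector_derivative_def o_def linear_scale)
qed

lemma wd_test_function:
  fixes v :: "real^'d::finite \<Rightarrow> 'b::euclidean_space"
  assumes v: "v \<in> test_functions V"
  shows "wd U i v (partial_deriv i v)"
  unfolding wd_def
proof (intro conjI ballI)
  note vi = test_functions_partial[OF v]
  show "integrable lborel v" "integrable lborel (partial_deriv i v)"
    by (rule test_function_integrable[OF v], rule test_function_integrable[OF vi])
  fix \<phi> :: "real^'d \<Rightarrow> real" assume \<phi>: "\<phi> \<in> test_functions U"
  note \<phi>i = test_functions_partial[OF \<phi>]
  note pi = test_functions_scaleR[OF \<phi> test_functionsD(1)[OF vi]]
  note ip = test_functions_scaleR[OF \<phi>i test_functionsD(1)[OF v]]
  note pv = test_functions_scaleR[OF \<phi> test_functionsD(1)[OF v]]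
  let ?w = "\<lambda>x. \<phi> x *\<^sub>R v x"
  have eq: "partial_deriv i ?w x = \<phi> x *\<^sub>R partial_deriv i v x + partial_deriv i \<phi> x *\<^sub>R v x" for x
    by (intro partial_deriv_scaleR smoothD(2) test_functionsD(1)[OF v] test_functionsD(1)[OF \<phi>])
  obtain B where B: "\<And>x. norm (partial_deriv i ?w x) \<le> B"
    using test_function_bounded[OF pv] by metis
  obtain R where R: "\<And>x. x \<in> closure {x. ?w x \<noteq> 0} \<Longrightarrow> norm x \<le> R"
    using compact_imp_bounded[OF test_functionsD(2)[OF pv]] unfolding bounded_iff by blast
  have "(LBINT x. partial_deriv i ?w x) = 0"
  proof (rule integral_directional_derivative[OF test_function_integrable[OF pv] _ B])
    show "((\<lambda>t. ?w (x + t *\<^sub>R axis i 1)) has_vector_derivative partial_deriv i ?w x) (at 0)" for x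
      unfolding partial_deriv_def
      by (intro has_vector_derivative_along iffD1[OF frechet_derivative_works] smoothD(2) test_functionsD(1)[OF pv])
    show "?w x = 0" if "norm x > R" for x
    proof (rule test_functions_support(1)[OF pv])
      show "x \<notin> closure {x. ?w x \<noteq> 0}" using R[of x] that by linarith
    qed
  qed
  then show "(LBINT x. partial_deriv i \<phi> x *\<^sub>R v x) = - (LBINT x. \<phi> x *\<^sub>R partial_deriv i v x)"
    using test_function_integrable[OF pi] test_function_integrable[OF ip]
    unfolding eq by (simp add: add_eq_0_iff)
qed

subsection \<open>The chain rule\<close>

lemma norm_LBINT_le:
  fixes f :: "'a::euclidean_space \<Rightarrow> 'b::euclidean_space"
  assumes "\<And>x. norm (f x) \<le> g x" "integrable lborel f" "integrable lborel g"
  shows "norm (LBINT x. f x) \<le> (LBINT x. g x)"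
  by (rule order_trans[OF integral_norm_bound integral_mono]) (use assms in auto)

text \<open>A mollified value is a weighted mean, which every half space containing \<open>I\<close> contains as well.\<close>

lemma conv_in_closed_convex:
  fixes f :: "real^'d::finite \<Rightarrow> 'a::euclidean_space"
  assumes I: "convex I" "closed I" and f: "integrable lborel f"
    and fI: "\<And>y. y \<in> cball x (inverse (real (Suc n))) \<Longrightarrow> f y \<in> I"
  shows "conv (moll n) f x \<in> I"
proof (rule ccontr)
  assume "conv (moll n) f x \<notin> I"
  then obtain a b where ab: "a \<bullet> conv (moll n) f x < b" "\<And>y. y \<in> I \<Longrightarrow> a \<bullet> y > b"
    using separating_hyperplane_closed_point[OF I] by blast
  let ?\<rho> = "\<lambda>y. moll n (x - y)"
  have i\<rho>: "integrable lborel ?\<rho>" by (rule integrable_reflect_borel[OF moll_integrable])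
  have fi: "integrable lborel (\<lambda>y. ?\<rho> y *\<^sub>R f y)" by (rule conv_integrable[OF moll_test f])
  have "b = (LBINT y. ?\<rho> y * b)"
    using integral_reflect_borel[of "moll n" x] i\<rho> by (simp add: integral_moll)
  also have "\<dots> \<le> (LBINT y. a \<bullet> (?\<rho> y *\<^sub>R f y))"
  proof (rule integral_mono)
    show "?\<rho> y * b \<le> a \<bullet> (?\<rho> y *\<^sub>R f y)" for y
    proof (cases "y \<in> cball x (inverse (real (Suc n)))")
      case True
      then show ?thesis
        using ab(2)[OF fI[OF True]] moll_nonneg[of n "x - y"] by (simp add: mult_left_mono)
    next
      case False
      then have "?\<rho> y = 0" by (intro moll_eq_0) (simp add: dist_norm)
      then show ?thesis by simp
    qed
  next
    show "integrable lborel (\<lambda>y. a \<bullet> (?\<rho> y *\<^sub>R f y))" by (intro integrable_inner_right fi)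
  qed (use i\<rho> in auto)
  also have "\<dots> = a \<bullet> conv (moll n) f x"
    unfolding conv_def by (rule integral_inner_right) (rule fi)
  finally show False using ab(1) by simp
qed

lemma compact_mollifier_margin:
  fixes U :: "(real^'d::finite) set"
  assumes "compact K" "open U" "K \<subseteq> U"
  obtains N where "\<And>n x. n \<ge> N \<Longrightarrow> x \<in> K \<Longrightarrow> cball x (inverse (real (Suc n))) \<subseteq> U"
proof -
  obtain \<delta> where \<delta>: "\<delta> > 0" "(\<Union>x\<in>K. cball x \<delta>) \<subseteq> U"
    using compact_subset_open_imp_cball_epsilon_subset[OF assms] by blast
  obtain N where N: "\<And>n. n \<ge> N \<Longrightarrow> inverse (real (Suc n)) \<le> \<delta>"
    using moll_radius_small[OF \<delta>(1)] by blast
  have "cball x (inverse (real (Suc n))) \<subseteq> U" if "n \<ge> N" "x \<in> K" for n x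
    using subset_cball[OF N[OF that(1)], of x] \<delta>(2) that(2) by blast
  then show ?thesis using that by blast
qed

text \<open>For smooth functions the chain rule is classical.  It passes to the limit because mollified
  functions stay in the closed convex set that contains the values of \<open>f\<close>, on which the
  derivative of \<open>F\<close> is bounded and continuous.\<close>

lemma wd_chain_linear:
  fixes f g :: "real^'d::finite \<Rightarrow> 'a::euclidean_space" and F :: "'a \<Rightarrow> 'b::euclidean_space"
  assumes U: "open U" "bounded U" and fg: "wd U i f g"
    and I: "convex I" "closed I" "\<And>x. x \<in> U \<Longrightarrow> f x \<in> I"
    and F: "\<And>y. y \<in> I \<Longrightarrow> (F has_derivative F' y) (at y)"
    and cont: "\<And>h. continuous_on I (\<lambda>y. F' y h)"
    and bound: "\<And>y h. y \<in> I \<Longrightarrow> norm (F' y h) \<le> B * norm h"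
    and Fm [measurable]: "F \<in> borel_measurable borel"
    and F'm: "(\<lambda>p. F' (fst p) (snd p)) \<in> borel_measurable (borel \<Otimes>\<^sub>M borel)"
    and lin: "\<And>y. linear (F' y)"
  shows "wd U i (\<lambda>x. indicat_real U x *\<^sub>R F (f x)) (\<lambda>x. indicat_real U x *\<^sub>R F' (f x) (g x))"
proof -
  have [measurable]: "f \<in> borel_measurable borel" "g \<in> borel_measurable borel" "U \<in> sets borel"
    using wdD[OF fg] U by auto
  have F'm' [measurable]: "(\<lambda>x. F' (p x) (q x)) \<in> borel_measurable M"
    if [measurable]: "p \<in> borel_measurable M" "q \<in> borel_measurable M" for M :: "'z measure" and p q
    using measurable_compose[OF _ F'm, of "\<lambda>x. (p x, q x)" M] by simp
  have finU: "emeasure lborel U < \<infinity>" using emeasure_bounded_finite[OF U(2)] by simp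
  have lip: "norm (F y - F z) \<le> B * norm (y - z)" if "y \<in> I" "z \<in> I" for y z
  proof (rule differentiable_bound[OF I(1)])
    show "(F has_derivative F' y) (at y within I)" if "y \<in> I" for y
      using F[OF that] by (rule has_derivative_at_withinI)
    show "onorm (F' y) \<le> B" if "y \<in> I" for y
      using bound[OF that] by (rule onorm_le)
  qed (use that in auto)
  have IFf: "integrable lborel (\<lambda>x. indicat_real U x *\<^sub>R F (f x))"
  proof (cases "U = {}")
    case False
    then obtain x0 where x0: "x0 \<in> U" by blast
    show ?thesis
    proof (rule Bochner_Integration.integrable_bound)
      show "integrable lborel (\<lambda>x. norm (F (f x0)) * indicat_real U x + \<bar>B\<bar> * (norm (f x) + norm (f x0) * indicat_real U x))"
        using wdD(1)[OF fg] finU by auto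
      show "AE x in lborel. norm (indicat_real U x *\<^sub>R F (f x)) \<le>
         norm (norm (F (f x0)) * indicat_real U x + \<bar>B\<bar> * (norm (f x) + norm (f x0) * indicat_real U x))"
      proof (rule AE_I2)
        fix x
        have "norm (F (f x)) \<le> norm (F (f x0)) + \<bar>B\<bar> * (norm (f x) + norm (f x0))" if "x \<in> U"
        proof -
          have "norm (F (f x)) \<le> norm (F (f x0)) + norm (F (f x) - F (f x0))"
            using norm_triangle_sub[of "F (f x)" "F (f x0)"] by simp
          also have "norm (F (f x) - F (f x0)) \<le> B * norm (f x - f x0)"
            by (intro lip I(3) x0 that)
          also have "\<dots> \<le> \<bar>B\<bar> * (norm (f x) + norm (f x0))"
            by (intro mult_mono norm_triangle_ineq4) auto
          finally show ?thesis by simp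
        qed
        then show "norm (indicat_real U x *\<^sub>R F (f x)) \<le>
           norm (norm (F (f x0)) * indicat_real U x + \<bar>B\<bar> * (norm (f x) + norm (f x0) * indicat_real U x))"
          by (cases "x \<in> U") (auto intro: order_trans[OF _ abs_ge_self])
      qed
    qed measurable
  qed simp
  have IFg: "integrable lborel (\<lambda>x. indicat_real U x *\<^sub>R F' (f x) (g x))"
  proof (rule Bochner_Integration.integrable_bound[of _ "\<lambda>x. B * norm (g x)"])
    show "AE x in lborel. norm (indicat_real U x *\<^sub>R F' (f x) (g x)) \<le> norm (B * norm (g x))"
    proof (rule AE_I2)
      fix x show "norm (indicat_real U x *\<^sub>R F' (f x) (g x)) \<le> norm (B * norm (g x))"
        using bound[OF I(3), of x "g x"] by (cases "x \<in> U") (auto intro: order_trans[OF _ abs_ge_self])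
    qed
  qed (use wdD(2)[OF fg] in auto)
  show ?thesis
    unfolding wd_def
  proof (intro conjI ballI IFf IFg)
    fix \<phi> :: "real^'d \<Rightarrow> real" assume \<phi>: "\<phi> \<in> test_functions U"
    note \<phi>i = test_functions_partial[OF \<phi>, of i]
    define K where "K = closure {x. \<phi> x \<noteq> 0}"
    have K: "compact K" "K \<subseteq> U" using test_functionsD[OF \<phi>] by (auto simp: K_def)
    have off: "\<phi> x = 0" "partial_deriv i \<phi> x = 0" if "x \<notin> K" for x
      using test_functions_support[OF \<phi>] that unfolding K_def by blast+
    obtain C where C: "C \<ge> 0" "\<And>x. \<bar>\<phi> x\<bar> \<le> C" "\<And>x. \<bar>partial_deriv i \<phi> x\<bar> \<le> C"
      using test_function_bounded[OF \<phi>] by (metis real_norm_def)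
    note [measurable] = test_function_measurable[OF \<phi>] test_function_measurable[OF \<phi>i]
    obtain N where N: "\<And>n x. n \<ge> N \<Longrightarrow> x \<in> K \<Longrightarrow> cball x (inverse (real (Suc n))) \<subseteq> U"
      using compact_mollifier_margin[OF K(1) U(1) K(2)] by blast
    define fn where "fn n = conv (moll n) f" for n
    define gn where "gn n = conv (moll n) g" for n
    have [measurable]: "fn n \<in> borel_measurable borel" "gn n \<in> borel_measurable borel" for n
      using conv_measurable wdD(1,2)[OF fg] by (auto simp: fn_def gn_def)
    have sfn: "smooth (fn n)" for n unfolding fn_def by (rule smooth_conv[OF moll_test wdD(1)[OF fg]])
    have sgn: "smooth (gn n)" for n unfolding gn_def by (rule smooth_conv[OF moll_test wdD(2)[OF fg]])
    have fnI: "fn n x \<in> I" and fngn: "partial_deriv i (fn n) x = gn n x" if "n \<ge> N" "x \<in> K" for n x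
      using conv_in_closed_convex[OF I(1,2) wdD(1)[OF fg], of x n] I(3) wd_conv[OF fg N[OF that]] N[OF that]
      by (auto simp: fn_def gn_def subset_iff)
    \<comment> \<open>The classical identity for the mollified functions.\<close>
    have parts: "(LBINT x. partial_deriv i \<phi> x *\<^sub>R F (fn n x)) = - (LBINT x. \<phi> x *\<^sub>R F' (fn n x) (gn n x))"
      and parts_int: "integrable lborel (\<lambda>x. partial_deriv i \<phi> x *\<^sub>R F (fn n x))"
        "integrable lborel (\<lambda>x. \<phi> x *\<^sub>R F' (fn n x) (gn n x))" if n: "n \<ge> N" for n
    proof -
      have "compact (fn n ` K)" "compact (gn n ` K)"
        using K(1) smoothD(1)[OF sfn] smoothD(1)[OF sgn]
        by (auto intro!: compact_continuous_image intro: continuous_on_subset)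
      moreover have "continuous_on (fn n ` K) F"
      proof (rule continuous_at_imp_continuous_on, rule ballI)
        fix y assume "y \<in> fn n ` K"
        then show "isCont F y" using F[of y] fnI[OF n] has_derivative_continuous by blast
      qed
      ultimately have "bounded (F ` (fn n ` K))" "bounded (gn n ` K)"
        by (auto intro: compact_imp_bounded compact_continuous_image)
      then obtain C1 C2 where C1: "\<And>x. x \<in> K \<Longrightarrow> norm (F (fn n x)) \<le> C1"
        and C2: "\<And>x. x \<in> K \<Longrightarrow> norm (gn n x) \<le> C2"
        unfolding bounded_iff by (metis imageI)
      let ?w = "\<lambda>x. \<phi> x *\<^sub>R F (fn n x)"
      let ?a = "\<lambda>x. partial_deriv i \<phi> x *\<^sub>R F (fn n x)"
      let ?b = "\<lambda>x. \<phi> x *\<^sub>R F' (fn n x) (gn n x)"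
      have bw: "norm (?w x) \<le> C * \<bar>C1\<bar>" and ba: "norm (?a x) \<le> C * \<bar>C1\<bar>" for x
        using C(1) C(2)[of x] C(3)[of x] C1[of x] off[of x]
        by (cases "x \<in> K"; auto intro!: mult_mono)+
      have bb: "norm (?b x) \<le> C * (\<bar>B\<bar> * \<bar>C2\<bar>)" for x
      proof (cases "x \<in> K")
        case True
        have "norm (F' (fn n x) (gn n x)) \<le> B * norm (gn n x)" by (rule bound[OF fnI[OF n True]])
        also have "\<dots> \<le> \<bar>B\<bar> * \<bar>C2\<bar>" using C2[OF True] by (intro mult_mono) auto
        finally show ?thesis using C by (auto intro!: mult_mono)
      qed (use off C in auto)
      have iw: "integrable lborel ?w" and ia: "integrable lborel ?a" and ib: "integrable lborel ?b"
        by (rule integrable_bounded_compact_support[OF _ K(1)]; (use off bw ba bb in measurable)?;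
            use off bw ba bb in auto)+
      have "(LBINT x. ?a x + ?b x) = 0"
      proof -
        obtain R where R: "\<And>x. x \<in> K \<Longrightarrow> norm x \<le> R"
          using compact_imp_bounded[OF K(1)] unfolding bounded_iff by blast
        show ?thesis
        proof (rule integral_directional_derivative[OF iw, where e="axis i 1"])
          show "norm (?a x + ?b x) \<le> C * \<bar>C1\<bar> + C * (\<bar>B\<bar> * \<bar>C2\<bar>)" for x
            using norm_triangle_ineq[of "?a x" "?b x"] ba[of x] bb[of x] by linarith
          show "?w x = 0" if "norm x > R" for x
            using off(1)[of x] R[of x] that by (cases "x \<in> K") auto
          show "((\<lambda>t. ?w (x + t *\<^sub>R axis i 1)) has_vector_derivative ?a x + ?b x) (at 0)" for x
          proof (cases "x \<in> K")
            case True
            let ?P = "\<lambda>h. \<Sum>j\<in>UNIV. (h $ j) *\<^sub>R partial_deriv j \<phi> x"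
            let ?Q = "\<lambda>h. \<Sum>j\<in>UNIV. (h $ j) *\<^sub>R partial_deriv j (fn n) x"
            have ax: "(\<Sum>j\<in>UNIV. (axis i (1::real) $ j) *\<^sub>R p j) = (p i :: 'c::real_vector)" for p
            proof -
              have "(\<Sum>j\<in>UNIV. (axis i (1::real) $ j) *\<^sub>R p j) = (\<Sum>j\<in>UNIV. if j = i then p j else 0)"
                by (rule sum.cong) (auto simp: axis_def)
              then show ?thesis by simp
            qed
            have d\<phi>: "(\<phi> has_derivative ?P) (at x)"
              by (rule has_derivative_partials[OF smoothD(2)[OF test_functionsD(1)[OF \<phi>]]])
            have dfn: "(fn n has_derivative ?Q) (at x)"
              by (rule has_derivative_partials[OF smoothD(2)[OF sfn]])
            have "((F \<circ> fn n) has_derivative (F' (fn n x) \<circ> ?Q)) (at x)"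
              using dfn F[OF fnI[OF n True]] by (rule diff_chain_at)
            then have dF: "((\<lambda>x. F (fn n x)) has_derivative (\<lambda>h. F' (fn n x) (?Q h))) (at x)"
              by (simp add: o_def)
            from has_vector_derivative_along[OF has_derivative_scaleR[OF d\<phi> dF], of "axis i 1"]
            show ?thesis by (simp add: ax fngn[OF n True] add.commute del: real_scaleR_def)
          next
            case False
            have "(?w has_derivative (\<lambda>h. 0)) (at x)"
            proof (rule has_derivative_transform_within_open[where s="- K" and f="\<lambda>x. 0"])
              show "open (- K)" using K(1) by (simp add: compact_imp_closed open_Compl)
            qed (use False off in auto)
            from has_vector_derivative_along[OF this, of "axis i 1"] show ?thesis
              using off[OF False] by simp
          qed
        qed
      qed
      then have "(LBINT x. ?a x) + (LBINT x. ?b x) = 0" using ia ib by simp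
      then show "(LBINT x. ?a x) = - (LBINT x. ?b x)" by (simp add: add_eq_0_iff2)
      show "integrable lborel ?a" "integrable lborel ?b" by (fact ia, fact ib)
    qed
    obtain r0 where r0: "strict_mono r0" "AE x in lborel. (\<lambda>n. fn (r0 n) x) \<longlonglongrightarrow> f x"
      unfolding fn_def using conv_AE_subseq[OF wdD(1)[OF fg]] by blast
    define r where "r n = r0 (n + N)" for n
    have rN: "r n \<ge> N" for n using seq_suble[OF r0(1), of "n + N"] by (simp add: r_def)
    have rmono: "strict_mono r" using r0(1) by (auto simp: r_def strict_mono_def)
    have rlim: "AE x in lborel. (\<lambda>n. fn (r n) x) \<longlonglongrightarrow> f x"
      using r0(2) unfolding r_def by eventually_elim (rule LIMSEQ_ignore_initial_segment)
    have fL1: "(\<lambda>n. LBINT x. norm (fn (r n) x - f x)) \<longlonglongrightarrow> 0"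
      unfolding fn_def using LIMSEQ_subseq_LIMSEQ[OF conv_tendsto_L1[OF wdD(1)[OF fg]] rmono] by (simp add: o_def)
    have gL1: "(\<lambda>n. LBINT x. norm (gn (r n) x - g x)) \<longlonglongrightarrow> 0"
      unfolding gn_def using LIMSEQ_subseq_LIMSEQ[OF conv_tendsto_L1[OF wdD(2)[OF fg]] rmono] by (simp add: o_def)
    have fni: "integrable lborel (fn n)" "integrable lborel (gn n)" for n
      unfolding fn_def gn_def by (intro integrable_conv wdD(1,2)[OF fg])+
    have bddi: "integrable lborel (\<lambda>x. \<psi> x *\<^sub>R h x)" if "integrable lborel h" "\<psi> \<in> borel_measurable borel" "\<And>x. \<bar>\<psi> x\<bar> \<le> C"
      for h :: "real^'d \<Rightarrow> 'b" and \<psi> :: "real^'d \<Rightarrow> real"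
      by (rule integrable_bounded_scaleR[OF that])
    have limI: "(\<lambda>x. partial_deriv i \<phi> x *\<^sub>R (indicat_real U x *\<^sub>R F (f x))) = (\<lambda>x. partial_deriv i \<phi> x *\<^sub>R F (f x))"
      "(\<lambda>x. \<phi> x *\<^sub>R (indicat_real U x *\<^sub>R F' (f x) (g x))) = (\<lambda>x. \<phi> x *\<^sub>R F' (f x) (g x))"
      using test_functions_eq_0[OF \<phi>] by (auto simp: indicator_def fun_eq_iff)
    have iL: "integrable lborel (\<lambda>x. partial_deriv i \<phi> x *\<^sub>R F (f x))"
      using bddi[OF IFf test_function_measurable[OF \<phi>i] C(3)] unfolding limI(1) .
    have iR: "integrable lborel (\<lambda>x. \<phi> x *\<^sub>R F' (f x) (g x))"
      using bddi[OF IFg test_function_measurable[OF \<phi>] C(2)] unfolding limI(2) .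
    have L: "(\<lambda>n. LBINT x. partial_deriv i \<phi> x *\<^sub>R F (fn (r n) x)) \<longlonglongrightarrow> (LBINT x. partial_deriv i \<phi> x *\<^sub>R F (f x))"
    proof (rule Lim_null[THEN iffD2, OF Lim_null_comparison])
      show "\<forall>\<^sub>F n in sequentially. norm ((LBINT x. partial_deriv i \<phi> x *\<^sub>R F (fn (r n) x)) - (LBINT x. partial_deriv i \<phi> x *\<^sub>R F (f x)))
          \<le> C * \<bar>B\<bar> * (LBINT x. norm (fn (r n) x - f x))"
      proof (intro always_eventually allI)
        fix n
        have "norm ((LBINT x. partial_deriv i \<phi> x *\<^sub>R F (fn (r n) x)) - (LBINT x. partial_deriv i \<phi> x *\<^sub>R F (f x))) =
          norm (LBINT x. partial_deriv i \<phi> x *\<^sub>R F (fn (r n) x) - partial_deriv i \<phi> x *\<^sub>R F (f x))"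
          using parts_int(1)[OF rN] iL by simp
        also have "\<dots> \<le> (LBINT x. C * \<bar>B\<bar> * norm (fn (r n) x - f x))"
        proof (rule norm_LBINT_le)
          fix x
          show "norm (partial_deriv i \<phi> x *\<^sub>R F (fn (r n) x) - partial_deriv i \<phi> x *\<^sub>R F (f x)) \<le> C * \<bar>B\<bar> * norm (fn (r n) x - f x)"
          proof (cases "x \<in> K")
            case True
            have "norm (F (fn (r n) x) - F (f x)) \<le> B * norm (fn (r n) x - f x)"
              using True K(2) by (intro lip fnI rN I(3)) auto
            also have "\<dots> \<le> \<bar>B\<bar> * norm (fn (r n) x - f x)" by (intro mult_right_mono) auto
            finally have "\<bar>partial_deriv i \<phi> x\<bar> * norm (F (fn (r n) x) - F (f x)) \<le> C * (\<bar>B\<bar> * norm (fn (r n) x - f x))"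
              using C by (intro mult_mono) auto
            then show ?thesis by (simp add: mult.assoc flip: scaleR_diff_right)
          qed (use off C in auto)
        qed (use parts_int(1)[OF rN] iL fni wdD(1)[OF fg] in auto)
        finally show "norm ((LBINT x. partial_deriv i \<phi> x *\<^sub>R F (fn (r n) x)) - (LBINT x. partial_deriv i \<phi> x *\<^sub>R F (f x)))
          \<le> C * \<bar>B\<bar> * (LBINT x. norm (fn (r n) x - f x))" by simp
      qed
      show "(\<lambda>n. C * \<bar>B\<bar> * (LBINT x. norm (fn (r n) x - f x))) \<longlonglongrightarrow> 0"
        by (rule tendsto_mult_right_zero[OF fL1])
    qed
    have dom: "norm (\<phi> x *\<^sub>R F' (fn (r n) x) (g x)) \<le> C * (\<bar>B\<bar> * norm (g x))" for n x
    proof (cases "x \<in> K")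
      case True
      have "norm (F' (fn (r n) x) (g x)) \<le> \<bar>B\<bar> * norm (g x)"
        by (rule order_trans[OF bound[OF fnI[OF rN True]]]) (intro mult_right_mono, auto)
      then have "\<bar>\<phi> x\<bar> * norm (F' (fn (r n) x) (g x)) \<le> C * (\<bar>B\<bar> * norm (g x))"
        using C by (intro mult_mono) auto
      then show ?thesis by simp
    qed (use off C in auto)
    have iM: "integrable lborel (\<lambda>x. \<phi> x *\<^sub>R F' (fn (r n) x) (g x))" for n
    proof (rule Bochner_Integration.integrable_bound[of _ "\<lambda>x. C * (\<bar>B\<bar> * norm (g x))"])
      show "AE x in lborel. norm (\<phi> x *\<^sub>R F' (fn (r n) x) (g x)) \<le> norm (C * (\<bar>B\<bar> * norm (g x)))"
        by (rule AE_I2, rule order_trans[OF dom]) simp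
    qed (use wdD(2)[OF fg] in auto)
    have R1: "(\<lambda>n. LBINT x. \<phi> x *\<^sub>R F' (fn (r n) x) (g x)) \<longlonglongrightarrow> (LBINT x. \<phi> x *\<^sub>R F' (f x) (g x))"
    proof (rule integral_dominated_convergence[where w="\<lambda>x. C * (\<bar>B\<bar> * norm (g x))"])
      show "AE x in lborel. (\<lambda>n. \<phi> x *\<^sub>R F' (fn (r n) x) (g x)) \<longlonglongrightarrow> \<phi> x *\<^sub>R F' (f x) (g x)"
        using rlim
      proof eventually_elim
        case (elim x)
        show ?case
        proof (cases "x \<in> K")
          case True
          have "(\<lambda>n. F' (fn (r n) x) (g x)) \<longlonglongrightarrow> F' (f x) (g x)"
            using True K(2) fnI[OF rN True] elim
            by (intro continuous_on_tendsto_compose[OF cont elim]) (auto intro: I(3))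
          then show ?thesis by (intro tendsto_intros)
        qed (simp add: off)
      qed
      show "AE x in lborel. norm (\<phi> x *\<^sub>R F' (fn (r n) x) (g x)) \<le> C * (\<bar>B\<bar> * norm (g x))" for n
        by (intro AE_I2 dom)
    qed (use wdD(2)[OF fg] in auto)
    have R2: "(\<lambda>n. (LBINT x. \<phi> x *\<^sub>R F' (fn (r n) x) (gn (r n) x)) - (LBINT x. \<phi> x *\<^sub>R F' (fn (r n) x) (g x))) \<longlonglongrightarrow> 0"
    proof (rule Lim_null_comparison)
      show "\<forall>\<^sub>F n in sequentially. norm ((LBINT x. \<phi> x *\<^sub>R F' (fn (r n) x) (gn (r n) x)) - (LBINT x. \<phi> x *\<^sub>R F' (fn (r n) x) (g x)))
          \<le> C * \<bar>B\<bar> * (LBINT x. norm (gn (r n) x - g x))"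
      proof (intro always_eventually allI)
        fix n
        have "norm ((LBINT x. \<phi> x *\<^sub>R F' (fn (r n) x) (gn (r n) x)) - (LBINT x. \<phi> x *\<^sub>R F' (fn (r n) x) (g x))) =
          norm (LBINT x. \<phi> x *\<^sub>R F' (fn (r n) x) (gn (r n) x) - \<phi> x *\<^sub>R F' (fn (r n) x) (g x))"
          using parts_int(2)[OF rN] iM by simp
        also have "\<dots> \<le> (LBINT x. C * \<bar>B\<bar> * norm (gn (r n) x - g x))"
        proof (rule norm_LBINT_le)
          fix x
          show "norm (\<phi> x *\<^sub>R F' (fn (r n) x) (gn (r n) x) - \<phi> x *\<^sub>R F' (fn (r n) x) (g x)) \<le> C * \<bar>B\<bar> * norm (gn (r n) x - g x)"
          proof (cases "x \<in> K")
            case True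
            have "norm (F' (fn (r n) x) (gn (r n) x - g x)) \<le> B * norm (gn (r n) x - g x)"
              by (rule bound[OF fnI[OF rN True]])
            also have "\<dots> \<le> \<bar>B\<bar> * norm (gn (r n) x - g x)" by (intro mult_right_mono) auto
            finally have "\<bar>\<phi> x\<bar> * norm (F' (fn (r n) x) (gn (r n) x - g x)) \<le> C * (\<bar>B\<bar> * norm (gn (r n) x - g x))"
              using C by (intro mult_mono) auto
            then show ?thesis by (simp add: mult.assoc linear_diff[OF lin] flip: scaleR_diff_right)
          qed (use off C in auto)
        qed (use parts_int(2)[OF rN] iM fni wdD(2)[OF fg] in auto)
        finally show "norm ((LBINT x. \<phi> x *\<^sub>R F' (fn (r n) x) (gn (r n) x)) - (LBINT x. \<phi> x *\<^sub>R F' (fn (r n) x) (g x)))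
          \<le> C * \<bar>B\<bar> * (LBINT x. norm (gn (r n) x - g x))" by simp
      qed
      show "(\<lambda>n. C * \<bar>B\<bar> * (LBINT x. norm (gn (r n) x - g x))) \<longlonglongrightarrow> 0"
        by (rule tendsto_mult_right_zero[OF gL1])
    qed
    have "(\<lambda>n. LBINT x. \<phi> x *\<^sub>R F' (fn (r n) x) (gn (r n) x)) \<longlonglongrightarrow> (LBINT x. \<phi> x *\<^sub>R F' (f x) (g x))"
      using tendsto_add[OF R2 R1] by simp
    then have "(\<lambda>n. - (LBINT x. \<phi> x *\<^sub>R F' (fn (r n) x) (gn (r n) x))) \<longlonglongrightarrow> - (LBINT x. \<phi> x *\<^sub>R F' (f x) (g x))"
      by (rule tendsto_minus)
    then have "(\<lambda>n. LBINT x. partial_deriv i \<phi> x *\<^sub>R F (fn (r n) x)) \<longlonglongrightarrow> - (LBINT x. \<phi> x *\<^sub>R F' (f x) (g x))"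
      using parts[OF rN] by simp
    with L have "(LBINT x. partial_deriv i \<phi> x *\<^sub>R F (f x)) = - (LBINT x. \<phi> x *\<^sub>R F' (f x) (g x))"
      by (rule LIMSEQ_unique)
    then show "(LBINT x. partial_deriv i \<phi> x *\<^sub>R (indicat_real U x *\<^sub>R F (f x))) =
        - (LBINT x. \<phi> x *\<^sub>R (indicat_real U x *\<^sub>R F' (f x) (g x)))"
      unfolding limI .
  qed
qed

lemma wd_chain:
  fixes f g :: "real^'d::finite \<Rightarrow> 'a::euclidean_space" and F :: "'a \<Rightarrow> 'b::euclidean_space"
  assumes U: "open U" "bounded U" and fg: "wd U i f g"
    and I: "convex I" "closed I" "\<And>x. x \<in> U \<Longrightarrow> f x \<in> I"
    and F: "\<And>y. y \<in> I \<Longrightarrow> (F has_derivative F' y) (at y)"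
    and cont: "\<And>h. continuous_on I (\<lambda>y. F' y h)"
    and bound: "\<And>y h. y \<in> I \<Longrightarrow> norm (F' y h) \<le> B * norm h"
    and Fm: "F \<in> borel_measurable borel"
    and F'm: "\<And>h. (\<lambda>y. F' y h) \<in> borel_measurable borel"
  shows "wd U i (\<lambda>x. indicat_real U x *\<^sub>R F (f x)) (\<lambda>x. indicat_real U x *\<^sub>R F' (f x) (g x))"
proof -
  \<comment> \<open>Outside \<open>I\<close> the derivative is replaced by a linear map that depends measurably on the point.\<close>
  define G where "G y h = (\<Sum>b\<in>Basis. (h \<bullet> b) *\<^sub>R F' y b)" for y h
  have G: "G y = F' y" if "y \<in> I" for y
  proof
    fix h
    have l: "linear (F' y)" using F[OF that] by (rule has_derivative_linear)
    have "F' y h = F' y (\<Sum>b\<in>Basis. (h \<bullet> b) *\<^sub>R b)" by (simp add: euclidean_representation)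
    also have "\<dots> = G y h" by (simp add: G_def linear_sum[OF l] linear_scale[OF l])
    finally show "G y h = F' y h" by simp
  qed
  have "wd U i (\<lambda>x. indicat_real U x *\<^sub>R F (f x)) (\<lambda>x. indicat_real U x *\<^sub>R G (f x) (g x))"
  proof (rule wd_chain_linear[OF U fg I _ _ _ Fm])
    show "(F has_derivative G y) (at y)" if "y \<in> I" for y using F[OF that] G[OF that] by simp
    show "continuous_on I (\<lambda>y. G y h)" for h
      unfolding G_def by (intro continuous_intros cont)
    show "norm (G y h) \<le> B * norm h" if "y \<in> I" for y h using bound[OF that] G[OF that] by simp
    note [measurable] = F'm
    show "(\<lambda>p. G (fst p) (snd p)) \<in> borel_measurable (borel \<Otimes>\<^sub>M borel)"
      unfolding G_def by measurable
    show "linear (G y)" for y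
      by (intro linearI) (simp_all add: G_def inner_add_left scaleR_add_left sum.distrib scaleR_sum_right)
  qed
  moreover have "(\<lambda>x. indicat_real U x *\<^sub>R G (f x) (g x)) = (\<lambda>x. indicat_real U x *\<^sub>R F' (f x) (g x))"
    using G[OF I(3)] by (auto simp: indicator_def fun_eq_iff)
  ultimately show ?thesis by simp
qed

section \<open>Morrey's estimate\<close>

lemma nn_integral_powr_unit_interval:
  fixes s :: real
  assumes "0 < s" "s < 1"
  shows "(\<integral>\<^sup>+t. ennreal (t powr (-s)) * indicator {0..1} t \<partial>lborel) = ennreal (1 / (1 - s))"
proof -
  have "((\<lambda>t. t powr (-s)) has_integral (1 powr (1 - s) / (1 - s) - 0 powr (1 - s) / (1 - s))) {0..1::real}"
  proof (rule fundamental_theorem_of_calculus_interior)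
    show "continuous_on {0..1} (\<lambda>t::real. t powr (1 - s) / (1 - s))"
      using assms by (intro continuous_intros continuous_on_powr') auto
    show "((\<lambda>t. t powr (1 - s) / (1 - s)) has_vector_derivative t powr (-s)) (at t)" if "t \<in> {0<..<1}" for t
    proof -
      have "((\<lambda>t. t powr (1 - s) / (1 - s)) has_real_derivative ((1 - s) * t powr (1 - s - 1)) / (1 - s)) (at t)"
        using that by (intro DERIV_cdivide has_real_derivative_powr) auto
      then show ?thesis using assms by (simp add: has_real_derivative_iff_has_vector_derivative)
    qed
  qed simp
  then have "((\<lambda>t. t powr (-s)) has_integral (1 / (1 - s))) {0..1::real}" by simp
  then show ?thesis by (intro nn_integral_has_integral_lebesgue') auto
qed

lemma nn_integral_affine_image:
  fixes g :: "'a::euclidean_space \<Rightarrow> ennreal"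
  assumes [measurable]: "g \<in> borel_measurable borel" and t: "t > 0"
  shows "(\<integral>\<^sup>+y. g (c + t *\<^sub>R y) \<partial>lborel) = ennreal (t powr (- real DIM('a))) * (\<integral>\<^sup>+z. g z \<partial>lborel)"
proof -
  have "(\<integral>\<^sup>+z. g z \<partial>lborel) = ennreal (t ^ DIM('a)) * (\<integral>\<^sup>+y. g (c + t *\<^sub>R y) \<partial>lborel)"
    using t by (subst lborel_affine[of t c]) (auto simp: nn_integral_density nn_integral_distr nn_integral_cmult)
  moreover have "ennreal (t powr (- real DIM('a))) * ennreal (t ^ DIM('a)) = 1"
    using t by (simp add: powr_minus powr_realpow flip: ennreal_mult)
  ultimately show ?thesis by (simp add: mult.assoc[symmetric])
qed

text \<open>The mean oscillation of a \<open>C\<^sup>1\<close> function around a point \<open>x\<close> of a convex set \<open>K\<close> is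
  controlled by the integrals of the gradient over the shrunken copies \<open>x + t(K - x)\<close>, which
  remain inside \<open>K\<close>.  This gives Morrey's estimate with a constant that depends on the diameter
  and the volume of \<open>K\<close> only.\<close>

lemma morrey_mean_oscillation:
  fixes f :: "real^'d::finite \<Rightarrow> real"
  assumes sm: "smooth f" and K: "compact K" "convex K" and q: "real CARD('d) < q" and M: "M \<ge> 0"
    and growth: "\<And>i A. A \<in> sets borel \<Longrightarrow> A \<subseteq> K \<Longrightarrow>
      (\<integral>\<^sup>+z. indicator A z * ennreal \<bar>partial_deriv i f z\<bar> \<partial>lborel) \<le> ennreal (M * measure lborel A powr (1 - 1/q))"
    and x: "x \<in> K"
  shows "(\<integral>\<^sup>+y. indicator K y * ennreal \<bar>f y - f x\<bar> \<partial>lborel) \<le>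
    ennreal (real CARD('d) / (1 - real CARD('d) / q) * diameter K * M * measure lborel K powr (1 - 1/q))"
proof -
  let ?d = "real CARD('d)" and ?m = "measure lborel K" and ?\<delta> = "diameter K"
  have d0: "?d > 0" by simp
  have q0: "q > 0" using q d0 by linarith
  have s: "0 < ?d / q" "?d / q < 1" using q q0 d0 by auto
  have [measurable]: "K \<in> sets borel" using K by (auto intro: borel_compact)
  have \<delta>0: "?\<delta> \<ge> 0" by (rule diameter_ge_0[OF compact_imp_bounded[OF K(1)]])
  have fm [measurable]: "f \<in> borel_measurable borel"
    by (rule borel_measurable_continuous_onI[OF smoothD(1)[OF sm]])
  have cp: "continuous_on UNIV (partial_deriv i f)" for i
    by (rule smoothD(1)[OF smoothD(3)[OF sm]])
  have [measurable]: "partial_deriv i f \<in> borel_measurable borel" for i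
    by (rule borel_measurable_continuous_onI[OF cp])
  define H where "H z = (\<Sum>i\<in>UNIV. \<bar>partial_deriv i f z\<bar>)" for z
  have H0: "H z \<ge> 0" for z unfolding H_def by (intro sum_nonneg) auto
  have [measurable]: "H \<in> borel_measurable borel" unfolding H_def by measurable
  have dist: "norm (y - x) \<le> ?\<delta>" if "y \<in> K" for y
    using diameter_bounded_bound[OF compact_imp_bounded[OF K(1)] that x] by (simp add: dist_norm)
  have pt: "ennreal \<bar>f y - f x\<bar> \<le> (\<integral>\<^sup>+t. indicator {0..1} t * (ennreal ?\<delta> * ennreal (H (x + t *\<^sub>R (y - x)))) \<partial>lborel)"
    if y: "y \<in> K" for y
  proof -
    let ?p = "\<lambda>t. f (x + t *\<^sub>R (y - x))"
    let ?p' = "\<lambda>t. \<Sum>i\<in>UNIV. ((y - x) $ i) * partial_deriv i f (x + t *\<^sub>R (y - x))"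
    have der: "(?p has_real_derivative ?p' t) (at t)" for t
    proof -
      have "((\<lambda>t. x + t *\<^sub>R (y - x)) has_derivative (\<lambda>t. t *\<^sub>R (y - x))) (at t)"
        by (auto intro!: derivative_eq_intros)
      from diff_chain_at[OF this has_derivative_partials[OF smoothD(2)[OF sm]]]
      have "(?p has_derivative (\<lambda>s. \<Sum>i\<in>UNIV. ((s *\<^sub>R (y - x)) $ i) *\<^sub>R partial_deriv i f (x + t *\<^sub>R (y - x)))) (at t)"
        by (simp add: o_def)
      also have "(\<lambda>s. \<Sum>i\<in>UNIV. ((s *\<^sub>R (y - x)) $ i) *\<^sub>R partial_deriv i f (x + t *\<^sub>R (y - x))) = (*) (?p' t)"
        by (auto simp: fun_eq_iff sum_distrib_left sum_distrib_right ac_simps intro!: sum.cong)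
      finally show ?thesis by (simp add: has_field_derivative_def)
    qed
    have cont: "isCont ?p' t" for t
    proof -
      have "continuous_on UNIV ?p'"
        by (intro continuous_intros continuous_on_compose2[OF cp]) auto
      then show ?thesis by (simp add: continuous_on_eq_continuous_at)
    qed
    have hb: "has_bochner_integral lborel (\<lambda>t. ?p' t * indicator {0..1} t) (?p 1 - ?p 0)"
      by (rule has_bochner_integral_FTC_Icc_real) (use der cont in auto)
    then have i: "integrable lborel (\<lambda>t. ?p' t * indicator {0..1} t)"
      and e: "(LBINT t. ?p' t * indicator {0..1} t) = f y - f x"
      by (auto simp: has_bochner_integral_iff)
    have "ennreal \<bar>f y - f x\<bar> \<le> (\<integral>\<^sup>+t. ennreal (norm (?p' t * indicator {0..1} t)) \<partial>lborel)"
      using integral_norm_bound_ennreal[OF i] unfolding e by simp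
    also have "\<dots> \<le> (\<integral>\<^sup>+t. indicator {0..1} t * (ennreal ?\<delta> * ennreal (H (x + t *\<^sub>R (y - x)))) \<partial>lborel)"
    proof (rule nn_integral_mono)
      fix t :: real
      have "\<bar>?p' t\<bar> \<le> (\<Sum>i\<in>UNIV. norm (y - x) * \<bar>partial_deriv i f (x + t *\<^sub>R (y - x))\<bar>)"
        using component_le_norm_cart[of "y - x"]
        by (intro order_trans[OF sum_abs] sum_mono) (auto simp: abs_mult intro!: mult_right_mono)
      also have "\<dots> = norm (y - x) * H (x + t *\<^sub>R (y - x))" by (simp add: H_def sum_distrib_left)
      also have "\<dots> \<le> ?\<delta> * H (x + t *\<^sub>R (y - x))" by (intro mult_right_mono dist y H0)
      finally show "ennreal (norm (?p' t * indicator {0..1} t)) \<le>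
          indicator {0..1} t * (ennreal ?\<delta> * ennreal (H (x + t *\<^sub>R (y - x))))"
        using \<delta>0 H0 by (auto simp: indicator_def ennreal_leI simp flip: ennreal_mult)
    qed
    finally show ?thesis .
  qed
  \<comment> \<open>The shrunken copy \<open>A = x + t(K - x)\<close> has volume \<open>t ^ d\<close> times that of \<open>K\<close>, and the substitution
    contributes \<open>t powr (-d)\<close>; what remains is \<open>t powr (-d/q)\<close>, which is integrable since \<open>q > d\<close>.\<close>
  have scaled: "(\<integral>\<^sup>+y. indicator K y * ennreal (H (x + t *\<^sub>R (y - x))) \<partial>lborel) \<le>
      ennreal (?d * M * ?m powr (1 - 1/q)) * ennreal (t powr (- (?d / q)))" if t: "0 < t" "t \<le> 1" for t
  proof -
    define c where "c = x - t *\<^sub>R x"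
    have aff: "x + t *\<^sub>R (y - x) = c + t *\<^sub>R y" for y by (simp add: c_def algebra_simps)
    define A where "A = (\<lambda>z. (z - c) /\<^sub>R t) -` K"
    have A [measurable]: "A \<in> sets borel"
    proof -
      have "(\<lambda>z. (z - c) /\<^sub>R t) -` K \<inter> space borel \<in> sets borel"
        by (rule measurable_sets[of _ borel borel]) auto
      then show ?thesis by (simp add: A_def)
    qed
    have AK: "A \<subseteq> K"
    proof
      fix z assume "z \<in> A"
      then have y: "(z - c) /\<^sub>R t \<in> K" by (simp add: A_def)
      have "(1 - t) *\<^sub>R x + t *\<^sub>R ((z - c) /\<^sub>R t) \<in> K"
        using t by (intro convexD[OF K(2) x y]) auto
      then show "z \<in> K" using t by (simp add: c_def algebra_simps)
    qed
    have ind: "indicator K y = indicator A (c + t *\<^sub>R y)" for y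
      using t by (auto simp: A_def indicator_def)
    have tr: "(\<integral>\<^sup>+y. indicator K y * h (c + t *\<^sub>R y) \<partial>lborel) =
       ennreal (t powr (- ?d)) * (\<integral>\<^sup>+z. indicator A z * h z \<partial>lborel)"
      if [measurable]: "h \<in> borel_measurable borel" for h :: "real^'d \<Rightarrow> ennreal"
      unfolding ind using nn_integral_affine_image[of "\<lambda>z. indicator A z * h z" t c] t by simp
    have finK: "emeasure lborel K < \<infinity>" using emeasure_bounded_finite[OF compact_imp_bounded[OF K(1)]] by simp
    have finA: "emeasure lborel A < \<infinity>" using emeasure_mono[OF AK, of lborel] finK by (auto intro: le_less_trans)
    have "emeasure lborel K = ennreal (t powr (- ?d)) * emeasure lborel A"
      using tr[of "\<lambda>_. 1"] by simp
    then have "?m = t powr (- ?d) * measure lborel A"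
      by (simp add: measure_def enn2real_mult)
    then have mA: "measure lborel A = t powr ?d * ?m"
      using t by (simp add: powr_minus field_simps)
    have "(\<integral>\<^sup>+y. indicator K y * ennreal (H (x + t *\<^sub>R (y - x))) \<partial>lborel) =
        ennreal (t powr (- ?d)) * (\<integral>\<^sup>+z. indicator A z * ennreal (H z) \<partial>lborel)"
      unfolding aff by (rule tr) measurable
    also have "(\<integral>\<^sup>+z. indicator A z * ennreal (H z) \<partial>lborel) =
        (\<integral>\<^sup>+z. (\<Sum>i\<in>UNIV. indicator A z * ennreal \<bar>partial_deriv i f z\<bar>) \<partial>lborel)"
      by (intro nn_integral_cong) (simp add: H_def sum_distrib_left flip: sum_ennreal)
    also have "\<dots> = (\<Sum>i\<in>UNIV. (\<integral>\<^sup>+z. indicator A z * ennreal \<bar>partial_deriv i f z\<bar> \<partial>lborel))"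
      by (rule nn_integral_sum) measurable
    also have "\<dots> \<le> (\<Sum>i\<in>(UNIV::'d set). ennreal (M * measure lborel A powr (1 - 1/q)))"
      by (intro sum_mono growth A AK)
    also have "\<dots> = ennreal (?d * (M * measure lborel A powr (1 - 1/q)))"
      using M by (simp add: ennreal_mult' ennreal_of_nat_eq_real_of_nat)
    finally have "(\<integral>\<^sup>+y. indicator K y * ennreal (H (x + t *\<^sub>R (y - x))) \<partial>lborel) \<le>
        ennreal (t powr (- ?d)) * ennreal (?d * (M * measure lborel A powr (1 - 1/q)))"
      by (simp add: mult_left_mono)
    also have "\<dots> = ennreal (t powr (- ?d) * (?d * (M * measure lborel A powr (1 - 1/q))))"
      by (simp add: ennreal_mult')
    also have "t powr (- ?d) * (?d * (M * measure lborel A powr (1 - 1/q))) =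
        (?d * M * ?m powr (1 - 1/q)) * (t powr (- ?d) * t powr (?d * (1 - 1/q)))"
      unfolding mA using t by (simp add: powr_mult powr_powr)
    also have "t powr (- ?d) * t powr (?d * (1 - 1/q)) = t powr (- (?d / q))"
      by (simp add: powr_add[symmetric] algebra_simps)
    also have "ennreal (?d * M * ?m powr (1 - 1/q) * t powr (- (?d / q))) =
        ennreal (?d * M * ?m powr (1 - 1/q)) * ennreal (t powr (- (?d / q)))"
      using M by (simp add: ennreal_mult')
    finally show ?thesis .
  qed
  have "(\<integral>\<^sup>+y. indicator K y * ennreal \<bar>f y - f x\<bar> \<partial>lborel) \<le>
     (\<integral>\<^sup>+y. (\<integral>\<^sup>+t. indicator K y * (indicator {0..1} t * (ennreal ?\<delta> * ennreal (H (x + t *\<^sub>R (y - x))))) \<partial>lborel) \<partial>lborel)"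
    by (intro nn_integral_mono, subst nn_integral_cmult) (use pt in \<open>auto simp: indicator_def\<close>)
  also have "\<dots> = (\<integral>\<^sup>+t. (\<integral>\<^sup>+y. indicator K y * (indicator {0..1} t * (ennreal ?\<delta> * ennreal (H (x + t *\<^sub>R (y - x))))) \<partial>lborel) \<partial>lborel)"
    by (rule lborel_pair.Fubini') measurable
  also have "\<dots> = (\<integral>\<^sup>+t. indicator {0..1} t * (ennreal ?\<delta> * (\<integral>\<^sup>+y. indicator K y * ennreal (H (x + t *\<^sub>R (y - x))) \<partial>lborel)) \<partial>lborel)"
    by (intro nn_integral_cong) (simp add: nn_integral_cmult[symmetric] ac_simps)
  also have "\<dots> \<le> (\<integral>\<^sup>+t. ennreal (?\<delta> * (?d * M * ?m powr (1 - 1/q))) * (ennreal (t powr (- (?d / q))) * indicator {0..1} t) \<partial>lborel)"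
  proof (rule nn_integral_mono_AE)
    show "AE t in lborel. indicator {0..1} t * (ennreal ?\<delta> * (\<integral>\<^sup>+y. indicator K y * ennreal (H (x + t *\<^sub>R (y - x))) \<partial>lborel)) \<le>
        ennreal (?\<delta> * (?d * M * ?m powr (1 - 1/q))) * (ennreal (t powr (- (?d / q))) * indicator {0..1} t)"
      using AE_lborel_singleton[of "0::real"]
    proof eventually_elim
      case (elim t)
      show ?case
      proof (cases "t \<in> {0..1}")
        case True
        then have "ennreal ?\<delta> * (\<integral>\<^sup>+y. indicator K y * ennreal (H (x + t *\<^sub>R (y - x))) \<partial>lborel) \<le>
           ennreal ?\<delta> * (ennreal (?d * M * ?m powr (1 - 1/q)) * ennreal (t powr (- (?d / q))))"
          using elim by (intro mult_left_mono scaled) auto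
        then show ?thesis using True \<delta>0 M by (simp add: ennreal_mult' mult.assoc)
      qed simp
    qed
  qed
  also have "\<dots> = ennreal (?\<delta> * (?d * M * ?m powr (1 - 1/q))) * ennreal (1 / (1 - ?d / q))"
    by (subst nn_integral_cmult) (auto simp: nn_integral_powr_unit_interval[OF s])
  also have "\<dots> = ennreal (?d / (1 - ?d / q) * ?\<delta> * M * ?m powr (1 - 1/q))"
    using s \<delta>0 M by (subst ennreal_mult[symmetric]) (auto intro!: arg_cong[where f=ennreal])
  finally show ?thesis .
qed

definition morrey :: "real \<Rightarrow> real \<Rightarrow> (real^'d::finite) set \<Rightarrow> real"
  where "morrey q M K =
     2 * real CARD('d) / (1 - real CARD('d) / q) * diameter K * M * measure lborel K powr (- 1/q)"

text \<open>Both points are compared with the mean over \<open>K\<close>.\<close>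

lemma morrey_smooth:
  fixes f :: "real^'d::finite \<Rightarrow> real"
  assumes sm: "smooth f" and K: "compact K" "convex K" "measure lborel K > 0"
    and q: "real CARD('d) < q" and M: "M \<ge> 0"
    and growth: "\<And>i A. A \<in> sets borel \<Longrightarrow> A \<subseteq> K \<Longrightarrow>
      (\<integral>\<^sup>+z. indicator A z * ennreal \<bar>partial_deriv i f z\<bar> \<partial>lborel) \<le> ennreal (M * measure lborel A powr (1 - 1/q))"
    and x: "x \<in> K" "x' \<in> K"
  shows "\<bar>f x - f x'\<bar> \<le> morrey q M K"
proof -
  let ?m = "measure lborel K"
  let ?J = "real CARD('d) / (1 - real CARD('d) / q) * diameter K * M * ?m powr (1 - 1/q)"
  have [measurable]: "K \<in> sets borel" using K by (auto intro: borel_compact)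
  have q0: "q > 0" using q by (meson less_trans of_nat_0_less_iff zero_less_card_finite)
  have J0: "?J \<ge> 0"
    using q q0 M diameter_ge_0[OF compact_imp_bounded[OF K(1)]] by (auto intro!: mult_nonneg_nonneg divide_nonneg_nonneg)
  have fm [measurable]: "f \<in> borel_measurable borel"
    by (rule borel_measurable_continuous_onI[OF smoothD(1)[OF sm]])
  have finK: "emeasure lborel K \<noteq> \<infinity>" using emeasure_bounded_finite[OF compact_imp_bounded[OF K(1)]] by auto
  have "ennreal (?m * \<bar>f x - f x'\<bar>) = (\<integral>\<^sup>+y. indicator K y * ennreal \<bar>f x - f x'\<bar> \<partial>lborel)"
    using finK by (simp add: nn_integral_multc emeasure_eq_ennreal_measure ennreal_mult)
  also have "\<dots> \<le> (\<integral>\<^sup>+y. indicator K y * ennreal \<bar>f y - f x\<bar> + indicator K y * ennreal \<bar>f y - f x'\<bar> \<partial>lborel)"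
    by (intro nn_integral_mono) (auto simp: indicator_def simp flip: ennreal_plus intro!: ennreal_leI)
  also have "\<dots> = (\<integral>\<^sup>+y. indicator K y * ennreal \<bar>f y - f x\<bar> \<partial>lborel) + (\<integral>\<^sup>+y. indicator K y * ennreal \<bar>f y - f x'\<bar> \<partial>lborel)"
    by (rule nn_integral_add) measurable
  also have "\<dots> \<le> ennreal ?J + ennreal ?J"
    using x by (intro add_mono morrey_mean_oscillation[OF sm K(1,2) q M growth]) auto
  also have "\<dots> = ennreal (2 * ?J)" using J0 by (simp only: mult_2 ennreal_plus)
  finally have "?m * \<bar>f x - f x'\<bar> \<le> 2 * ?J" using J0 by (subst (asm) ennreal_le_iff) auto
  then have "\<bar>f x - f x'\<bar> * ?m \<le> 2 * ?J" by (subst mult.commute)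
  then have "\<bar>f x - f x'\<bar> \<le> 2 * ?J / ?m" by (rule pos_le_divide_eq[THEN iffD2, OF K(3)])
  also have "2 * ?J / ?m = morrey q M K"
  proof -
    have pw: "?m powr (1 - 1/q) = ?m * ?m powr (- 1/q)"
    proof -
      have "?m * ?m powr (- 1/q) = ?m powr 1 * ?m powr (- 1/q)" using K(3) by simp
      also have "\<dots> = ?m powr (1 - 1/q)" by (simp only: powr_add[symmetric]) simp
      finally show ?thesis by simp
    qed
    have "2 * (d / c * \<delta> * M * (m * P)) / m = 2 * d / c * \<delta> * M * P" if "m \<noteq> 0" for d c \<delta> M m P :: real
      using that by simp
    then show ?thesis unfolding morrey_def pw using K(3) by (metis less_irrefl)
  qed
  finally show ?thesis .
qed

text \<open>Integrals over sets of volume \<open>a\<close> grow at most like \<open>a powr (1 - 1/q)\<close>.  Unlike the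
  \<open>L\<^sup>q\<close> norm, this bound is visibly stable under convolution with a mollifier, as it is invariant
  under translations.\<close>

definition volume_growth :: "real \<Rightarrow> real \<Rightarrow> (real^'d::finite \<Rightarrow> 'b::euclidean_space) \<Rightarrow> bool"
  where "volume_growth q M g \<longleftrightarrow> (\<forall>A\<in>sets borel. emeasure lborel A < \<infinity> \<longrightarrow>
     (\<integral>\<^sup>+z. indicator A z * ennreal (norm (g z)) \<partial>lborel) \<le> ennreal (M * measure lborel A powr (1 - 1/q)))"

lemma volume_growth_conv:
  fixes g :: "real^'d::finite \<Rightarrow> 'b::euclidean_space"
  assumes g: "integrable lborel g" and vg: "volume_growth q M g"
  shows "volume_growth q M (conv (moll n) g)"
  unfolding volume_growth_def
proof (intro ballI impI)
  fix A :: "(real^'d) set" assume A [measurable]: "A \<in> sets borel" and fin: "emeasure lborel A < \<infinity>"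
  have [measurable]: "g \<in> borel_measurable borel" using g by auto
  let ?b = "ennreal (M * measure lborel A powr (1 - 1/q))"
  have "(\<integral>\<^sup>+x. indicator A x * ennreal (norm (conv (moll n) g x)) \<partial>lborel) \<le>
    (\<integral>\<^sup>+z. ennreal (moll n z) * (\<integral>\<^sup>+x. indicator A x * ennreal (norm (g (x - z))) \<partial>lborel) \<partial>lborel)"
    by (rule nn_integral_conv_le[OF g A])
  also have "\<dots> \<le> (\<integral>\<^sup>+(z::real^'d). ennreal (moll n z) * ?b \<partial>lborel)"
  proof (intro nn_integral_mono mult_left_mono)
    fix z :: "real^'d"
    define B where "B = (\<lambda>x. x + z) -` A"
    have B [measurable]: "B \<in> sets borel"
    proof -
      have "(\<lambda>x. x + z) -` A \<inter> space borel \<in> sets borel"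
        by (rule measurable_sets[of _ borel borel]) auto
      then show ?thesis by (simp add: B_def)
    qed
    have tr: "(\<integral>\<^sup>+x. indicator A x * h (x - z) \<partial>lborel) = (\<integral>\<^sup>+x. indicator B x * h x \<partial>lborel)"
      if [measurable]: "h \<in> borel_measurable borel" for h :: "real^'d \<Rightarrow> ennreal"
    proof -
      have "indicator A x = (indicator B (x - z) :: ennreal)" for x by (auto simp: B_def indicator_def)
      then show ?thesis using nn_integral_shift[of "\<lambda>x. indicator B x * h x" z] by simp
    qed
    have "emeasure lborel A = emeasure lborel B" using tr[of "\<lambda>_. 1"] by simp
    then have "measure lborel A = measure lborel B" "emeasure lborel B < \<infinity>" using fin by (auto simp: measure_def)
    note eq = this
    have "(\<integral>\<^sup>+x. indicator A x * ennreal (norm (g (x - z))) \<partial>lborel) = (\<integral>\<^sup>+x. indicator B x * ennreal (norm (g x)) \<partial>lborel)"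
      by (rule tr) measurable
    also have "\<dots> \<le> ennreal (M * measure lborel B powr (1 - 1/q))"
      using vg B eq(2) unfolding volume_growth_def by blast
    finally show "(\<integral>\<^sup>+x. indicator A x * ennreal (norm (g (x - z))) \<partial>lborel) \<le> ?b" unfolding eq(1) .
  qed auto
  also have "\<dots> = ?b" by (subst nn_integral_multc) (auto simp: nn_integral_moll)
  finally show "(\<integral>\<^sup>+x. indicator A x * ennreal (norm (conv (moll n) g x)) \<partial>lborel) \<le> ?b" .
qed

text \<open>The bound with the constant \<open>1 + \<integral>\<bar>g\<bar>\<^sup>q\<close> comes from
  \<open>\<bar>g\<bar> \<le> s + s powr (1 - q) * \<bar>g\<bar>\<^sup>q\<close> with \<open>s = a powr (-1/q)\<close>.\<close>

lemma volume_growth_power_integrable: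
  fixes g :: "real^'d::finite \<Rightarrow> 'b::euclidean_space"
  assumes [measurable]: "g \<in> borel_measurable borel"
    and i: "integrable lborel (\<lambda>x. norm (g x) powr q)" and q: "q > 1"
  shows "volume_growth q (1 + (LBINT x. norm (g x) powr q)) g"
  unfolding volume_growth_def
proof (intro ballI impI)
  fix A :: "(real^'d) set" assume A [measurable]: "A \<in> sets borel" and fin: "emeasure lborel A < \<infinity>"
  let ?a = "measure lborel A" and ?I = "LBINT x. norm (g x) powr q"
  have I0: "?I \<ge> 0" by (intro Bochner_Integration.integral_nonneg) auto
  show "(\<integral>\<^sup>+z. indicator A z * ennreal (norm (g z)) \<partial>lborel) \<le> ennreal ((1 + ?I) * ?a powr (1 - 1/q))"
  proof (cases "?a = 0")
    case True
    then have "A \<in> null_sets lborel" using fin by (auto simp: measure_def enn2real_eq_0_iff)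
    then show ?thesis using nn_integral_null_set[of A lborel "\<lambda>z. ennreal (norm (g z))"]
      by (simp add: mult.commute)
  next
    case False
    then have a: "?a > 0" using measure_nonneg[of lborel A] by linarith
    \<comment> \<open>With this \<open>s\<close> both terms of the bound have the same order \<open>a powr (1 - 1/q)\<close>.\<close>
    define s where "s = ?a powr (- 1/q)"
    have s: "s > 0" using a by (simp add: s_def)
    have y: "norm (g z) \<le> s + s powr (1 - q) * norm (g z) powr q" for z
    proof (cases "norm (g z) \<le> s")
      case True then show ?thesis using s by (intro order_trans[OF True]) simp
    next
      case False
      then have p: "norm (g z) > 0" using s by linarith
      have "norm (g z) = norm (g z) powr (1 - q) * norm (g z) powr q"
        using p by (simp add: powr_add[symmetric])
      also have "norm (g z) powr (1 - q) \<le> s powr (1 - q)"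
        using False s q by (intro powr_mono2') auto
      finally show ?thesis using s by (simp add: mult_right_mono)
    qed
    have "(\<integral>\<^sup>+z. indicator A z * ennreal (norm (g z)) \<partial>lborel) \<le>
       (\<integral>\<^sup>+z. ennreal s * indicator A z + ennreal (s powr (1 - q)) * ennreal (norm (g z) powr q) \<partial>lborel)"
    proof (rule nn_integral_mono)
      fix z
      have "ennreal (norm (g z)) \<le> ennreal s + ennreal (s powr (1 - q)) * ennreal (norm (g z) powr q)"
        using ennreal_leI[OF y[of z]] s by (simp add: ennreal_mult' ennreal_plus)
      then show "indicator A z * ennreal (norm (g z)) \<le>
          ennreal s * indicator A z + ennreal (s powr (1 - q)) * ennreal (norm (g z) powr q)"
        by (auto simp: indicator_def)
    qed
    also have "\<dots> = ennreal s * emeasure lborel A + ennreal (s powr (1 - q)) * ennreal ?I"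
      using i by (simp add: nn_integral_add nn_integral_cmult nn_integral_eq_integral)
    also have "\<dots> = ennreal (s * ?a + s powr (1 - q) * ?I)"
      using fin s I0 by (simp add: emeasure_eq_ennreal_measure ennreal_mult)
    also have "s * ?a + s powr (1 - q) * ?I = (1 + ?I) * ?a powr (1 - 1/q)"
    proof -
      have "s * ?a = ?a powr (- 1/q) * ?a powr 1" using a by (simp add: s_def)
      also have "\<dots> = ?a powr (1 - 1/q)" by (simp only: powr_add[symmetric]) simp
      finally have 1: "s * ?a = ?a powr (1 - 1/q)" .
      have "- 1/q * (1 - q) = 1 - 1/q" using q by (simp add: field_simps)
      then have "s powr (1 - q) = ?a powr (1 - 1/q)"
        unfolding s_def powr_powr by simp
      then show ?thesis using 1 by (simp add: algebra_simps)
    qed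
    finally show ?thesis .
  qed
qed

lemma volume_growth_mono:
  assumes "volume_growth q M g" "M \<le> M'"
  shows "volume_growth q M' g"
  unfolding volume_growth_def
proof (intro ballI impI)
  fix A :: "(real^'a) set" assume "A \<in> sets borel" "emeasure lborel A < \<infinity>"
  then have "(\<integral>\<^sup>+z. indicator A z * ennreal (norm (g z)) \<partial>lborel) \<le> ennreal (M * measure lborel A powr (1 - 1/q))"
    using assms(1) by (auto simp: volume_growth_def)
  also have "\<dots> \<le> ennreal (M' * measure lborel A powr (1 - 1/q))"
    using assms(2) by (intro ennreal_leI mult_right_mono) auto
  finally show "(\<integral>\<^sup>+z. indicator A z * ennreal (norm (g z)) \<partial>lborel) \<le> ennreal (M' * measure lborel A powr (1 - 1/q))" .
qed

lemma volume_growth_family: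
  fixes g :: "'i::finite \<Rightarrow> real^'d::finite \<Rightarrow> 'b::euclidean_space"
  assumes g: "\<And>k. g k \<in> borel_measurable borel" "\<And>k. integrable lborel (\<lambda>x. norm (g k x) powr q)" and q: "q > 1"
  obtains M where "M \<ge> 0" "\<And>k. volume_growth q M (g k)"
proof -
  define M where "M = 1 + (\<Sum>k\<in>UNIV. LBINT x. norm (g k x) powr q)"
  have I0: "(LBINT x. norm (g k x) powr q) \<ge> 0" for k by (intro Bochner_Integration.integral_nonneg) auto
  have "volume_growth q M (g k)" for k
  proof (rule volume_growth_mono[OF volume_growth_power_integrable[OF g q]])
    show "1 + (LBINT x. norm (g k x) powr q) \<le> M"
      unfolding M_def using I0 by (intro add_left_mono member_le_sum) auto
  qed
  moreover have "M \<ge> 0" using I0 by (auto simp: M_def intro!: add_nonneg_nonneg sum_nonneg)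
  ultimately show ?thesis using that by blast
qed

text \<open>A single null set serves all \<open>K\<close>: the set on which the mollified functions do not converge to \<open>f\<close>.\<close>

lemma morrey_wd:
  fixes f :: "real^'d::finite \<Rightarrow> real"
  assumes U: "open U" and fg: "\<And>i. wd U i f (g i)" and q: "real CARD('d) < q" and M: "M \<ge> 0"
    and vg: "\<And>i. volume_growth q M (g i)"
  obtains N where "N \<in> null_sets lborel"
    "\<And>K x y. compact K \<Longrightarrow> convex K \<Longrightarrow> K \<subseteq> U \<Longrightarrow> measure lborel K > 0 \<Longrightarrow> x \<in> K - N \<Longrightarrow> y \<in> K - N \<Longrightarrow>
      \<bar>f x - f y\<bar> \<le> morrey q M K"
proof -
  have f: "integrable lborel f" and gi: "integrable lborel (g i)" for i using wdD(1,2)[OF fg] by auto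
  obtain r where r: "strict_mono r" "AE x in lborel. (\<lambda>n. conv (moll (r n)) f x) \<longlonglongrightarrow> f x"
    using conv_AE_subseq[OF f] by blast
  obtain N where N: "N \<in> null_sets lborel" "\<And>x. x \<notin> N \<Longrightarrow> (\<lambda>n. conv (moll (r n)) f x) \<longlonglongrightarrow> f x"
    using r(2) by (elim AE_E3) auto
  show ?thesis
  proof (rule that[OF N(1)])
    fix K x y assume K: "compact K" "convex K" "K \<subseteq> U" "measure lborel K > 0" and x: "x \<in> K - N" and y: "y \<in> K - N"
    obtain n0 where n0: "\<And>n x. n \<ge> n0 \<Longrightarrow> x \<in> K \<Longrightarrow> cball x (inverse (real (Suc n))) \<subseteq> U"
      using compact_mollifier_margin[OF K(1) U K(3)] by blast
    have est: "\<bar>conv (moll n) f x - conv (moll n) f y\<bar> \<le> morrey q M K" if n: "n \<ge> n0" for n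
    proof (rule morrey_smooth[OF smooth_conv[OF moll_test f] K(1,2,4) q M])
      fix i A assume A: "A \<in> sets borel" "A \<subseteq> K"
      have "emeasure lborel A < \<infinity>"
        using emeasure_bounded_finite[OF bounded_subset[OF compact_imp_bounded[OF K(1)] A(2)]] by simp
      moreover have "(\<integral>\<^sup>+z. indicator A z * ennreal \<bar>partial_deriv i (conv (moll n) f) z\<bar> \<partial>lborel) =
          (\<integral>\<^sup>+z. indicator A z * ennreal (norm (conv (moll n) (g i) z)) \<partial>lborel)"
        using A(2) wd_conv[OF fg n0[OF n]] by (intro nn_integral_cong) (auto simp: indicator_def)
      ultimately show "(\<integral>\<^sup>+z. indicator A z * ennreal \<bar>partial_deriv i (conv (moll n) f) z\<bar> \<partial>lborel) \<le>
          ennreal (M * measure lborel A powr (1 - 1/q))"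
        using volume_growth_conv[OF gi vg] A(1) by (simp add: volume_growth_def)
    qed (use x y in auto)
    have "(\<lambda>n. \<bar>conv (moll (r n)) f x - conv (moll (r n)) f y\<bar>) \<longlonglongrightarrow> \<bar>f x - f y\<bar>"
      using x y by (intro tendsto_intros N(2)) auto
    moreover have "\<forall>\<^sub>F n in sequentially. \<bar>conv (moll (r n)) f x - conv (moll (r n)) f y\<bar> \<le> morrey q M K"
      unfolding eventually_sequentially
      using est seq_suble[OF r(1)] by (intro exI[of _ n0]) (auto intro: order_trans)
    ultimately show "\<bar>f x - f y\<bar> \<le> morrey q M K"
      by (rule tendsto_upperbound) simp
  qed
qed

subsection \<open>Continuous representatives\<close>

lemma AE_local:
  fixes U :: "'a::euclidean_space set"
  assumes "\<And>x. x \<in> U \<Longrightarrow> \<exists>r>0. AE y in M. y \<in> ball x r \<longrightarrow> P y"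
  shows "AE y in M. y \<in> U \<longrightarrow> P y"
proof -
  obtain r where r: "\<And>x. x \<in> U \<Longrightarrow> r x > 0 \<and> (AE y in M. y \<in> ball x (r x) \<longrightarrow> P y)"
    using assms by metis
  obtain F where F: "F \<subseteq> (\<lambda>x. ball x (r x)) ` U" "countable F" "\<Union>F = \<Union>((\<lambda>x. ball x (r x)) ` U)"
    using Lindelof[of "(\<lambda>x. ball x (r x)) ` U"] by blast
  have "AE y in M. \<forall>B\<in>F. y \<in> B \<longrightarrow> P y"
    using F(1) r by (subst AE_ball_countable[OF F(2)]) auto
  then show ?thesis
  proof eventually_elim
    case (elim y)
    show ?case
    proof
      assume "y \<in> U"
      then have "y \<in> \<Union>F" unfolding F(3) using r[of y] by (auto intro!: bexI[of _ y])
      then show "P y" using elim by auto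
    qed
  qed
qed

lemma continuous_AE_eq_imp_eq:
  fixes h k :: "'a::euclidean_space \<Rightarrow> 'b::t2_space"
  assumes W: "open W" and h: "continuous_on W h" and k: "continuous_on W k"
    and ae: "AE x in lborel. x \<in> W \<longrightarrow> h x = k x" and x: "x \<in> W"
  shows "h x = k x"
proof (rule ccontr)
  assume "h x \<noteq> k x"
  then obtain A B where AB: "open A" "open B" "h x \<in> A" "k x \<in> B" "A \<inter> B = {}"
    using hausdorff[OF \<open>h x \<noteq> k x\<close>] by auto
  let ?V = "(W \<inter> h -` A) \<inter> (W \<inter> k -` B)"
  have "open (W \<inter> h -` A)" "open (W \<inter> k -` B)"
    using AB(1,2) W h k by (simp_all add: continuous_on_open_vimage Int_commute)
  then have "open ?V" by (rule open_Int)
  moreover have "?V \<noteq> {}" using AB x by auto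
  moreover have "AE y in lborel. y \<in> ?V \<longrightarrow> h y = k y" using ae by (auto elim: eventually_mono)
  ultimately obtain y where "y \<in> ?V" "h y = k y" by (rule AE_point_in_open)
  then show False using AB(5) by auto
qed

text \<open>Local continuous representatives agree on overlaps, since they agree almost everywhere there.\<close>

lemma continuous_representative_glue:
  fixes f :: "'a::euclidean_space \<Rightarrow> 'b::t2_space"
  assumes loc: "\<And>x. x \<in> U \<Longrightarrow> \<exists>r>0. \<exists>h. continuous_on (ball x r) h \<and> (AE y in lborel. y \<in> ball x r \<longrightarrow> f y = h y)"
  obtains h where "continuous_on U h" "AE y in lborel. y \<in> U \<longrightarrow> f y = h y"
proof -
  obtain r k where r: "\<And>x. x \<in> U \<Longrightarrow> r x > 0" and k: "\<And>x. x \<in> U \<Longrightarrow> continuous_on (ball x (r x)) (k x)"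
    and ae: "\<And>x. x \<in> U \<Longrightarrow> AE y in lborel. y \<in> ball x (r x) \<longrightarrow> f y = k x y"
    using loc by metis
  define h where "h x = k x x" for x
  have eq: "h y = k x y" if "x \<in> U" "y \<in> U" "y \<in> ball x (r x)" for x y
  proof -
    let ?W = "ball x (r x) \<inter> ball y (r y)"
    have "k y y = k x y"
    proof (rule continuous_AE_eq_imp_eq[where W="?W" and h="k y" and k="k x"])
      show "AE z in lborel. z \<in> ?W \<longrightarrow> k y z = k x z"
        using ae[OF that(1)] ae[OF that(2)] by eventually_elim auto
    qed (use that r k in \<open>auto intro: continuous_on_subset\<close>)
    then show ?thesis by (simp add: h_def)
  qed
  show ?thesis
  proof (rule that)
    show "continuous_on U h"
      unfolding continuous_on_eq_continuous_within
    proof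
      fix x assume x: "x \<in> U"
      have "continuous (at x within U) (k x)"
        using k[OF x] r[OF x] by (simp add: continuous_on_eq_continuous_at continuous_at_imp_continuous_at_within)
      then show "continuous (at x within U) h"
        by (rule continuous_transform_within[where \<delta>="r x"]) (use x r eq[OF x] in \<open>auto simp: dist_commute\<close>)
    qed
    have "AE y in lborel. y \<in> U \<longrightarrow> y \<in> U \<longrightarrow> f y = h y"
    proof (rule AE_local[where P="\<lambda>y. y \<in> U \<longrightarrow> f y = h y"])
      fix x assume x: "x \<in> U"
      have "AE y in lborel. y \<in> ball x (r x) \<longrightarrow> y \<in> U \<longrightarrow> f y = h y"
        using ae[OF x] by eventually_elim (auto simp: eq[OF x])
      then show "\<exists>r>0. AE y in lborel. y \<in> ball x r \<longrightarrow> y \<in> U \<longrightarrow> f y = h y" using r[OF x] by blast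
    qed
    then show "AE y in lborel. y \<in> U \<longrightarrow> f y = h y" by simp
  qed
qed

lemma morrey_cball:
  fixes x :: "real^'d::finite"
  assumes q: "real CARD('d) < q" and M: "M \<ge> 0"
  obtains C where "C \<ge> 0"
    "\<And>(x::real^'d) \<delta>. \<delta> > 0 \<Longrightarrow> morrey q M (cball x \<delta>) = C * \<delta> powr (1 - real CARD('d) / q)"
proof -
  let ?d = "real CARD('d)"
  let ?C = "2 * ?d / (1 - ?d / q) * 2 * M * (unit_ball_vol ?d powr (- 1/q))"
  have q0: "q > 0" using q by (meson less_trans of_nat_0_less_iff zero_less_card_finite)
  have "morrey q M (cball x \<delta>) = ?C * \<delta> powr (1 - ?d / q)" if "\<delta> > 0" for x :: "real^'d" and \<delta>
  proof -
    have "measure lborel (cball x \<delta>) powr (- 1/q) = (unit_ball_vol ?d * \<delta> powr ?d) powr (- 1/q)"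
      using that by (simp add: content_cball powr_realpow)
    also have "\<dots> = unit_ball_vol ?d powr (- 1/q) * (\<delta> powr ?d) powr (- 1/q)"
      by (rule powr_mult)
    finally have m: "measure lborel (cball x \<delta>) powr (- 1/q) = unit_ball_vol ?d powr (- 1/q) * (\<delta> powr ?d) powr (- 1/q)" .
    have "(\<delta> powr ?d) powr (- 1/q) * \<delta> = \<delta> powr (1 - ?d / q)"
    proof -
      have "(\<delta> powr ?d) powr (- 1/q) * \<delta> = \<delta> powr (?d * (- 1/q)) * \<delta> powr 1"
        using that by (simp add: powr_powr)
      also have "\<dots> = \<delta> powr (1 - ?d / q)" by (simp only: powr_add[symmetric]) simp
      finally show ?thesis .
    qed
    note p = this
    have dm: "diameter (cball x \<delta>) = 2 * \<delta>" using that by (simp add: diameter_cball)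
    have "morrey q M (cball x \<delta>) = ?C * ((\<delta> powr ?d) powr (- 1/q) * \<delta>)"
      unfolding morrey_def m dm by (simp only: ac_simps)
    then show ?thesis by (simp only: p)
  qed
  moreover have "?C \<ge> 0" using q q0 M by (auto intro!: mult_nonneg_nonneg divide_nonneg_nonneg)
  ultimately show ?thesis using that by blast
qed

text \<open>On the ball around \<open>y\<close> of radius \<open>dist y z\<close> Morrey's estimate is a Hoelder estimate for \<open>f y - f z\<close>
  outside a null set; the complement of the null set is dense, so \<open>f\<close> extends continuously.\<close>

lemma wd_continuous_representative:
  fixes f :: "real^'d::finite \<Rightarrow> real"
  assumes U: "open U" and fg: "\<And>i. wd U i f (g i)" and q: "real CARD('d) < q" and M: "M \<ge> 0"
    and vg: "\<And>i. volume_growth q M (g i)"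
  obtains h where "continuous_on U h" "AE y in lborel. y \<in> U \<longrightarrow> f y = h y"
proof -
  define s where "s = 1 - real CARD('d) / q"
  have q0: "q > 0" using q by (meson less_trans of_nat_0_less_iff zero_less_card_finite)
  have s: "s > 0" using q q0 by (simp add: s_def)
  obtain N where N: "N \<in> null_sets lborel"
    and osc: "\<And>K x y. compact K \<Longrightarrow> convex K \<Longrightarrow> K \<subseteq> U \<Longrightarrow> measure lborel K > 0 \<Longrightarrow> x \<in> K - N \<Longrightarrow> y \<in> K - N \<Longrightarrow>
      \<bar>f x - f y\<bar> \<le> morrey q M K"
    using morrey_wd[OF U fg q M vg] by blast
  obtain C where C: "C \<ge> 0" "\<And>(x::real^'d) \<delta>. \<delta> > 0 \<Longrightarrow> morrey q M (cball x \<delta>) = C * \<delta> powr s"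
    using morrey_cball[OF q M] unfolding s_def by blast
  have aeN: "AE y in lborel. y \<notin> N" by (rule AE_not_in[OF N])
  have "\<exists>r>0. \<exists>h. continuous_on (ball x r) h \<and> (AE y in lborel. y \<in> ball x r \<longrightarrow> f y = h y)" if "x \<in> U" for x
  proof -
    obtain R where R: "R > 0" "ball x R \<subseteq> U" using openE[OF U \<open>x \<in> U\<close>] by blast
    define r where "r = R / 3"
    define X where "X = ball x r - N"
    have r: "r > 0" using R by (simp add: r_def)
    \<comment> \<open>The radius \<open>r = R / 3\<close> leaves room for the balls around \<open>y\<close> that reach up to \<open>z\<close>.\<close>
    have hoelder: "\<bar>f y - f z\<bar> \<le> C * dist y z powr s" if "y \<in> X" "z \<in> X" for y z
    proof (cases "y = z")
      case False
      then have \<delta>: "dist y z > 0" by simp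
      have "dist y z < 2 * r"
        using dist_triangle2[of y z x] that by (auto simp: X_def dist_commute)
      then have "cball y (dist y z) \<subseteq> U"
      proof (intro order_trans[OF _ R(2)] subsetI)
        fix w assume "w \<in> cball y (dist y z)" "dist y z < 2 * r"
        then show "w \<in> ball x R" using that dist_triangle[of x w y] by (auto simp: X_def r_def)
      qed
      then have "\<bar>f y - f z\<bar> \<le> morrey q M (cball y (dist y z))"
        using that \<delta> by (intro osc) (auto simp: X_def content_cball_gt_0_iff)
      then show ?thesis using C(2)[OF \<delta>] by simp
    qed (use C s in simp)
    have "uniformly_continuous_on X f"
      unfolding uniformly_continuous_on_def
    proof (intro allI impI)
      fix e :: real assume e: "e > 0"
      define \<delta> where "\<delta> = (e / (C + 1)) powr (1 / s)"
      have eC: "e / (C + 1) > 0" using e C(1) by simp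
      have "\<bar>f y - f z\<bar> < e" if "y \<in> X" "z \<in> X" "dist y z < \<delta>" for y z
      proof -
        have "dist y z powr s \<le> \<delta> powr s" using that s by (intro powr_mono2) auto
        also have "\<dots> = e / (C + 1)" using s eC e C(1) by (simp add: \<delta>_def powr_powr)
        finally have "C * dist y z powr s \<le> C * (e / (C + 1))" using C(1) by (rule mult_left_mono)
        also have "\<dots> < e" using C(1) e by (simp add: field_simps)
        finally show ?thesis using hoelder[OF that(1,2)] by linarith
      qed
      moreover have "\<delta> > 0" using e C(1) by (auto simp: \<delta>_def)
      ultimately show "\<exists>d>0. \<forall>x\<in>X. \<forall>x'\<in>X. dist x' x < d \<longrightarrow> dist (f x') (f x) < e"
        by (intro exI[of _ \<delta>]) (auto simp: dist_real_def)
    qed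
    then obtain h where h: "uniformly_continuous_on (closure X) h" "\<And>y. y \<in> X \<Longrightarrow> f y = h y"
      using uniformly_continuous_on_extension_on_closure by metis
    have "ball x r \<subseteq> closure X"
    proof
      fix y assume y: "y \<in> ball x r"
      show "y \<in> closure X"
      proof (rule ccontr)
        assume "y \<notin> closure X"
        have "open (ball x r - closure X)" by (intro open_Diff) auto
        moreover have "ball x r - closure X \<noteq> {}" using y \<open>y \<notin> closure X\<close> by blast
        moreover have "AE z in lborel. z \<in> ball x r - closure X \<longrightarrow> z \<notin> N" using aeN by eventually_elim simp
        ultimately obtain z where "z \<in> ball x r - closure X" "z \<notin> N" by (rule AE_point_in_open)
        then show False using closure_subset[of X] by (auto simp: X_def)
      qed
    qed
    then have "continuous_on (ball x r) h"
      using uniformly_continuous_imp_continuous[OF h(1)] continuous_on_subset by blast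
    moreover have "AE y in lborel. y \<in> ball x r \<longrightarrow> f y = h y"
      using aeN by eventually_elim (use h(2) in \<open>auto simp: X_def\<close>)
    ultimately show ?thesis using r by blast
  qed
  then show ?thesis using continuous_representative_glue[of U f] that by blast
qed

section \<open>Sobolev functions through Borel representatives\<close>

text \<open>Convolution and Fubini's theorem need Borel functions on the whole space.  A function on an
  open set is therefore replaced by a Borel function that agrees with it almost everywhere on
  that set.\<close>

lemma AE_lebesgue_on_iff:
  assumes "open U"
  shows "(AE x in lebesgue_on U. P x) \<longleftrightarrow> (AE x in lborel. x \<in> U \<longrightarrow> P x)"
  using assms by (subst AE_restrict_space_iff) (auto simp: AE_completion_iff)

lemma lebesgue_measurable_AE_cong:
  fixes f g :: "'a::euclidean_space \<Rightarrow> 'b::topological_space"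
  assumes f: "f \<in> borel_measurable lebesgue" and fg: "AE x in lborel. f x = g x"
  shows "g \<in> borel_measurable lebesgue"
proof (rule measurableI)
  fix A :: "'b set" assume "A \<in> sets borel"
  then have A: "f -` A \<in> sets lebesgue" using measurable_sets[OF f, of A] by simp
  have "AE x in lebesgue. x \<in> f -` A \<longleftrightarrow> x \<in> g -` A"
    using fg unfolding AE_completion_iff by eventually_elim simp
  then show "g -` A \<inter> space lebesgue \<in> sets lebesgue"
    using completion.in_sets_AE[of "f -` A" "g -` A"] A by simp
qed simp

lemma lebesgue_on_measurable_AE_cong:
  fixes f g :: "'a::euclidean_space \<Rightarrow> 'b::euclidean_space"
  assumes U: "open U" and f: "f \<in> borel_measurable borel" and fg: "AE x in lborel. x \<in> U \<longrightarrow> f x = g x"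
  shows "g \<in> borel_measurable (lebesgue_on U)"
proof -
  have [measurable]: "f \<in> borel_measurable borel" "U \<in> sets borel" using f U by auto
  have "(\<lambda>x. if x \<in> U then f x else 0) \<in> borel_measurable borel" by measurable
  then have "(\<lambda>x. if x \<in> U then f x else 0) \<in> borel_measurable lebesgue"
    by (intro measurable_completion) simp
  moreover have "AE x in lborel. (if x \<in> U then f x else 0) = (if x \<in> U then g x else 0)"
    using fg by eventually_elim simp
  ultimately have "(\<lambda>x. if x \<in> U then g x else 0) \<in> borel_measurable lebesgue"
    by (rule lebesgue_measurable_AE_cong)
  then show ?thesis by (rule borel_measurable_if_D)
qed

lemma borel_representative:
  fixes f :: "'a::euclidean_space \<Rightarrow> 'b::euclidean_space"
  assumes U: "open U" and f: "f \<in> borel_measurable (lebesgue_on U)"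
  obtains g where "g \<in> borel_measurable borel" "AE x in lborel. x \<in> U \<longrightarrow> f x = g x"
    "\<And>x. x \<notin> U \<Longrightarrow> g x = 0"
proof -
  have U' [measurable]: "U \<in> sets borel" using U by simp
  define f0 where "f0 x = (if x \<in> U then f x else 0)" for x
  have f0: "f0 \<in> borel_measurable lebesgue"
    unfolding f0_def using f U by (intro borel_measurable_if_I) auto
  have "\<exists>h\<in>borel_measurable lborel. AE x in lborel. f0 x \<bullet> b = h x" for b
    by (rule completion_ex_borel_measurable_real) (use f0 in measurable)
  then obtain h where h [measurable]: "\<And>b. h b \<in> borel_measurable lborel"
    and h_eq: "\<And>b. AE x in lborel. f0 x \<bullet> b = h b x"
    by metis
  have [measurable]: "\<And>b. h b \<in> borel_measurable borel" using h by simp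
  define g where "g x = indicat_real U x *\<^sub>R (\<Sum>b\<in>Basis. h b x *\<^sub>R b)" for x
  show ?thesis
  proof (rule that)
    show "g \<in> borel_measurable borel" unfolding g_def by measurable
    have "AE x in lborel. \<forall>b\<in>Basis. f0 x \<bullet> b = h b x"
      using h_eq by (intro AE_ball_countable[THEN iffD2]) (auto intro: countable_finite)
    then show "AE x in lborel. x \<in> U \<longrightarrow> f x = g x"
    proof eventually_elim
      case (elim x)
      have "(\<Sum>b\<in>Basis. h b x *\<^sub>R b) = (\<Sum>b\<in>Basis. (f0 x \<bullet> b) *\<^sub>R b)"
        using elim by (intro sum.cong) auto
      then show ?case by (auto simp: g_def f0_def euclidean_representation)
    qed
    show "g x = 0" if "x \<notin> U" for x using that by (simp add: g_def)
  qed
qed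

lemma integral_lebesgue_on_eq:
  fixes f g :: "'a::euclidean_space \<Rightarrow> 'b::euclidean_space"
  assumes U: "open U" and g: "g \<in> borel_measurable borel" and fg: "AE x in lborel. x \<in> U \<longrightarrow> f x = g x"
    and g0: "\<And>x. x \<notin> U \<Longrightarrow> g x = 0"
  shows "(LINT x|lebesgue_on U. f x) = (LBINT x. g x)"
    "integrable (lebesgue_on U) f \<longleftrightarrow> integrable lborel g"
proof -
  have fm: "f \<in> borel_measurable (lebesgue_on U)"
    by (rule lebesgue_on_measurable_AE_cong[OF U g]) (use fg in \<open>auto elim: eventually_mono\<close>)
  have gm: "g \<in> borel_measurable (lebesgue_on U)"
    by (rule lebesgue_on_measurable_AE_cong[OF U g]) simp
  have ae: "AE x in lebesgue_on U. f x = g x" using fg by (simp add: AE_lebesgue_on_iff[OF U])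
  have Us: "U \<inter> space lebesgue \<in> sets lebesgue" using U by simp
  have ig: "(\<lambda>x. indicat_real U x *\<^sub>R g x) = g" using g0 by (auto simp: indicator_def fun_eq_iff)
  have "(LINT x|lebesgue_on U. f x) = (LINT x|lebesgue_on U. g x)"
    by (rule integral_cong_AE[OF fm gm ae])
  also have "\<dots> = (LINT x|lebesgue. g x)"
    using integral_restrict_space[OF Us, of g] by (simp add: ig)
  also have "\<dots> = (LBINT x. g x)" using g by (intro integral_completion) simp
  finally show "(LINT x|lebesgue_on U. f x) = (LBINT x. g x)" .
  have "integrable (lebesgue_on U) f \<longleftrightarrow> integrable (lebesgue_on U) g"
    by (rule integrable_cong_AE[OF fm gm ae])
  also have "\<dots> \<longleftrightarrow> integrable lebesgue g"
    using integrable_restrict_space[OF Us, of g] by (simp add: ig)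
  also have "\<dots> \<longleftrightarrow> integrable lborel g" using g by (intro integrable_completion) simp
  finally show "integrable (lebesgue_on U) f \<longleftrightarrow> integrable lborel g" .
qed

lemma locally_integrable_representative:
  fixes f g :: "real^'d::finite \<Rightarrow> 'b::euclidean_space"
  assumes U: "open U" and g: "integrable lborel g" and fg: "AE x in lborel. x \<in> U \<longrightarrow> f x = g x"
  shows "locally_integrable U f"
  unfolding locally_integrable_def
proof (intro allI impI)
  fix K assume K: "compact K \<and> K \<subseteq> U"
  then have [measurable]: "K \<in> sets borel" by (auto intro: borel_compact)
  have [measurable]: "g \<in> borel_measurable borel" using g by auto
  have i: "integrable lborel (\<lambda>x. indicat_real K x *\<^sub>R g x)"
    using g by (intro integrable_mult_indicator) auto
  have m: "(\<lambda>x. indicat_real K x *\<^sub>R g x) \<in> borel_measurable lebesgue"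
    by (rule measurable_completion) simp
  have ae: "AE x in lborel. indicat_real K x *\<^sub>R g x = indicat_real K x *\<^sub>R f x"
    using fg by eventually_elim (use K in \<open>auto simp: indicator_def\<close>)
  have "integrable lebesgue (\<lambda>x. indicat_real K x *\<^sub>R g x)" using i by (subst integrable_completion) auto
  then have "integrable lebesgue (\<lambda>x. indicat_real K x *\<^sub>R f x)"
    using integrable_cong_AE[OF m lebesgue_measurable_AE_cong[OF m ae] AE_completion[OF ae]] by blast
  then show "f absolutely_integrable_on K" by (simp add: set_integrable_def)
qed

lemma has_weak_partial_iff_wd:
  fixes f g F G :: "real^'d::finite \<Rightarrow> 'b::euclidean_space"
  assumes U: "open U" and f: "integrable lborel f" and g: "integrable lborel g"
    and Ff: "AE x in lborel. x \<in> U \<longrightarrow> F x = f x" and Gg: "AE x in lborel. x \<in> U \<longrightarrow> G x = g x"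
  shows "has_weak_partial U i F G \<longleftrightarrow> wd U i f g"
proof -
  have [measurable]: "f \<in> borel_measurable borel" "g \<in> borel_measurable borel" using f g by auto
  have "(LINT x|lebesgue_on U. partial_deriv i \<phi> x *\<^sub>R F x) = (LBINT x. partial_deriv i \<phi> x *\<^sub>R f x)"
    "(LINT x|lebesgue_on U. \<phi> x *\<^sub>R G x) = (LBINT x. \<phi> x *\<^sub>R g x)" if \<phi>: "\<phi> \<in> test_functions U" for \<phi>
  proof -
    note [measurable] = test_function_measurable[OF \<phi>] test_function_measurable[OF test_functions_partial[OF \<phi>]]
    show "(LINT x|lebesgue_on U. partial_deriv i \<phi> x *\<^sub>R F x) = (LBINT x. partial_deriv i \<phi> x *\<^sub>R f x)"
      by (rule integral_lebesgue_on_eq(1)[OF U])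
        (use Ff test_functions_eq_0(2)[OF \<phi>] in \<open>auto elim: eventually_mono\<close>)
    show "(LINT x|lebesgue_on U. \<phi> x *\<^sub>R G x) = (LBINT x. \<phi> x *\<^sub>R g x)"
      by (rule integral_lebesgue_on_eq(1)[OF U])
        (use Gg test_functions_eq_0(1)[OF \<phi>] in \<open>auto elim: eventually_mono\<close>)
  qed
  then show ?thesis
    using locally_integrable_representative[OF U f] locally_integrable_representative[OF U g] Ff Gg f g
    by (auto simp: has_weak_partial_def wd_def)
qed

text \<open>Weak derivatives are only locally integrable in general; on a smaller set where they are integrable
  they have Borel representatives on the whole space.\<close>

lemma has_weak_partial_subset:
  assumes U: "open U" "open V" "V \<subseteq> U" and h: "has_weak_partial U i f g"
    and fi: "f absolutely_integrable_on V" and gi: "g absolutely_integrable_on V"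
  obtains f' g' where "wd V i f' g'" "AE x in lborel. x \<in> V \<longrightarrow> f x = f' x" "AE x in lborel. x \<in> V \<longrightarrow> g x = g' x"
    "\<And>x. x \<notin> V \<Longrightarrow> f' x = 0" "\<And>x. x \<notin> V \<Longrightarrow> g' x = 0"
proof -
  have iV: "integrable (lebesgue_on V) f" "integrable (lebesgue_on V) g"
    using fi gi U(2) by (simp_all add: set_integrable_def integrable_restrict_space)
  obtain f' where f': "f' \<in> borel_measurable borel" "AE x in lborel. x \<in> V \<longrightarrow> f x = f' x" "\<And>x. x \<notin> V \<Longrightarrow> f' x = 0"
    using borel_representative[OF U(2) borel_measurable_integrable[OF iV(1)]] by blast
  obtain g' where g': "g' \<in> borel_measurable borel" "AE x in lborel. x \<in> V \<longrightarrow> g x = g' x" "\<And>x. x \<notin> V \<Longrightarrow> g' x = 0"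
    using borel_representative[OF U(2) borel_measurable_integrable[OF iV(2)]] by blast
  have i': "integrable lborel f'" "integrable lborel g'"
    using iV integral_lebesgue_on_eq(2)[OF U(2) f'] integral_lebesgue_on_eq(2)[OF U(2) g'] by auto
  have "wd V i f' g'"
    unfolding wd_def
  proof (intro conjI ballI i')
    fix \<phi> :: "real^'a \<Rightarrow> real" assume \<phi>: "\<phi> \<in> test_functions V"
    note \<phi>U = test_functions_mono[OF U(3) \<phi>]
    note [measurable] = f'(1) g'(1) test_function_measurable[OF \<phi>] test_function_measurable[OF test_functions_partial[OF \<phi>]]
    have "(LINT x|lebesgue_on U. partial_deriv i \<phi> x *\<^sub>R f x) = (LBINT x. partial_deriv i \<phi> x *\<^sub>R f' x)"
    proof (rule integral_lebesgue_on_eq(1)[OF U(1)])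
      show "AE x in lborel. x \<in> U \<longrightarrow> partial_deriv i \<phi> x *\<^sub>R f x = partial_deriv i \<phi> x *\<^sub>R f' x"
        using f'(2) by eventually_elim (use test_functions_eq_0(2)[OF \<phi>] in auto)
    qed (use U(3) f'(3) in auto)
    moreover have "(LINT x|lebesgue_on U. \<phi> x *\<^sub>R g x) = (LBINT x. \<phi> x *\<^sub>R g' x)"
    proof (rule integral_lebesgue_on_eq(1)[OF U(1)])
      show "AE x in lborel. x \<in> U \<longrightarrow> \<phi> x *\<^sub>R g x = \<phi> x *\<^sub>R g' x"
        using g'(2) by eventually_elim (use test_functions_eq_0(1)[OF \<phi>] in auto)
    qed (use U(3) g'(3) in auto)
    ultimately show "(LBINT x. partial_deriv i \<phi> x *\<^sub>R f' x) = - (LBINT x. \<phi> x *\<^sub>R g' x)"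
      using h \<phi>U unfolding has_weak_partial_def by metis
  qed
  then show ?thesis using that f' g' by blast
qed

lemma wd_unique:
  fixes f :: "real^'d::finite \<Rightarrow> 'b::euclidean_space"
  assumes U: "open U" and g: "wd U i f g" and g': "wd U i f' g'" and ff: "AE x in lborel. x \<in> U \<longrightarrow> f x = f' x"
  shows "AE x in lborel. x \<in> U \<longrightarrow> g x = g' x"
proof -
  have "AE x in lborel. x \<in> U \<longrightarrow> g x - g' x = 0"
  proof (rule fundamental_lemma[OF U])
    show "integrable lborel (\<lambda>x. g x - g' x)" using wdD[OF g] wdD[OF g'] by auto
    fix \<phi> :: "real^'d \<Rightarrow> real" assume \<phi>: "\<phi> \<in> test_functions U"
    have g2: "wd U i f g'"
      by (rule wd_cong[OF g' wdD(1)[OF g] wdD(2)[OF g']]) (use ff in \<open>auto elim: eventually_mono\<close>)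
    have "(LBINT x. \<phi> x *\<^sub>R (g x - g' x)) = (LBINT x. \<phi> x *\<^sub>R g x) - (LBINT x. \<phi> x *\<^sub>R g' x)"
      unfolding scaleR_diff_right by (intro Bochner_Integration.integral_diff test_function_scaleR_integrable[OF _ \<phi>] wdD(2)[OF g] wdD(2)[OF g'])
    then show "(LBINT x. \<phi> x *\<^sub>R (g x - g' x)) = 0"
      using wdD(5)[OF g \<phi>] wdD(5)[OF g2 \<phi>] by simp
  qed
  then show ?thesis by simp
qed

lemma has_weak_partial_unique:
  fixes f :: "real^'d::finite \<Rightarrow> 'b::euclidean_space"
  assumes U: "open U" and g: "has_weak_partial U i f g" and g': "has_weak_partial U i f g'"
  shows "AE x in lborel. x \<in> U \<longrightarrow> g x = g' x"
proof -
  have "AE x in lborel. x \<in> U \<longrightarrow> x \<in> U \<longrightarrow> g x = g' x"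
  proof (rule AE_local[where P="\<lambda>x. x \<in> U \<longrightarrow> g x = g' x"])
    fix x assume "x \<in> U"
    then obtain r where r: "r > 0" "cball x r \<subseteq> U" using U by (meson open_contains_cball)
    have V: "ball x r \<subseteq> U" using order_trans[OF ball_subset_cball r(2)] .
    have ai: "h absolutely_integrable_on ball x r" if "locally_integrable U h" for h :: "real^'d \<Rightarrow> 'b"
      by (rule set_integrable_subset[of _ "cball x r"]) (use that r in \<open>auto simp: locally_integrable_def\<close>)
    have li: "locally_integrable U f" "locally_integrable U g" "locally_integrable U g'"
      using g g' by (auto simp: has_weak_partial_def)
    obtain f1 g1 where 1: "wd (ball x r) i f1 g1" "AE y in lborel. y \<in> ball x r \<longrightarrow> f y = f1 y"
      "AE y in lborel. y \<in> ball x r \<longrightarrow> g y = g1 y"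
      by (rule has_weak_partial_subset[OF U open_ball V g ai[OF li(1)] ai[OF li(2)]]) (rule that)
    obtain f2 g2 where 2: "wd (ball x r) i f2 g2" "AE y in lborel. y \<in> ball x r \<longrightarrow> f y = f2 y"
      "AE y in lborel. y \<in> ball x r \<longrightarrow> g' y = g2 y"
      by (rule has_weak_partial_subset[OF U open_ball V g' ai[OF li(1)] ai[OF li(3)]]) (rule that)
    have "AE y in lborel. y \<in> ball x r \<longrightarrow> f1 y = f2 y" using 1(2) 2(2) by eventually_elim auto
    from wd_unique[OF open_ball 1(1) 2(1) this]
    have "AE y in lborel. y \<in> ball x r \<longrightarrow> y \<in> U \<longrightarrow> g y = g' y"
      using 1(3) 2(3) by eventually_elim auto
    then show "\<exists>r>0. AE y in lborel. y \<in> ball x r \<longrightarrow> y \<in> U \<longrightarrow> g y = g' y" using r(1) by blast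
  qed
  then show ?thesis by simp
qed

text \<open>The choice made in the definition of \<open>weak_partial\<close> does not matter up to null sets.\<close>

lemma weak_partial_AE_eq:
  fixes f :: "real^'d::finite \<Rightarrow> 'b::euclidean_space"
  assumes U: "open U" and fg: "wd U i f g" and Ff: "AE x in lborel. x \<in> U \<longrightarrow> F x = f x"
  shows "AE x in lborel. x \<in> U \<longrightarrow> weak_partial U i F x = g x"
proof -
  have "has_weak_partial U i F g"
    by (subst has_weak_partial_iff_wd[OF U wdD(1,2)[OF fg] Ff]) (use fg in auto)
  moreover from this have "has_weak_partial U i F (weak_partial U i F)"
    unfolding weak_partial_def by (rule someI[of "has_weak_partial U i F"])
  ultimately show ?thesis by (rule has_weak_partial_unique[OF U, rotated])
qed

subsection \<open>Products with test functions\<close>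

lemma partial_deriv_mult:
  fixes f g :: "real^'d::finite \<Rightarrow> real"
  assumes "f differentiable (at x)" "g differentiable (at x)"
  shows "partial_deriv i (\<lambda>x. f x * g x) x = f x * partial_deriv i g x + partial_deriv i f x * g x"
  using partial_deriv_scaleR[OF assms] by simp

lemma wd_test_function_scaleR:
  fixes f g :: "real^'d::finite \<Rightarrow> 'b::euclidean_space"
  assumes fg: "wd U i f g" and \<phi>: "\<phi> \<in> test_functions U"
  shows "wd U i (\<lambda>x. \<phi> x *\<^sub>R f x) (\<lambda>x. partial_deriv i \<phi> x *\<^sub>R f x + \<phi> x *\<^sub>R g x)"
proof -
  note i = test_function_scaleR_integrable[where U=U]
  note f = wdD(1)[OF fg] and g = wdD(2)[OF fg]
  note \<phi>i = test_functions_partial[OF \<phi>]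
  show ?thesis
    unfolding wd_def
  proof (intro conjI ballI Bochner_Integration.integrable_add i f g \<phi> \<phi>i)
    fix \<psi> :: "real^'d \<Rightarrow> real" assume \<psi>: "\<psi> \<in> test_functions U"
    note \<psi>i = test_functions_partial[OF \<psi>]
    have p: "(\<lambda>x. \<psi> x * \<phi> x) \<in> test_functions U" "(\<lambda>x. \<psi> x * partial_deriv i \<phi> x) \<in> test_functions U"
      using test_functions_scaleR[OF \<psi> test_functionsD(1)[OF \<phi>]] test_functions_scaleR[OF \<psi> test_functionsD(1)[OF \<phi>i]] by auto
    have eq: "partial_deriv i \<psi> x * \<phi> x = partial_deriv i (\<lambda>x. \<psi> x * \<phi> x) x - \<psi> x * partial_deriv i \<phi> x" for x
      using partial_deriv_mult[where x=x and i=i, OF smoothD(2)[OF test_functionsD(1)[OF \<psi>]] smoothD(2)[OF test_functionsD(1)[OF \<phi>]]] by simp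
    have "(LBINT x. partial_deriv i \<psi> x *\<^sub>R \<phi> x *\<^sub>R f x) =
       (LBINT x. partial_deriv i (\<lambda>x. \<psi> x * \<phi> x) x *\<^sub>R f x - (\<psi> x * partial_deriv i \<phi> x) *\<^sub>R f x)"
      by (simp add: eq scaleR_diff_left)
    also have "\<dots> = (LBINT x. partial_deriv i (\<lambda>x. \<psi> x * \<phi> x) x *\<^sub>R f x) - (LBINT x. (\<psi> x * partial_deriv i \<phi> x) *\<^sub>R f x)"
      by (rule Bochner_Integration.integral_diff[OF i[OF f test_functions_partial[OF p(1)]] i[OF f p(2)]])
    also have "\<dots> = - ((LBINT x. (\<psi> x * partial_deriv i \<phi> x) *\<^sub>R f x) + (LBINT x. (\<psi> x * \<phi> x) *\<^sub>R g x))"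
      using wdD(5)[OF fg p(1)] by simp
    also have "(LBINT x. (\<psi> x * partial_deriv i \<phi> x) *\<^sub>R f x) + (LBINT x. (\<psi> x * \<phi> x) *\<^sub>R g x) =
        (LBINT x. (\<psi> x * partial_deriv i \<phi> x) *\<^sub>R f x + (\<psi> x * \<phi> x) *\<^sub>R g x)"
      by (rule Bochner_Integration.integral_add[OF i[OF f p(2)] i[OF g p(1)], symmetric])
    finally show "(LBINT x. partial_deriv i \<psi> x *\<^sub>R \<phi> x *\<^sub>R f x) =
        - (LBINT x. \<psi> x *\<^sub>R (partial_deriv i \<phi> x *\<^sub>R f x + \<phi> x *\<^sub>R g x))"
      by (simp add: scaleR_add_right)
  qed
qed

subsection \<open>Compactly supported Sobolev functions\<close>

lemma partial_moll_eq_0: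
  assumes "norm x > inverse (real (Suc n))"
  shows "partial_deriv i (moll n) x = 0"
proof (rule test_functions_support(2)[OF moll_test])
  have "closure {x. moll n x \<noteq> 0} \<subseteq> cball (0::real^'a) (inverse (real (Suc n)))"
  proof (rule closure_minimal)
    show "{x. moll n x \<noteq> 0} \<subseteq> cball (0::real^'a) (inverse (real (Suc n)))"
      using moll_eq_0[of n] by (force simp: not_le)
  qed simp
  then show "x \<notin> closure {x. moll n x \<noteq> 0}" using assms by auto
qed

lemma Lp_2_I:
  fixes f g :: "real^'d::finite \<Rightarrow> 'b::euclidean_space"
  assumes U: "open U" and g: "g \<in> borel_measurable borel" "integrable lborel (\<lambda>x. (norm (g x))\<^sup>2)"
    and fg: "AE x in lborel. x \<in> U \<longrightarrow> f x = g x"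
  shows "f \<in> Lp U 2"
proof -
  have [measurable]: "g \<in> borel_measurable borel" "U \<in> sets borel" using g U by auto
  have "f \<in> borel_measurable (lebesgue_on U)"
    by (rule lebesgue_on_measurable_AE_cong[OF U g(1)]) (use fg in \<open>auto elim: eventually_mono\<close>)
  moreover have "integrable (lebesgue_on U) (\<lambda>x. norm (f x) powr 2)"
  proof -
    have "integrable lborel (\<lambda>x. indicat_real U x *\<^sub>R (norm (g x) powr 2))"
      using g(2) by (intro integrable_mult_indicator) (auto simp: powr_numeral)
    moreover have "integrable (lebesgue_on U) (\<lambda>x. norm (f x) powr 2) \<longleftrightarrow>
       integrable lborel (\<lambda>x. indicat_real U x *\<^sub>R (norm (g x) powr 2))"
      by (rule integral_lebesgue_on_eq(2)[OF U]) (use fg in \<open>auto elim: eventually_mono\<close>)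
    ultimately show ?thesis by simp
  qed
  ultimately show ?thesis by (simp add: Lp_def)
qed

lemma conv_tendsto_L2:
  fixes f :: "real^'d::finite \<Rightarrow> 'b::euclidean_space"
  assumes f: "integrable lborel f" and f2: "integrable lborel (\<lambda>x. (norm (f x))\<^sup>2)"
  shows "(\<lambda>n. LBINT x. (norm (conv (moll n) f x - f x))\<^sup>2) \<longlonglongrightarrow> 0"
proof -
  have [measurable]: "f \<in> borel_measurable borel" "\<And>n. conv (moll n) f \<in> borel_measurable borel"
    using f conv_measurable[OF f] by auto
  have "(\<lambda>n. enn2real (\<integral>\<^sup>+x. ennreal ((norm (conv (moll n) f x - f x))\<^sup>2) \<partial>lborel)) \<longlonglongrightarrow> enn2real 0"
    using conv_tendsto_power[OF f, of 2] f2 by (intro tendsto_enn2real) auto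
  then show ?thesis by (simp add: integral_eq_nn_integral)
qed

text \<open>The mollifications of a compactly supported function are test functions that approximate it
  together with its weak derivatives.\<close>

lemma H10_compact_support:
  fixes f :: "real^'d::finite \<Rightarrow> 'b::euclidean_space"
  assumes U: "open U" and K: "compact K" "K \<subseteq> U" and fg: "\<And>i. wd U i f (g i)"
    and f0: "\<And>x. x \<notin> K \<Longrightarrow> f x = 0" and g0: "\<And>i x. x \<notin> K \<Longrightarrow> g i x = 0"
    and f2: "integrable lborel (\<lambda>x. (norm (f x))\<^sup>2)" and g2: "\<And>i. integrable lborel (\<lambda>x. (norm (g i x))\<^sup>2)"
  shows "f \<in> H10 U"
proof -
  have f: "integrable lborel f" and g: "\<And>i. integrable lborel (g i)" using wdD[OF fg] by auto
  have [measurable]: "f \<in> borel_measurable borel" "\<And>i. g i \<in> borel_measurable borel" "U \<in> sets borel"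
    using f g U by auto
  obtain \<delta> where \<delta>: "\<delta> > 0" "(\<Union>x\<in>K. cball x \<delta>) \<subseteq> U"
    using compact_subset_open_imp_cball_epsilon_subset[OF K(1) U K(2)] by blast
  obtain N where N: "\<And>n. n \<ge> N \<Longrightarrow> inverse (real (Suc n)) \<le> \<delta> / 2"
    using moll_radius_small[of "\<delta> / 2"] \<delta>(1) by auto
  let ?r = "\<lambda>n. inverse (real (Suc n))"
  define \<phi> where "\<phi> n = conv (moll (n + N)) f" for n
  have far: "y \<in> K \<Longrightarrow> norm (x - y) > ?r (n + N)" if "\<not> cball x (?r (n + N)) \<subseteq> U" for x y n
  proof (rule ccontr)
    assume y: "y \<in> K" "\<not> norm (x - y) > ?r (n + N)"
    have "cball x (?r (n + N)) \<subseteq> cball y \<delta>"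
    proof
      fix z assume "z \<in> cball x (?r (n + N))"
      then have "dist y z \<le> ?r (n + N) + ?r (n + N)"
        using y(2) dist_triangle[of y z x] by (simp add: dist_norm norm_minus_commute)
      also have "\<dots> \<le> \<delta>" using N[of "n + N"] by simp
      finally show "z \<in> cball y \<delta>" by simp
    qed
    then show False using \<delta>(2) y(1) that by blast
  qed
  have \<phi>_test: "\<phi> n \<in> test_functions U" for n
  proof (rule test_functionsI)
    show "smooth (\<phi> n)" unfolding \<phi>_def by (rule smooth_conv[OF moll_test f])
    let ?C = "{x + y |x y. x \<in> K \<and> y \<in> cball 0 (?r (n + N))}"
    show "compact ?C" by (rule compact_sums[OF K(1) compact_cball])
    show "?C \<subseteq> U"
    proof
      fix z assume "z \<in> ?C"
      then obtain x y where z: "z = x + y" "x \<in> K" "norm y \<le> ?r (n + N)" by auto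
      have "?r (n + N) \<le> \<delta>" using N[of "n + N"] \<delta>(1) by simp
      then have "z \<in> cball x \<delta>" using z by (simp add: dist_norm)
      then show "z \<in> U" using \<delta>(2) z(2) by blast
    qed
    show "\<phi> n x = 0" if "x \<notin> ?C" for x
      unfolding \<phi>_def
    proof (rule conv_eq_0[where K=K, OF _ f0])
      fix y assume "y \<in> K"
      then have "x - y \<notin> cball 0 (?r (n + N))" using that by (auto simp: algebra_simps)
      then show "moll (n + N) (x - y) = 0" by (intro moll_eq_0) auto
    qed
  qed
  have d\<phi>: "partial_deriv i (\<phi> n) x = conv (moll (n + N)) (g i) x" for i n x
  proof (cases "cball x (?r (n + N)) \<subseteq> U")
    case True
    then show ?thesis unfolding \<phi>_def by (rule wd_conv[OF fg])
  next
    case False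
    have "conv (partial_deriv i (moll (n + N))) f x = 0"
      by (rule conv_eq_0[where K=K, OF _ f0]) (use far[OF False] partial_moll_eq_0 in blast)
    moreover have "conv (moll (n + N)) (g i) x = 0"
      by (rule conv_eq_0[where K=K, OF _ g0]) (use far[OF False] moll_eq_0 less_imp_le in blast)
    ultimately show ?thesis by (simp add: \<phi>_def partial_deriv_conv[OF moll_test f])
  qed
  have wdd: "wd U i (\<lambda>x. \<phi> n x - f x) (\<lambda>x. conv (moll (n + N)) (g i) x - g i x)" for i n
  proof -
    have eq: "partial_deriv i (\<phi> n) = conv (moll (n + N)) (g i)" using d\<phi> by blast
    have "wd U i (\<lambda>x. - f x) (\<lambda>x. - g i x)"
      by (rule wd_bounded_linear[OF bounded_linear_minus[OF bounded_linear_ident] fg])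
    from wd_add[OF wd_test_function[OF \<phi>_test[of n], of U i] this] show ?thesis by (simp add: eq)
  qed
  have norm_eq: "H1_norm U (\<lambda>x. \<phi> n x - f x) =
      sqrt ((LBINT x. indicat_real U x *\<^sub>R (norm (\<phi> n x - f x))\<^sup>2) +
        (\<Sum>i\<in>UNIV. LBINT x. indicat_real U x *\<^sub>R (norm (conv (moll (n + N)) (g i) x - g i x))\<^sup>2))" for n
  proof -
    have [measurable]: "\<phi> n \<in> borel_measurable borel" by (rule test_function_measurable[OF \<phi>_test])
    have [measurable]: "conv (moll (n + N)) (g i) \<in> borel_measurable borel" for i by (rule conv_measurable[OF g])
    have 1: "(LINT x|lebesgue_on U. (norm (\<phi> n x - f x))\<^sup>2) = (LBINT x. indicat_real U x *\<^sub>R (norm (\<phi> n x - f x))\<^sup>2)"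
      by (rule integral_lebesgue_on_eq(1)[OF U]) auto
    have 2: "(LINT x|lebesgue_on U. (norm (weak_partial U i (\<lambda>x. \<phi> n x - f x) x))\<^sup>2) =
        (LBINT x. indicat_real U x *\<^sub>R (norm (conv (moll (n + N)) (g i) x - g i x))\<^sup>2)" for i
    proof (rule integral_lebesgue_on_eq(1)[OF U])
      have "AE x in lborel. x \<in> U \<longrightarrow> weak_partial U i (\<lambda>x. \<phi> n x - f x) x = conv (moll (n + N)) (g i) x - g i x"
        by (rule weak_partial_AE_eq[OF U wdd]) simp
      then show "AE x in lborel. x \<in> U \<longrightarrow> (norm (weak_partial U i (\<lambda>x. \<phi> n x - f x) x))\<^sup>2 =
          indicat_real U x *\<^sub>R (norm (conv (moll (n + N)) (g i) x - g i x))\<^sup>2"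
        by eventually_elim simp
    qed auto
    show ?thesis unfolding H1_norm_def 1 2 ..
  qed
  have to0: "(\<lambda>n. LBINT x. indicat_real U x *\<^sub>R (norm (conv (moll (n + N)) h x - h x))\<^sup>2) \<longlonglongrightarrow> 0"
    if h: "integrable lborel h" "integrable lborel (\<lambda>x. (norm (h x))\<^sup>2)" for h :: "real^'d \<Rightarrow> 'b"
  proof (rule tendsto_sandwich[OF _ _ tendsto_const LIMSEQ_ignore_initial_segment[OF conv_tendsto_L2[OF h]]])
    have [measurable]: "h \<in> borel_measurable borel" "\<And>n. conv (moll n) h \<in> borel_measurable borel"
      using h conv_measurable[OF h(1)] by auto
    show "\<forall>\<^sub>F n in sequentially. 0 \<le> (LBINT x. indicat_real U x *\<^sub>R (norm (conv (moll (n + N)) h x - h x))\<^sup>2)"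
      by (intro always_eventually allI Bochner_Integration.integral_nonneg) simp
    have "(\<lambda>n. \<integral>\<^sup>+x. ennreal ((norm (conv (moll n) h x - h x))\<^sup>2) \<partial>lborel) \<longlonglongrightarrow> 0"
      using conv_tendsto_power[OF h(1), of 2] h(2) by auto
    then have "\<forall>\<^sub>F n in sequentially. (\<integral>\<^sup>+x. ennreal ((norm (conv (moll n) h x - h x))\<^sup>2) \<partial>lborel) < \<infinity>"
      by (rule order_tendstoD) simp
    then have ev: "\<forall>\<^sub>F n in sequentially. integrable lborel (\<lambda>x. (norm (conv (moll n) h x - h x))\<^sup>2)"
      by eventually_elim (auto intro: integrableI_nonneg)
    show "\<forall>\<^sub>F n in sequentially. (LBINT x. indicat_real U x *\<^sub>R (norm (conv (moll (n + N)) h x - h x))\<^sup>2)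
        \<le> (LBINT x. (norm (conv (moll (n + N)) h x - h x))\<^sup>2)"
      using sequentially_offset[OF ev, of N]
    proof eventually_elim
      case (elim n)
      show ?case
      proof (rule integral_mono)
        show "integrable lborel (\<lambda>x. indicat_real U x *\<^sub>R (norm (conv (moll (n + N)) h x - h x))\<^sup>2)"
          using elim by (intro integrable_mult_indicator) auto
      qed (use elim in \<open>auto simp: indicator_def\<close>)
    qed
  qed
  have "(\<lambda>n. sqrt ((LBINT x. indicat_real U x *\<^sub>R (norm (\<phi> n x - f x))\<^sup>2) +
        (\<Sum>i\<in>UNIV. LBINT x. indicat_real U x *\<^sub>R (norm (conv (moll (n + N)) (g i) x - g i x))\<^sup>2))) \<longlonglongrightarrow> sqrt (0 + (\<Sum>i\<in>(UNIV::'d set). 0))"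
    unfolding \<phi>_def by (intro tendsto_intros to0 f g f2 g2)
  then have lim: "(\<lambda>n. H1_norm U (\<lambda>x. \<phi> n x - f x)) \<longlonglongrightarrow> 0" unfolding norm_eq by simp
  have "f \<in> H1 U"
    unfolding W1p_def
  proof (intro CollectI conjI allI)
    show "f \<in> Lp U 2" by (rule Lp_2_I[OF U _ f2]) auto
    fix i
    have "g i \<in> Lp U 2" by (rule Lp_2_I[OF U _ g2]) auto
    moreover have "has_weak_partial U i f (g i)"
      by (subst has_weak_partial_iff_wd[OF U f g]) (use fg in auto)
    ultimately show "\<exists>h\<in>Lp U 2. has_weak_partial U i f h" by blast
  qed
  then show ?thesis unfolding H10_def using \<phi>_test lim by blast
qed

section \<open>Weak derivatives of the inverse matrix\<close>

text \<open>Conditions that hold almost everywhere are forced to hold at every point of \<open>U\<close>, as the chain rule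
  demands.\<close>

lemma wd_modify:
  fixes f :: "real^'d::finite \<Rightarrow> 'b::euclidean_space"
  assumes U [measurable]: "U \<in> sets borel" and fg: "\<And>i. wd U i f (g i)"
    and P: "{y. P y} \<in> sets borel" "P y0" and ae: "AE x in lborel. x \<in> U \<longrightarrow> P (f x)"
  obtains f' where "\<And>i. wd U i f' (g i)" "\<And>x. x \<in> U \<Longrightarrow> P (f' x)" "AE x in lborel. f x = f' x"
proof (rule that)
  define f' where "f' x = (if x \<in> U \<and> f x \<notin> {y. P y} then y0 else f x)" for x
  note [measurable] = P(1)
  have [measurable]: "f \<in> borel_measurable borel" using wdD(3)[OF fg] .
  have m: "f' \<in> borel_measurable borel" unfolding f'_def by measurable
  have eq: "AE x in lborel. f x = f' x" using ae by eventually_elim (auto simp: f'_def)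
  then show "AE x in lborel. f x = f' x" .
  have i: "integrable lborel f'"
    using integrable_cong_AE[of f lborel f'] m wdD(1)[OF fg] eq by auto
  show "wd U i f' (g i)" for i
    by (rule wd_cong[OF fg i wdD(2)[OF fg]]) (use eq in \<open>auto elim: eventually_mono\<close>)
  show "P (f' x)" if "x \<in> U" for x using that P(2) by (auto simp: f'_def)
qed

subsection \<open>Continuously differentiable maps\<close>

definition C1_with :: "('a::euclidean_space \<Rightarrow> 'b::euclidean_space) \<Rightarrow> ('a \<Rightarrow> 'a \<Rightarrow> 'b) \<Rightarrow> bool"
  where "C1_with F F' \<longleftrightarrow> (\<forall>y. (F has_derivative F' y) (at y)) \<and> (\<forall>h. continuous_on UNIV (\<lambda>y. F' y h))"

definition C1 :: "('a::euclidean_space \<Rightarrow> 'b::euclidean_space) \<Rightarrow> bool"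
  where "C1 F \<longleftrightarrow> (\<exists>F'. C1_with F F')"

lemma C1_with_continuous: "C1_with F F' \<Longrightarrow> continuous_on UNIV F"
  unfolding C1_with_def by (intro continuous_at_imp_continuous_on ballI) (blast intro: has_derivative_continuous)

lemma C1_const: "C1 (\<lambda>y. c)"
  unfolding C1_def C1_with_def by (intro exI[of _ "\<lambda>y h. 0"]) auto

lemma C1_bounded_linear: "bounded_linear L \<Longrightarrow> C1 L"
  unfolding C1_def C1_with_def by (intro exI[of _ "\<lambda>y. L"]) (auto intro: bounded_linear_imp_has_derivative)

lemma C1_add:
  assumes "C1 f" "C1 g" shows "C1 (\<lambda>y. f y + g y)"
proof -
  obtain f' g' where "C1_with f f'" "C1_with g g'" using assms by (auto simp: C1_def)
  then show ?thesis unfolding C1_def C1_with_def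
    by (intro exI[of _ "\<lambda>y h. f' y h + g' y h"]) (auto intro!: derivative_intros continuous_intros)
qed

lemma C1_scaleR:
  assumes "C1 f" "C1 g" shows "C1 (\<lambda>y. f y *\<^sub>R g y)"
proof -
  obtain f' g' where fg: "C1_with f f'" "C1_with g g'" using assms by (auto simp: C1_def)
  have c: "continuous_on UNIV f" "continuous_on UNIV g" using fg C1_with_continuous by auto
  show ?thesis unfolding C1_def C1_with_def
    by (intro exI[of _ "\<lambda>y h. f y *\<^sub>R g' y h + f' y h *\<^sub>R g y"] conjI allI has_derivative_scaleR continuous_intros c)
      (use fg in \<open>auto simp: C1_with_def\<close>)
qed

lemma C1_mult: "C1 f \<Longrightarrow> C1 g \<Longrightarrow> C1 (\<lambda>y. f y * g y :: real)"
  using C1_scaleR[of f g] by simp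

lemma C1_sum: "(\<And>a. a \<in> A \<Longrightarrow> C1 (f a)) \<Longrightarrow> C1 (\<lambda>y. \<Sum>a\<in>A. f a y)"
  by (induction A rule: infinite_finite_induct) (auto intro: C1_const C1_add)

lemma C1_prod: "(\<And>a. a \<in> A \<Longrightarrow> C1 (f a)) \<Longrightarrow> C1 (\<lambda>y. \<Prod>a\<in>A. f a y :: real)"
  by (induction A rule: infinite_finite_induct) (auto intro: C1_const C1_mult)

lemma C1_det:
  fixes a :: "'d::finite \<Rightarrow> 'd \<Rightarrow> 'a::euclidean_space \<Rightarrow> real"
  assumes "\<And>i j. C1 (\<lambda>y. a i j y)"
  shows "C1 (\<lambda>y. det (\<chi> i j. a i j y))"
  unfolding det_def vec_lambda_beta by (intro C1_sum C1_mult C1_prod C1_const assms)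

lemma C1_entry: "C1 (\<lambda>A::real^'n^'m. A $ i $ j)"
  by (rule C1_bounded_linear) (intro bounded_linear_compose[OF bounded_linear_vec_nth bounded_linear_vec_nth])

text \<open>By linearity it suffices to bound the values at the finitely many basis vectors.\<close>

lemma compact_derivative_bound:
  fixes F' :: "'c::topological_space \<Rightarrow> 'a::euclidean_space \<Rightarrow> 'b::euclidean_space"
  assumes I: "compact I" and cont: "\<And>h. continuous_on I (\<lambda>y. F' y h)" and lin: "\<And>y. y \<in> I \<Longrightarrow> linear (F' y)"
  obtains B where "B \<ge> 0" "\<And>y h. y \<in> I \<Longrightarrow> norm (F' y h) \<le> B * norm h"
proof -
  have "\<exists>C\<ge>0. \<forall>y\<in>I. norm (F' y b) \<le> C" for b
  proof -
    have "bounded ((\<lambda>y. F' y b) ` I)" by (intro compact_imp_bounded compact_continuous_image cont I)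
    then obtain C where "\<And>y. y \<in> I \<Longrightarrow> norm (F' y b) \<le> C" by (auto simp: bounded_iff)
    then have "\<forall>y\<in>I. norm (F' y b) \<le> max C 0" by (auto simp: le_max_iff_disj)
    then show ?thesis by (intro exI[of _ "max C 0"]) auto
  qed
  then obtain C where C: "\<And>b. C b \<ge> 0" "\<And>b y. y \<in> I \<Longrightarrow> norm (F' y b) \<le> C b" by metis
  have "norm (F' y h) \<le> (\<Sum>b\<in>Basis. C b) * norm h" if y: "y \<in> I" for y h
  proof -
    have "F' y h = F' y (\<Sum>b\<in>Basis. (h \<bullet> b) *\<^sub>R b)" by (simp add: euclidean_representation)
    also have "\<dots> = (\<Sum>b\<in>Basis. (h \<bullet> b) *\<^sub>R F' y b)"
      by (simp add: linear_sum[OF lin[OF y]] linear_scale[OF lin[OF y]])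
    also have "norm \<dots> \<le> (\<Sum>b\<in>Basis. norm h * C b)"
      using C Basis_le_norm[of _ h] y by (intro sum_norm_le) (auto intro!: mult_mono)
    finally show ?thesis by (simp add: sum_distrib_left mult.commute)
  qed
  moreover have "(\<Sum>b\<in>Basis. C b) \<ge> 0" using C by (intro sum_nonneg) auto
  ultimately show ?thesis using that by blast
qed

text \<open>The \<open>k\<close>-th column of the adjugate matrix: the vector of the numerators in Cramer's rule for
  \<open>A *v x = axis k 1\<close>.\<close>

definition cramer_vec :: "'d::finite \<Rightarrow> real^'d^'d \<Rightarrow> real^'d"
  where "cramer_vec k A = (\<Sum>i\<in>UNIV. det (\<chi> a b. if b = i then axis k 1 $ a else A $ a $ b) *\<^sub>R axis i 1)"

lemma matrix_mult_cramer_vec: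
  assumes "det A \<noteq> 0"
  shows "A *v (inverse (det A) *\<^sub>R cramer_vec k A) = axis k 1"
proof -
  have "inverse (det A) *\<^sub>R cramer_vec k A = (\<chi> i. det (\<chi> a b. if b = i then axis k 1 $ a else A $ a $ b) / det A)"
  proof -
    have "cramer_vec k A $ j = det (\<chi> a b. if b = j then axis k 1 $ a else A $ a $ b)" for j
    proof -
      have "cramer_vec k A $ j = (\<Sum>i\<in>UNIV. if i = j then det (\<chi> a b. if b = i then axis k 1 $ a else A $ a $ b) else 0)"
        unfolding cramer_vec_def sum_component by (rule sum.cong) (auto simp: axis_def)
      then show ?thesis by simp
    qed
    then show ?thesis by (simp add: vec_eq_iff divide_inverse mult.commute)
  qed
  then show ?thesis using cramer[OF assms, of _ "axis k 1"] by metis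
qed

lemma C1_cramer_vec: "C1 (cramer_vec k)"
proof -
  have "C1 (\<lambda>A::real^'a^'a. if b = i then axis k 1 $ a else A $ a $ b)" for a b i
    by (cases "b = i") (auto intro: C1_const C1_entry)
  then show ?thesis
    unfolding cramer_vec_def[abs_def] by (intro C1_sum C1_scaleR C1_const C1_det)
qed

lemma C1_det_id: "C1 (det :: real^'d^'d \<Rightarrow> real)"
  using C1_det[of "\<lambda>i j A. A $ i $ j", OF C1_entry] by simp

lemma power_integrable_bound:
  fixes f :: "real^'d::finite \<Rightarrow> 'a::euclidean_space" and g :: "real^'d \<Rightarrow> 'b::euclidean_space"
  assumes f: "integrable lborel (\<lambda>x. norm (f x) powr q)" and g: "g \<in> borel_measurable borel"
    and le: "\<And>x. norm (g x) \<le> B * norm (f x)" and B: "B \<ge> 0" and q: "q \<ge> 0"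
  shows "integrable lborel (\<lambda>x. norm (g x) powr q)"
proof (rule Bochner_Integration.integrable_bound)
  show "integrable lborel (\<lambda>x. B powr q * norm (f x) powr q)" using f by simp
  show "AE x in lborel. norm (norm (g x) powr q) \<le> norm (B powr q * norm (f x) powr q)"
  proof (rule AE_I2)
    fix x
    have "norm (g x) powr q \<le> (B * norm (f x)) powr q" using le q by (intro powr_mono2) auto
    then show "norm (norm (g x) powr q) \<le> norm (B powr q * norm (f x) powr q)" using B by (simp add: powr_mult)
  qed
qed (use g in measurable)

lemma continuous_nonzero_constant_sign:
  fixes h :: "'a::topological_space \<Rightarrow> real"
  assumes "connected \<Omega>" "continuous_on \<Omega> h" "\<forall>x\<in>\<Omega>. h x \<noteq> 0"
  obtains s :: real where "s \<in> {1, -1}" "\<And>x. x \<in> \<Omega> \<Longrightarrow> s * h x > 0"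
proof -
  have conn: "connected (h ` \<Omega>)" by (rule connected_continuous_image[OF assms(2,1)])
  have "(\<forall>x\<in>\<Omega>. h x > 0) \<or> (\<forall>x\<in>\<Omega>. h x < 0)"
  proof (rule ccontr)
    assume "\<not> ?thesis"
    then obtain x y where xy: "x \<in> \<Omega>" "y \<in> \<Omega>" "h x \<le> 0" "h y \<ge> 0" by force
    then have "0 \<in> h ` \<Omega>" using connectedD_interval[OF conn, of "h x" "h y" 0] by auto
    then show False using assms(3) by auto
  qed
  then show ?thesis
  proof
    assume "\<forall>x\<in>\<Omega>. h x > 0"
    then show ?thesis by (intro that[of 1]) auto
  next
    assume "\<forall>x\<in>\<Omega>. h x < 0"
    then show ?thesis by (intro that[of "-1"]) auto
  qed
qed

text \<open>The determinant is bounded and weakly differentiable with derivatives in \<open>L\<^sup>q\<close>, hence has a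
  continuous representative.  Being bounded away from zero, this representative keeps its sign.\<close>

lemma det_constant_sign:
  fixes S :: "real^'d::finite \<Rightarrow> real^'d^'d" and T :: "'d \<Rightarrow> real^'d \<Rightarrow> real^'d^'d"
  assumes \<Omega>: "open \<Omega>" "bounded \<Omega>" "connected \<Omega>" and ST: "\<And>j. wd \<Omega> j S (T j)"
    and C: "\<And>x. x \<in> \<Omega> \<Longrightarrow> norm (S x) \<le> C" and c: "c > 0" "\<And>x. x \<in> \<Omega> \<Longrightarrow> \<bar>det (S x)\<bar> \<ge> c"
    and q: "real CARD('d) < q" and T: "\<And>j. integrable lborel (\<lambda>x. norm (T j x) powr q)"
  obtains s where "s \<in> {1, -1}" "AE x in lborel. x \<in> \<Omega> \<longrightarrow> s * det (S x) \<ge> c"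
proof -
  have q1: "q > 1" using q by (metis One_nat_def Suc_leI dual_order.strict_trans2 of_nat_1 of_nat_le_iff zero_less_card_finite)
  obtain d' where d': "C1_with (det :: real^'d^'d \<Rightarrow> real) d'" using C1_det_id by (auto simp: C1_def)
  have dd: "(det has_derivative d' y) (at y)" and dc: "continuous_on UNIV (\<lambda>y. d' y h)" for y h
    using d' by (auto simp: C1_with_def)
  obtain B where B: "B \<ge> 0" "\<And>y h. y \<in> cball 0 C \<Longrightarrow> norm (d' y h) \<le> B * norm h"
    by (rule compact_derivative_bound[of "cball 0 C" d'])
      (use dc has_derivative_linear[OF dd] in \<open>auto intro: continuous_on_subset\<close>)
  have [measurable]: "\<Omega> \<in> sets borel" "S \<in> borel_measurable borel" "\<And>j. T j \<in> borel_measurable borel"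
    using \<Omega>(1) wdD(3,4)[OF ST] by auto
  define D where "D x = indicat_real \<Omega> x *\<^sub>R det (S x)" for x
  define E where "E j x = indicat_real \<Omega> x *\<^sub>R d' (S x) (T j x)" for j x
  have DE: "wd \<Omega> j D (E j)" for j
    unfolding D_def E_def
  proof (rule wd_chain[OF \<Omega>(1,2) ST, where I="cball 0 C" and B=B])
    show "(det :: real^'d^'d \<Rightarrow> real) \<in> borel_measurable borel" by (rule borel_measurable_continuous_onI[OF C1_with_continuous[OF d']])
    show "(\<lambda>y. d' y h) \<in> borel_measurable borel" for h by (rule borel_measurable_continuous_onI[OF dc])
  qed (use C dd dc B in \<open>auto intro: continuous_on_subset\<close>)
  have Eb: "norm (E j x) \<le> B * norm (T j x)" for j x
    using B C[of x] by (auto simp: E_def indicator_def)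
  have Eq: "integrable lborel (\<lambda>x. norm (E j x) powr q)" for j
    by (rule power_integrable_bound[OF T wdD(4)[OF DE] Eb B(1)]) (use q1 in auto)
  obtain M where M0: "M \<ge> 0" and vg: "\<And>j. volume_growth q M (E j)"
    using volume_growth_family[of E q, OF wdD(4)[OF DE] Eq q1] by blast
  obtain h where h: "continuous_on \<Omega> h" "AE y in lborel. y \<in> \<Omega> \<longrightarrow> D y = h y"
    using wd_continuous_representative[OF \<Omega>(1) DE q M0 vg] by blast
  have h_det: "AE y in lborel. y \<in> \<Omega> \<longrightarrow> det (S y) = h y"
    using h(2) by eventually_elim (auto simp: D_def)
  have hc: "\<bar>h x\<bar> \<ge> c" if x: "x \<in> \<Omega>" for x
  proof (rule ccontr)
    assume "\<not> \<bar>h x\<bar> \<ge> c"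
    have ch: "continuous_on \<Omega> (\<lambda>x. \<bar>h x\<bar>)" using h(1) by (intro continuous_intros)
    have "open (\<Omega> \<inter> (\<lambda>x. \<bar>h x\<bar>) -` {..<c})"
      using ch \<Omega>(1) by (simp add: continuous_on_open_vimage Int_commute)
    moreover have "\<Omega> \<inter> (\<lambda>x. \<bar>h x\<bar>) -` {..<c} \<noteq> {}" using x \<open>\<not> \<bar>h x\<bar> \<ge> c\<close> by auto
    moreover have "AE y in lborel. y \<in> \<Omega> \<inter> (\<lambda>x. \<bar>h x\<bar>) -` {..<c} \<longrightarrow> \<bar>h y\<bar> \<ge> c"
      using h_det by eventually_elim (metis Int_iff c(2))
    ultimately obtain y where "y \<in> \<Omega> \<inter> (\<lambda>x. \<bar>h x\<bar>) -` {..<c}" "\<bar>h y\<bar> \<ge> c" by (rule AE_point_in_open)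
    then show False by auto
  qed
  then have "\<forall>x\<in>\<Omega>. h x \<noteq> 0" using c(1) by fastforce
  then obtain s :: real where s: "s \<in> {1, -1}" "\<And>x. x \<in> \<Omega> \<Longrightarrow> s * h x > 0"
    by (rule continuous_nonzero_constant_sign[OF \<Omega>(3) h(1)]) (rule that)
  have "s * h x \<ge> c" if "x \<in> \<Omega>" for x using hc[OF that] s(1) s(2)[OF that] by auto
  then have "AE x in lborel. x \<in> \<Omega> \<longrightarrow> s * det (S x) \<ge> c" using h_det by (auto elim: eventually_mono)
  then show ?thesis using that s(1) by blast
qed

text \<open>The set of matrices with a determinant away from zero is not convex, so the chain rule does not apply
  to the inverse as a function of \<open>S\<close>.  It applies to \<open>cramer_vec k A / t\<close> as a function of the pair
  \<open>(A, t)\<close> in the product of a ball and an interval without zero.\<close>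

lemma inverse_columns_weakly_differentiable:
  fixes S :: "real^'d::finite \<Rightarrow> real^'d^'d" and T :: "'d \<Rightarrow> real^'d \<Rightarrow> real^'d^'d"
  assumes \<Omega>: "open \<Omega>" "bounded \<Omega>" and ST: "\<And>j. wd \<Omega> j S (T j)"
    and C: "\<And>x. x \<in> \<Omega> \<Longrightarrow> norm (S x) \<le> C" and s: "s \<in> {1, -1}"
    and c: "c > 0" "\<And>x. x \<in> \<Omega> \<Longrightarrow> s * det (S x) \<ge> c"
  obtains Q R B where "\<And>j. wd \<Omega> j Q (R j)" "\<And>x. x \<in> \<Omega> \<Longrightarrow> S x *v Q x = axis k 1"
    "B \<ge> 0" "\<And>x. norm (Q x) \<le> B" "\<And>j x. norm (R j x) \<le> B * norm (T j x)"
proof -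
  obtain d' where d': "C1_with (det :: real^'d^'d \<Rightarrow> real) d'" using C1_det_id by (auto simp: C1_def)
  obtain n' where n': "C1_with (cramer_vec k :: real^'d^'d \<Rightarrow> real^'d) n'" using C1_cramer_vec by (auto simp: C1_def)
  have dd: "(det has_derivative d' y) (at y)" and dc: "continuous_on UNIV (\<lambda>y. d' y h)" for y h
    using d' by (auto simp: C1_with_def)
  have nd: "(cramer_vec k has_derivative n' y) (at y)" and nc: "continuous_on UNIV (\<lambda>y. n' y h)" for y h
    using n' by (auto simp: C1_with_def)
  have cn: "continuous_on UNIV (cramer_vec k)" and cd: "continuous_on UNIV (det :: real^'d^'d \<Rightarrow> real)"
    using C1_with_continuous d' n' by auto
  have [measurable]: "\<Omega> \<in> sets borel" "S \<in> borel_measurable borel" "\<And>j. T j \<in> borel_measurable borel"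
    using \<Omega>(1) wdD(3,4)[OF ST] by auto
  obtain B1 where B1: "B1 \<ge> 0" "\<And>y h. y \<in> cball 0 C \<Longrightarrow> norm (d' y h) \<le> B1 * norm h"
    by (rule compact_derivative_bound[of "cball 0 C" d'])
      (use dc has_derivative_linear[OF dd] in \<open>auto intro: continuous_on_subset\<close>)
  have "bounded (det ` cball (0::real^'d^'d) C)"
    using cd by (intro compact_imp_bounded compact_continuous_image) (auto intro: continuous_on_subset)
  then obtain C2 where "\<forall>y\<in>det ` cball (0::real^'d^'d) C. norm y \<le> C2"
    unfolding bounded_iff by blast
  then have C2: "\<bar>det A\<bar> \<le> C2" if "A \<in> cball 0 C" for A :: "real^'d^'d"
    using that by (metis imageI real_norm_def)
  define D where "D x = indicat_real \<Omega> x *\<^sub>R det (S x)" for x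
  define E where "E j x = indicat_real \<Omega> x *\<^sub>R d' (S x) (T j x)" for j x
  have DE: "wd \<Omega> j D (E j)" for j
    unfolding D_def E_def
  proof (rule wd_chain[OF \<Omega>(1,2) ST, where I="cball 0 C" and B=B1])
    show "(det :: real^'d^'d \<Rightarrow> real) \<in> borel_measurable borel" by (rule borel_measurable_continuous_onI[OF cd])
    show "(\<lambda>y. d' y h) \<in> borel_measurable borel" for h by (rule borel_measurable_continuous_onI[OF dc])
  qed (use C dd dc B1 in \<open>auto intro: continuous_on_subset\<close>)
  have Eb: "norm (E j x) \<le> B1 * norm (T j x)" for j x
    using B1 C[of x] by (auto simp: E_def indicator_def)
  \<comment> \<open>The interval is \<open>[c, C2]\<close> or its reflection, according to the sign \<open>s\<close> of the determinant.\<close>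
  define I where "I = cball (0::real^'d^'d) C \<times> ({min (s * c) (s * C2)..max (s * c) (s * C2)} :: real set)"
  have I: "convex I" "compact I" unfolding I_def by (auto intro!: convex_Times compact_Times)
  have Is: "snd y \<noteq> 0" if "y \<in> I" and "c \<le> C2" for y
    using that c s by (auto simp: I_def min_def max_def split: if_splits)
  have SD: "(S x, D x) \<in> I" and cC2: "c \<le> C2" if x: "x \<in> \<Omega>" for x
  proof -
    have "c \<le> s * det (S x)" "\<bar>det (S x)\<bar> \<le> C2" using c(2)[OF x] C2 C[OF x] by auto
    then show "(S x, D x) \<in> I" "c \<le> C2" using s C[OF x] x by (auto simp: I_def D_def min_def max_def)
  qed
  define F :: "(real^'d^'d) \<times> real \<Rightarrow> real^'d" where "F p = inverse (snd p) *\<^sub>R cramer_vec k (fst p)" for p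
  define F' :: "(real^'d^'d) \<times> real \<Rightarrow> (real^'d^'d) \<times> real \<Rightarrow> real^'d"
    where "F' p h = inverse (snd p) *\<^sub>R n' (fst p) (fst h) + (- (inverse (snd p) * snd h * inverse (snd p))) *\<^sub>R cramer_vec k (fst p)" for p h
  have Fder: "(F has_derivative F' p) (at p)" if "snd p \<noteq> 0" for p
  proof -
    have "(fst has_derivative fst) (at p)" by (rule has_derivative_fst) (rule has_derivative_ident)
    from diff_chain_at[OF this nd] have 1: "((\<lambda>p. cramer_vec k (fst p)) has_derivative (\<lambda>h. n' (fst p) (fst h))) (at p)"
      by (simp add: o_def)
    have 2: "((\<lambda>p. inverse (snd p)) has_derivative (\<lambda>h. - (inverse (snd p) * snd h * inverse (snd p)))) (at p)"
    proof -
      have "(snd has_derivative snd) (at p)" by (rule has_derivative_snd) (rule has_derivative_ident)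
      from diff_chain_at[OF this has_derivative_inverse'[OF that]] show ?thesis by (simp add: o_def)
    qed
    show ?thesis unfolding F_def[abs_def] F'_def[abs_def] using has_derivative_scaleR[OF 2 1] by simp
  qed
  have n'c: "continuous_on X (\<lambda>p. n' (fst p) h)" for X h
    by (rule continuous_on_compose2[OF nc]) (auto intro!: continuous_intros)
  have cnc: "continuous_on X (\<lambda>p. cramer_vec k (fst p))" for X
    by (rule continuous_on_compose2[OF cn]) (auto intro!: continuous_intros)
  have [measurable]: "(\<lambda>A. n' A h) \<in> borel_measurable borel" "cramer_vec k \<in> borel_measurable borel" for h
    by (intro borel_measurable_continuous_onI nc cn)+
  have mfs [measurable]: "(fst :: (real^'d^'d) \<times> real \<Rightarrow> _) \<in> borel_measurable borel" "(snd :: (real^'d^'d) \<times> real \<Rightarrow> _) \<in> borel_measurable borel"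
    by (intro borel_measurable_continuous_onI continuous_intros)+
  have mn: "(\<lambda>p::(real^'d^'d) \<times> real. n' (fst p) h) \<in> borel_measurable borel"
    "(\<lambda>p::(real^'d^'d) \<times> real. cramer_vec k (fst p)) \<in> borel_measurable borel" for h
    by (rule borel_measurable_continuous_onI[OF n'c], rule borel_measurable_continuous_onI[OF cnc])
  show ?thesis
  proof (cases "\<Omega> = {}")
    case True
    show ?thesis
    proof (rule that[of "\<lambda>x. 0" "\<lambda>j x. 0" 0])
      show "wd \<Omega> j (\<lambda>x. 0) (\<lambda>x. 0)" for j by (simp add: wd_def)
    qed (use True in auto)
  next
    case False
    then have cC2': "c \<le> C2" using cC2 by blast
    have FI: "(F has_derivative F' p) (at p)" if "p \<in> I" for p using Fder Is[OF that cC2'] by blast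
    have F'c: "continuous_on I (\<lambda>p. F' p h)" for h
      unfolding F'_def using Is cC2' by (intro continuous_intros n'c cnc) auto
    have Fc: "continuous_on I F"
      unfolding F_def[abs_def] using Is cC2' by (intro continuous_intros cnc) auto
    obtain B2 where B2: "B2 \<ge> 0" "\<And>y h. y \<in> I \<Longrightarrow> norm (F' y h) \<le> B2 * norm h"
      using compact_derivative_bound[OF I(2) F'c has_derivative_linear[OF FI]] by metis
    have "bounded (F ` I)" by (intro compact_imp_bounded compact_continuous_image Fc I)
    then obtain B3 where "\<forall>y\<in>F ` I. norm y \<le> B3" unfolding bounded_iff by blast
    then have B3: "norm (F p) \<le> B3" if "p \<in> I" for p using that by blast
      define Q where "Q x = indicat_real \<Omega> x *\<^sub>R F (S x, D x)" for x
    define R where "R j x = indicat_real \<Omega> x *\<^sub>R F' (S x, D x) (T j x, E j x)" for j x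
    let ?B = "\<bar>B3\<bar> + B2 * (1 + B1)"
    show ?thesis
    proof (rule that[of Q R ?B])
      show "wd \<Omega> j Q (R j)" for j
        unfolding Q_def R_def
      proof (rule wd_chain[OF \<Omega> wd_Pair[OF ST DE] I(1) compact_imp_closed[OF I(2)] SD FI F'c B2(2)])
        show "F \<in> borel_measurable borel" unfolding F_def using mn mfs by measurable
        show "(\<lambda>p. F' p h) \<in> borel_measurable borel" for h unfolding F'_def using mn mfs by measurable
      qed auto
      show "S x *v Q x = axis k 1" if x: "x \<in> \<Omega>" for x
      proof -
        have "det (S x) \<noteq> 0" using c(1) c(2)[OF x] by auto
        from matrix_mult_cramer_vec[OF this, of k] x show ?thesis by (simp add: Q_def F_def D_def)
      qed
      show "?B \<ge> 0" using B1 B2 by auto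
      show "norm (Q x) \<le> ?B" for x
      proof (cases "x \<in> \<Omega>")
        case True
        then have "norm (Q x) \<le> \<bar>B3\<bar>" using B3[OF SD[OF True]] by (simp add: Q_def)
        also have "\<dots> \<le> ?B" using B1 B2 by auto
        finally show ?thesis .
      qed (use B1 B2 in \<open>auto simp: Q_def\<close>)
      show "norm (R j x) \<le> ?B * norm (T j x)" for j x
      proof (cases "x \<in> \<Omega>")
        case True
        have "norm (T j x, E j x) \<le> norm (T j x) + norm (E j x)" by (rule norm_Pair_le)
        also have "\<dots> \<le> (1 + B1) * norm (T j x)" using Eb[of j x] by (simp add: algebra_simps)
        finally have "norm (T j x, E j x) \<le> (1 + B1) * norm (T j x)" .
        then have "norm (R j x) \<le> B2 * ((1 + B1) * norm (T j x))"
          using True B2(2)[OF SD[OF True], of "(T j x, E j x)"] B2(1) by (auto simp: R_def intro: order_trans mult_left_mono)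
        also have "\<dots> \<le> ?B * norm (T j x)" by (simp add: algebra_simps mult_right_mono)
        finally show ?thesis .
      qed (use B1 B2 in \<open>auto simp: R_def\<close>)
    qed
  qed
qed

section \<open>The gradient of a solution\<close>

text \<open>The moduli \<open>\<mu>\<close> for which the stress \<open>\<mu> \<nabla>\<^sup>s u\<close> is divergence free.\<close>

definition stress_solution :: "(real^'d::finite) set \<Rightarrow> (real^'d \<Rightarrow> real^'d) \<Rightarrow> (real^'d \<Rightarrow> real) \<Rightarrow> bool"
  where "stress_solution \<Omega> u \<mu> \<longleftrightarrow> \<mu> \<in> Lp \<Omega> 2 \<and>
     (\<forall>v\<in>H10 \<Omega>. (LINT x|lebesgue_on \<Omega>. (\<mu> x *\<^sub>R sym_grad \<Omega> u x) \<bullet> sym_grad \<Omega> v x) = 0)"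

lemma integrable_lower_power:
  fixes f :: "real^'d::finite \<Rightarrow> 'b::euclidean_space"
  assumes U: "bounded U" "U \<in> sets borel" and f: "f \<in> borel_measurable borel" "\<And>x. x \<notin> U \<Longrightarrow> f x = 0"
    and q: "integrable lborel (\<lambda>x. norm (f x) powr q)" and r: "0 < r" "r \<le> q"
  shows "integrable lborel (\<lambda>x. norm (f x) powr r)"
proof (rule Bochner_Integration.integrable_bound[of _ "\<lambda>x. indicat_real U x + norm (f x) powr q"])
  have "emeasure lborel U < \<infinity>" using emeasure_bounded_finite[OF U(1)] by simp
  then show "integrable lborel (\<lambda>x. indicat_real U x + norm (f x) powr q)" using q U by auto
  show "AE x in lborel. norm (norm (f x) powr r) \<le> norm (indicat_real U x + norm (f x) powr q)"
  proof (rule AE_I2)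
    fix x
    show "norm (norm (f x) powr r) \<le> norm (indicat_real U x + norm (f x) powr q)"
    proof (cases "x \<in> U")
      case True
      have "norm (f x) powr r \<le> 1 + norm (f x) powr q"
      proof (cases "norm (f x) \<le> 1")
        case True
        then have "norm (f x) powr r \<le> 1" using powr_mono2[of r "norm (f x)" 1] r by simp
        then show ?thesis by (simp add: add_increasing2)
      next
        case False
        then have "norm (f x) powr r \<le> norm (f x) powr q" by (intro powr_mono r(2)) auto
        then show ?thesis by linarith
      qed
      then show ?thesis using True by simp
    qed (use f(2) in simp)
  qed
qed (use f in measurable)

lemma sum_powr_bound:
  fixes t :: "'d::finite \<Rightarrow> real"
  assumes t: "\<And>j. t j \<ge> 0" and q: "q \<ge> 0"
  shows "(\<Sum>j\<in>UNIV. t j) powr q \<le> real CARD('d) powr q * (\<Sum>j\<in>UNIV. t j powr q)"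
proof -
  obtain j0 where j0: "\<And>j. t j \<le> t j0"
  proof -
    have "Max (range t) \<in> range t" by (intro Max_in) auto
    then obtain j0 where j0: "Max (range t) = t j0" by (rule rangeE)
    have "t j \<le> t j0" for j unfolding j0[symmetric] by (rule Max_ge) auto
    then show ?thesis using that by blast
  qed
  have "(\<Sum>j\<in>UNIV. t j) \<le> real CARD('d) * t j0"
    using sum_bounded_above[of UNIV t "t j0"] j0 by simp
  then have "(\<Sum>j\<in>UNIV. t j) powr q \<le> (real CARD('d) * t j0) powr q"
    using t q by (intro powr_mono2 sum_nonneg) auto
  also have "\<dots> = real CARD('d) powr q * t j0 powr q" by (rule powr_mult)
  also have "\<dots> \<le> real CARD('d) powr q * (\<Sum>j\<in>UNIV. t j powr q)"
    by (intro mult_left_mono member_le_sum) auto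
  finally show ?thesis .
qed

lemma sum_norm_power_integrable:
  fixes T :: "'d::finite \<Rightarrow> real^'d \<Rightarrow> 'b::euclidean_space"
  assumes T: "\<And>j. integrable lborel (\<lambda>x. norm (T j x) powr q)" "\<And>j. T j \<in> borel_measurable borel" and q: "q \<ge> 0"
  shows "integrable lborel (\<lambda>x. norm (\<Sum>j\<in>UNIV. norm (T j x)) powr q)"
proof (rule Bochner_Integration.integrable_bound)
  show "integrable lborel (\<lambda>x. real CARD('d) powr q * (\<Sum>j\<in>UNIV. norm (T j x) powr q))" using T by auto
  show "AE x in lborel. norm (norm (\<Sum>j\<in>UNIV. norm (T j x)) powr q) \<le> norm (real CARD('d) powr q * (\<Sum>j\<in>UNIV. norm (T j x) powr q))"
  proof (rule AE_I2)
    fix x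
    have "(\<Sum>j\<in>UNIV. norm (T j x)) powr q \<le> real CARD('d) powr q * (\<Sum>j\<in>UNIV. norm (T j x) powr q)"
      by (rule sum_powr_bound) (use q in auto)
    then show "norm (norm (\<Sum>j\<in>UNIV. norm (T j x)) powr q) \<le> norm (real CARD('d) powr q * (\<Sum>j\<in>UNIV. norm (T j x) powr q))"
      by (simp add: sum_nonneg abs_of_nonneg)
  qed
qed (use T in measurable)

text \<open>Against a symmetric matrix the symmetric gradient can be replaced by the full gradient.\<close>

lemma sym_grad_inner_symmetric:
  fixes A :: "real^'d::finite^'d" and w :: "'d \<Rightarrow> real^'d"
  assumes "\<And>i j. A $ i $ j = A $ j $ i"
  shows "A \<bullet> (\<chi> i j. (w j $ i + w i $ j) / 2) = (\<Sum>j\<in>UNIV. \<Sum>i\<in>UNIV. A $ i $ j * w j $ i)"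
proof -
  let ?s = "\<Sum>j\<in>UNIV. \<Sum>i\<in>UNIV. A $ i $ j * w j $ i"
  have "A \<bullet> (\<chi> i j. (w j $ i + w i $ j) / 2) = (\<Sum>i\<in>UNIV. \<Sum>j\<in>UNIV. A $ i $ j * w j $ i / 2 + A $ i $ j * w i $ j / 2)"
    by (simp add: inner_vec_def algebra_simps add_divide_distrib)
  also have "\<dots> = (\<Sum>i\<in>UNIV. \<Sum>j\<in>UNIV. A $ i $ j * w j $ i / 2) + (\<Sum>i\<in>UNIV. \<Sum>j\<in>UNIV. A $ i $ j * w i $ j / 2)"
    by (simp add: sum.distrib)
  also have "(\<Sum>i\<in>UNIV. \<Sum>j\<in>UNIV. A $ i $ j * w j $ i / 2) = ?s / 2"
    by (subst sum.swap) (simp add: sum_divide_distrib)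
  also have "(\<Sum>i\<in>UNIV. \<Sum>j\<in>UNIV. A $ i $ j * w i $ j / 2) = ?s / 2"
    using assms by (simp add: sum_divide_distrib)
  finally show ?thesis by simp
qed

text \<open>With \<open>v = \<phi> Q\<close>, where \<open>S Q = axis k 1\<close>, the contraction of \<open>S\<close> with the gradient of \<open>v\<close> is
  \<open>\<partial>\<^sub>k \<phi> + \<phi> b\<close>, so the equation tested with \<open>v\<close> says that \<open>\<partial>\<^sub>k m = m b\<close>.\<close>

lemma wd_stress_solution:
  fixes \<Omega> :: "(real^'d::finite) set" and S :: "real^'d \<Rightarrow> real^'d^'d" and T :: "'d \<Rightarrow> real^'d \<Rightarrow> 'z::euclidean_space"
  assumes \<Omega>: "open \<Omega>" "bounded \<Omega>" and sol: "stress_solution \<Omega> u \<mu>"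
    and m: "m \<in> borel_measurable borel" "AE x in lborel. x \<in> \<Omega> \<longrightarrow> \<mu> x = m x" "\<And>x. x \<notin> \<Omega> \<Longrightarrow> m x = 0"
    and Su: "AE x in lborel. x \<in> \<Omega> \<longrightarrow> sym_grad \<Omega> u x = S x"
    and sym: "\<And>x i j. x \<in> \<Omega> \<Longrightarrow> S x $ i $ j = S x $ j $ i"
    and Q: "\<And>j. wd \<Omega> j Q (R j)" "\<And>x. x \<in> \<Omega> \<Longrightarrow> S x *v Q x = axis k 1" "\<And>x. norm (Q x) \<le> B"
      "\<And>j x. norm (R j x) \<le> B * norm (T j x)"
    and B: "B \<ge> 0" and T: "\<And>j. T j \<in> borel_measurable borel" "\<And>j. integrable lborel (\<lambda>x. (norm (T j x))\<^sup>2)"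
    and b: "\<And>x. x \<in> \<Omega> \<Longrightarrow> b x = (\<Sum>j\<in>UNIV. \<Sum>i\<in>UNIV. S x $ i $ j * R j x $ i)"
      "b \<in> borel_measurable borel" "integrable lborel (\<lambda>x. (b x)\<^sup>2)"
  shows "wd \<Omega> k m (\<lambda>x. m x * b x)"
proof -
  have [measurable]: "\<Omega> \<in> sets borel" "m \<in> borel_measurable borel" "b \<in> borel_measurable borel"
    "Q \<in> borel_measurable borel" "\<And>j. R j \<in> borel_measurable borel"
    using \<Omega> m b(2) wdD(3,4)[OF Q(1)] by auto
  have \<mu>: "\<mu> \<in> Lp \<Omega> 2" using sol by (simp add: stress_solution_def)
  have m2: "integrable lborel (\<lambda>x. norm (m x) powr 2)"
  proof -
    have "integrable (lebesgue_on \<Omega>) (\<lambda>x. norm (\<mu> x) powr 2)" using \<mu> by (simp add: Lp_def)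
    moreover have "integrable (lebesgue_on \<Omega>) (\<lambda>x. norm (\<mu> x) powr 2) \<longleftrightarrow> integrable lborel (\<lambda>x. norm (m x) powr 2)"
      by (rule integral_lebesgue_on_eq(2)[OF \<Omega>(1)]) (use m in \<open>auto elim: eventually_mono\<close>)
    ultimately show ?thesis by simp
  qed
  have mi: "integrable lborel m"
    using integrable_lower_power[OF \<Omega>(2) _ m(1) m(3) m2, of 1] by (simp add: integrable_abs_iff)
  have mb: "integrable lborel (\<lambda>x. m x * b x)"
  proof (rule Bochner_Integration.integrable_bound)
    show "integrable lborel (\<lambda>x. norm (m x) powr 2 + (b x)\<^sup>2)" using m2 b(3) by auto
    show "AE x in lborel. norm (m x * b x) \<le> norm (norm (m x) powr 2 + (b x)\<^sup>2)"
    proof (rule AE_I2)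
      fix x
      have "2 * \<bar>m x\<bar> * \<bar>b x\<bar> \<le> \<bar>m x\<bar>\<^sup>2 + \<bar>b x\<bar>\<^sup>2" by (rule sum_squares_bound)
      moreover have "0 \<le> \<bar>m x\<bar> * \<bar>b x\<bar>" by simp
      ultimately have "\<bar>m x\<bar> * \<bar>b x\<bar> \<le> \<bar>m x\<bar>\<^sup>2 + \<bar>b x\<bar>\<^sup>2" by linarith
      then show "norm (m x * b x) \<le> norm (norm (m x) powr 2 + (b x)\<^sup>2)" by (simp add: abs_mult powr_numeral)
    qed
  qed measurable
  show ?thesis
    unfolding wd_def
  proof (intro conjI ballI mi mb)
    fix \<phi> :: "real^'d \<Rightarrow> real" assume \<phi>: "\<phi> \<in> test_functions \<Omega>"
    note \<phi>i = test_functions_partial[OF \<phi>]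
    obtain C where C: "C \<ge> 0" "\<And>x. \<bar>\<phi> x\<bar> \<le> C" "\<And>x i. \<bar>partial_deriv i \<phi> x\<bar> \<le> C"
      using test_function_bounded[OF \<phi>] by (metis real_norm_def)
    define K where "K = closure {x. \<phi> x \<noteq> 0}"
    have K: "compact K" "K \<subseteq> \<Omega>" using test_functionsD[OF \<phi>] by (auto simp: K_def)
    have off: "\<phi> x = 0" "partial_deriv i \<phi> x = 0" if "x \<notin> K" for x i
      using test_functions_support[OF \<phi>] that unfolding K_def by blast+
    note [measurable] = test_function_measurable[OF \<phi>] test_function_measurable[OF \<phi>i]
    define v where "v x = \<phi> x *\<^sub>R Q x" for x
    define w where "w j x = partial_deriv j \<phi> x *\<^sub>R Q x + \<phi> x *\<^sub>R R j x" for j x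
    have vw: "wd \<Omega> j v (w j)" for j
      unfolding v_def w_def by (rule wd_test_function_scaleR[OF Q(1) \<phi>])
    have [measurable]: "v \<in> borel_measurable borel" "\<And>j. w j \<in> borel_measurable borel" using wdD(3,4)[OF vw] by auto
    have "v \<in> H10 \<Omega>"
    proof (rule H10_compact_support[OF \<Omega>(1) K vw])
      show "v x = 0" "w j x = 0" if "x \<notin> K" for x j using off[OF that] by (simp_all add: v_def w_def)
      show "integrable lborel (\<lambda>x. (norm (v x))\<^sup>2)"
      proof (rule integrable_bounded_compact_support[OF _ K(1)])
        have "norm (v x) \<le> C * B" for x
          using C(1,2) Q(3) by (auto simp: v_def intro!: mult_mono)
        then show "norm ((norm (v x))\<^sup>2) \<le> (C * B)\<^sup>2" for x by (simp add: power_mono)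
      qed (use off in \<open>auto simp: v_def\<close>)
      show "integrable lborel (\<lambda>x. (norm (w j x))\<^sup>2)" for j
      proof (rule Bochner_Integration.integrable_bound)
        have "emeasure lborel \<Omega> < \<infinity>" using emeasure_bounded_finite[OF \<Omega>(2)] by simp
        then show "integrable lborel (\<lambda>x. 3 * ((C * B)\<^sup>2 * indicat_real \<Omega> x + (C * B)\<^sup>2 * (norm (T j x))\<^sup>2))" using T(2) by auto
        show "AE x in lborel. norm ((norm (w j x))\<^sup>2) \<le> norm (3 * ((C * B)\<^sup>2 * indicat_real \<Omega> x + (C * B)\<^sup>2 * (norm (T j x))\<^sup>2))"
        proof (rule AE_I2)
          fix x
          show "norm ((norm (w j x))\<^sup>2) \<le> norm (3 * ((C * B)\<^sup>2 * indicat_real \<Omega> x + (C * B)\<^sup>2 * (norm (T j x))\<^sup>2))"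
          proof (cases "x \<in> K")
            case True
            have 1: "norm (partial_deriv j \<phi> x *\<^sub>R Q x) \<le> C * B" using C Q(3) by (auto intro!: mult_mono)
            have "norm (\<phi> x *\<^sub>R R j x) \<le> C * (B * norm (T j x))" using C Q(4) by (auto intro!: mult_mono)
            then have 2: "norm (\<phi> x *\<^sub>R R j x) \<le> (C * B) * norm (T j x)" by (simp add: mult.assoc)
            have "(norm (w j x))\<^sup>2 \<le> 3 * ((norm (partial_deriv j \<phi> x *\<^sub>R Q x))\<^sup>2 + (norm (\<phi> x *\<^sub>R R j x))\<^sup>2)"
              using norm_three_squares[of "partial_deriv j \<phi> x *\<^sub>R Q x" "\<phi> x *\<^sub>R R j x" 0] by (simp add: w_def)
            also have "\<dots> \<le> 3 * ((C * B)\<^sup>2 + ((C * B) * norm (T j x))\<^sup>2)"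
              using power_mono[OF 1, of 2] power_mono[OF 2, of 2] by simp
            finally show ?thesis using True K(2) by (auto simp: power_mult_distrib)
          qed (simp add: w_def off)
        qed
      qed measurable
    qed
    then have zero: "(LINT x|lebesgue_on \<Omega>. (\<mu> x *\<^sub>R sym_grad \<Omega> u x) \<bullet> sym_grad \<Omega> v x) = 0"
      using sol by (auto simp: stress_solution_def)
    let ?h = "\<lambda>x. partial_deriv k \<phi> x * m x + \<phi> x * (m x * b x)"
    have "(LINT x|lebesgue_on \<Omega>. (\<mu> x *\<^sub>R sym_grad \<Omega> u x) \<bullet> sym_grad \<Omega> v x) = (LBINT x. ?h x)"
    proof (rule integral_lebesgue_on_eq(1)[OF \<Omega>(1)])
      have "AE x in lborel. \<forall>j\<in>UNIV. x \<in> \<Omega> \<longrightarrow> weak_partial \<Omega> j v x = w j x"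
        using weak_partial_AE_eq[OF \<Omega>(1) vw, of v] by (intro AE_finite_allI) auto
      then show "AE x in lborel. x \<in> \<Omega> \<longrightarrow> (\<mu> x *\<^sub>R sym_grad \<Omega> u x) \<bullet> sym_grad \<Omega> v x = ?h x"
        using m(2) Su
      proof eventually_elim
        case (elim x)
        show ?case
        proof
          assume x: "x \<in> \<Omega>"
          have sv: "sym_grad \<Omega> v x = (\<chi> i j. (w j x $ i + w i x $ j) / 2)"
            using elim(1) x by (simp add: sym_grad_def)
          \<comment> \<open>\<open>S Q = axis k 1\<close> leaves only the \<open>k\<close>-th derivative of \<open>\<phi>\<close>.\<close>
          have SQ: "(\<Sum>i\<in>UNIV. S x $ j $ i * Q x $ i) = (if j = k then 1 else 0)" for j
            using arg_cong[OF Q(2)[OF x], of "\<lambda>z. z $ j"] by (auto simp: matrix_vector_mult_def axis_def)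
          have "S x \<bullet> sym_grad \<Omega> v x = (\<Sum>j\<in>UNIV. \<Sum>i\<in>UNIV. S x $ i $ j * w j x $ i)"
            unfolding sv by (rule sym_grad_inner_symmetric[OF sym[OF x]])
          also have "\<dots> = (\<Sum>j\<in>UNIV. partial_deriv j \<phi> x * (\<Sum>i\<in>UNIV. S x $ j $ i * Q x $ i)) +
              \<phi> x * (\<Sum>j\<in>UNIV. \<Sum>i\<in>UNIV. S x $ i $ j * R j x $ i)"
            unfolding w_def sum_distrib_left sum.distrib[symmetric]
            by (intro sum.cong refl) (simp add: sym[OF x] algebra_simps)
          also have "\<dots> = (\<Sum>j\<in>UNIV. partial_deriv j \<phi> x * (if j = k then 1 else 0)) +
              \<phi> x * (\<Sum>j\<in>UNIV. \<Sum>i\<in>UNIV. S x $ i $ j * R j x $ i)"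
            by (simp only: SQ)
          finally have "S x \<bullet> sym_grad \<Omega> v x = partial_deriv k \<phi> x + \<phi> x * b x"
            using b(1)[OF x] by (simp add: if_distrib cong: if_cong)
          then show "(\<mu> x *\<^sub>R sym_grad \<Omega> u x) \<bullet> sym_grad \<Omega> v x = ?h x"
            using elim(2,3) x by (simp add: algebra_simps)
        qed
      qed
    qed (use m(3) in auto)
    also have "\<dots> = (LBINT x. partial_deriv k \<phi> x * m x) + (LBINT x. \<phi> x * (m x * b x))"
    proof (rule Bochner_Integration.integral_add)
      show "integrable lborel (\<lambda>x. partial_deriv k \<phi> x * m x)"
        using integrable_bounded_scaleR[OF mi test_function_measurable[OF \<phi>i] C(3)] by simp
      show "integrable lborel (\<lambda>x. \<phi> x * (m x * b x))"
        using integrable_bounded_scaleR[OF mb test_function_measurable[OF \<phi>] C(2)] by simp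
    qed
    finally show "(LBINT x. partial_deriv k \<phi> x *\<^sub>R m x) = - (LBINT x. \<phi> x *\<^sub>R (m x * b x))"
      using zero by simp
  qed
qed

lemma closed_strain_conditions:
  "closed {A :: real^'d::finite^'d. norm A \<le> C \<and> (\<forall>i j. A $ i $ j = A $ j $ i) \<and> c \<le> \<bar>det A\<bar>}"
  "closed {A :: real^'d::finite^'d. norm A \<le> C \<and> (\<forall>i j. A $ i $ j = A $ j $ i) \<and> c \<le> s * det A}"
proof -
  have "continuous_on UNIV (det :: real^'d^'d \<Rightarrow> real)"
    using C1_det_id C1_with_continuous by (auto simp: C1_def)
  then show "closed {A :: real^'d::finite^'d. norm A \<le> C \<and> (\<forall>i j. A $ i $ j = A $ j $ i) \<and> c \<le> \<bar>det A\<bar>}"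
    "closed {A :: real^'d::finite^'d. norm A \<le> C \<and> (\<forall>i j. A $ i $ j = A $ j $ i) \<and> c \<le> s * det A}"
    by (intro closed_Collect_conj closed_Collect_all closed_Collect_le closed_Collect_eq continuous_intros; simp)+
qed

lemma borel_measurable_component:
  fixes f :: "'c \<Rightarrow> 'a::euclidean_space^'n"
  assumes "f \<in> borel_measurable M"
  shows "(\<lambda>x. f x $ i) \<in> borel_measurable M"
  by (rule measurable_compose[OF assms]) (rule borel_measurable_continuous_onI, intro continuous_intros)

text \<open>For \<open>p = \<infinity>\<close> every finite exponent is admissible, because \<open>U\<close> has finite measure; \<open>d + 1\<close> exceeds
  the dimension.\<close>

lemma Lp_power_integrable:
  fixes f :: "real^'d::finite \<Rightarrow> 'b::euclidean_space"
  assumes U: "open U" "bounded U" and f: "f \<in> Lp U p" and g: "g \<in> borel_measurable borel"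
    "AE x in lborel. x \<in> U \<longrightarrow> f x = g x" "\<And>x. x \<notin> U \<Longrightarrow> g x = 0"
    and q: "q = (if p = \<infinity> then real CARD('d) + 1 else enn2real p)"
  shows "integrable lborel (\<lambda>x. norm (g x) powr q)"
proof (cases "p = \<infinity>")
  case False
  have [measurable]: "g \<in> borel_measurable borel" by fact
  have "integrable (lebesgue_on U) (\<lambda>x. norm (f x) powr q)" using f False q by (simp add: Lp_def)
  moreover have "integrable (lebesgue_on U) (\<lambda>x. norm (f x) powr q) \<longleftrightarrow> integrable lborel (\<lambda>x. norm (g x) powr q)"
    by (rule integral_lebesgue_on_eq(2)[OF U(1)]) (use g in \<open>auto elim: eventually_mono\<close>)
  ultimately show ?thesis by simp
next
  case True
  have [measurable]: "g \<in> borel_measurable borel" "U \<in> sets borel" using g U by auto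
  obtain C where "AE x in lebesgue_on U. norm (f x) \<le> C" using f True by (auto simp: Lp_def)
  then have ae: "AE x in lborel. norm (g x) \<le> \<bar>C\<bar> * indicat_real U x"
    using g(2) unfolding AE_lebesgue_on_iff[OF U(1)] by eventually_elim (use g(3) in \<open>auto simp: indicator_def\<close>)
  show ?thesis
  proof (rule Bochner_Integration.integrable_bound)
    have "emeasure lborel U < \<infinity>" using emeasure_bounded_finite[OF U(2)] by simp
    then show "integrable lborel (\<lambda>x. \<bar>C\<bar> powr q * indicat_real U x)" by auto
    have "q > 0" using q True by simp
    show "AE x in lborel. norm (norm (g x) powr q) \<le> norm (\<bar>C\<bar> powr q * indicat_real U x)"
      using ae
    proof eventually_elim
      case (elim x)
      then show ?case using \<open>q > 0\<close> by (cases "x \<in> U") (auto intro!: powr_mono2)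
    qed
  qed measurable
qed

text \<open>The coefficient is \<open>b k = (\<Sum>i j. S i j * \<partial>\<^sub>j Q i)\<close> with the \<open>k\<close>-th column \<open>Q\<close> of the inverse of \<open>S\<close>.  It is
  bounded by a multiple of the derivatives of \<open>S\<close>, hence belongs to \<open>L\<^sup>p\<close> as they do.\<close>

lemma stress_solution_gradient:
  fixes \<Omega> :: "(real^'d::finite) set" and u :: "real^'d \<Rightarrow> real^'d"
  assumes d2: "CARD('d) \<ge> 2" and \<Omega>: "open \<Omega>" "connected \<Omega>" "bounded \<Omega>" "\<Omega> \<noteq> {}"
    and p: "of_nat CARD('d) < p" and Sp: "sym_grad \<Omega> u \<in> Lp \<Omega> \<infinity> \<inter> W1p \<Omega> p"
    and c: "c > 0" "AE x in lebesgue_on \<Omega>. \<bar>det (sym_grad \<Omega> u x)\<bar> \<ge> c"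
  obtains b q where "real CARD('d) < q" "\<And>k. b k \<in> borel_measurable borel"
    "\<And>k. integrable lborel (\<lambda>x. norm (b k x) powr q)" "\<And>k. b k \<in> Lp \<Omega> p"
    "\<And>\<mu> m k. stress_solution \<Omega> u \<mu> \<Longrightarrow> m \<in> borel_measurable borel \<Longrightarrow> AE x in lborel. x \<in> \<Omega> \<longrightarrow> \<mu> x = m x \<Longrightarrow>
       \<forall>x. x \<notin> \<Omega> \<longrightarrow> m x = 0 \<Longrightarrow> wd \<Omega> k m (\<lambda>x. m x * b k x)"
proof -
  let ?S = "sym_grad \<Omega> u"
  define q where "q = (if p = \<infinity> then real CARD('d) + 1 else enn2real p)"
  have q: "real CARD('d) < q"
  proof (cases "p = \<infinity>")
    case False
    then obtain r where r: "p = ennreal r" "r \<ge> 0" by (cases p) auto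
    then show ?thesis using p by (simp add: q_def ennreal_of_nat_eq_real_of_nat ennreal_less_iff)
  qed (simp add: q_def)
  have q2: "q \<ge> 2" "q \<ge> 0" using q d2 by linarith+
  have \<Omega>m [measurable]: "\<Omega> \<in> sets borel" using \<Omega> by simp
  have fin: "emeasure lborel \<Omega> < \<infinity>" using emeasure_bounded_finite[OF \<Omega>(3)] by simp
  obtain C where C: "AE x in lborel. x \<in> \<Omega> \<longrightarrow> norm (?S x) \<le> C"
    using Sp by (auto simp: Lp_def AE_lebesgue_on_iff[OF \<Omega>(1)])
  have "\<forall>j. \<exists>g\<in>Lp \<Omega> p. has_weak_partial \<Omega> j ?S g" using Sp by (auto simp: W1p_def)
  then have "\<forall>j. \<exists>g. g \<in> Lp \<Omega> p \<and> has_weak_partial \<Omega> j ?S g" by blast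
  from choice[OF this] obtain G where "\<forall>j. G j \<in> Lp \<Omega> p \<and> has_weak_partial \<Omega> j ?S (G j)" ..
  then have G: "G j \<in> Lp \<Omega> p" "has_weak_partial \<Omega> j ?S (G j)" for j by simp_all
  obtain S1 where S1: "S1 \<in> borel_measurable borel" "AE x in lborel. x \<in> \<Omega> \<longrightarrow> ?S x = S1 x" "\<And>x. x \<notin> \<Omega> \<Longrightarrow> S1 x = 0"
  proof -
    have m: "?S \<in> borel_measurable (lebesgue_on \<Omega>)" using Sp by (simp add: Lp_def)
    show thesis by (rule borel_representative[OF \<Omega>(1) m]) (rule that)
  qed
  have "\<exists>t. t \<in> borel_measurable borel \<and> (AE x in lborel. x \<in> \<Omega> \<longrightarrow> G j x = t x) \<and> (\<forall>x. x \<notin> \<Omega> \<longrightarrow> t x = 0)" for j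
  proof -
    have m: "G j \<in> borel_measurable (lebesgue_on \<Omega>)" using G(1)[of j] by (simp add: Lp_def)
    show ?thesis by (rule borel_representative[OF \<Omega>(1) m]) blast
  qed
  then have "\<forall>j. \<exists>t. t \<in> borel_measurable borel \<and> (AE x in lborel. x \<in> \<Omega> \<longrightarrow> G j x = t x) \<and> (\<forall>x. x \<notin> \<Omega> \<longrightarrow> t x = 0)" ..
  from choice[OF this] obtain T where
    T': "\<forall>j. T j \<in> borel_measurable borel \<and> (AE x in lborel. x \<in> \<Omega> \<longrightarrow> G j x = T j x) \<and> (\<forall>x. x \<notin> \<Omega> \<longrightarrow> T j x = 0)" ..
  then have T: "T j \<in> borel_measurable borel" "AE x in lborel. x \<in> \<Omega> \<longrightarrow> G j x = T j x"
    "x \<notin> \<Omega> \<Longrightarrow> T j x = 0" for j x by simp_all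
  note [measurable] = S1(1) T(1)
  have Tq: "integrable lborel (\<lambda>x. norm (T j x) powr q)" for j
    by (rule Lp_power_integrable[OF \<Omega>(1,3) G(1) T(1) T(2) T(3) q_def])
  have T1: "integrable lborel (T j)" for j
    using integrable_lower_power[OF \<Omega>(3) \<Omega>m T(1) T(3) Tq, of 1] q2 by (simp add: integrable_norm_iff)
  have T2: "integrable lborel (\<lambda>x. (norm (T j x))\<^sup>2)" for j
    using integrable_lower_power[OF \<Omega>(3) \<Omega>m T(1) T(3) Tq, of 2] q2 by (simp add: powr_numeral)
  have S1i: "integrable lborel S1"
  proof (rule Bochner_Integration.integrable_bound)
    show "integrable lborel (\<lambda>x. \<bar>C\<bar> * indicat_real \<Omega> x)" using fin by auto
    show "AE x in lborel. norm (S1 x) \<le> norm (\<bar>C\<bar> * indicat_real \<Omega> x)"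
      using C S1(2) by eventually_elim (use S1(3) in \<open>auto simp: indicator_def\<close>)
  qed measurable
  have wd1: "wd \<Omega> j S1 (T j)" for j
    by (rule has_weak_partial_iff_wd[OF \<Omega>(1) S1i T1 S1(2) T(2), THEN iffD1]) (rule G(2))
  \<comment> \<open>The bounds and the symmetry are made to hold at every point of the domain.\<close>
  let ?P = "\<lambda>A::real^'d^'d. norm A \<le> C \<and> (\<forall>i j. A $ i $ j = A $ j $ i) \<and> c \<le> \<bar>det A\<bar>"
  have P1: "AE x in lborel. x \<in> \<Omega> \<longrightarrow> ?P (S1 x)"
    using C S1(2) c(2)[unfolded AE_lebesgue_on_iff[OF \<Omega>(1)]]
  proof eventually_elim
    case (elim x)
    have "?S x $ i $ j = ?S x $ j $ i" for i j by (simp add: sym_grad_def add.commute)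
    then show ?case using elim by auto
  qed
  obtain y0 where y0: "?P y0" by (rule AE_point_in_open[OF \<Omega>(1,4) P1]) (rule that)
  obtain S2 where S2: "\<And>j. wd \<Omega> j S2 (T j)" "\<And>x. x \<in> \<Omega> \<Longrightarrow> ?P (S2 x)" "AE x in lborel. S1 x = S2 x"
    by (rule wd_modify[OF \<Omega>m wd1 borel_closed[OF closed_strain_conditions(1)] y0 P1]) (rule that)
  obtain s where s: "s \<in> {1, -1}" "AE x in lborel. x \<in> \<Omega> \<longrightarrow> s * det (S2 x) \<ge> c"
  proof (rule det_constant_sign[OF \<Omega>(1,3,2) S2(1) _ c(1) _ q Tq])
    show "norm (S2 x) \<le> C" "c \<le> \<bar>det (S2 x)\<bar>" if "x \<in> \<Omega>" for x using S2(2)[OF that] by auto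
  qed (rule that)
  let ?P' = "\<lambda>A::real^'d^'d. norm A \<le> C \<and> (\<forall>i j. A $ i $ j = A $ j $ i) \<and> c \<le> s * det A"
  have P2: "AE x in lborel. x \<in> \<Omega> \<longrightarrow> ?P' (S2 x)" using s(2) by eventually_elim (use S2(2) in auto)
  obtain y1 where y1: "?P' y1" by (rule AE_point_in_open[OF \<Omega>(1,4) P2]) (rule that)
  obtain S where S: "\<And>j. wd \<Omega> j S (T j)" "\<And>x. x \<in> \<Omega> \<Longrightarrow> ?P' (S x)" "AE x in lborel. S2 x = S x"
    by (rule wd_modify[OF \<Omega>m S2(1) borel_closed[OF closed_strain_conditions(2)] y1 P2]) (rule that)
  have SS: "AE x in lborel. x \<in> \<Omega> \<longrightarrow> ?S x = S x" using S1(2) S2(3) S(3) by eventually_elim auto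
  have C0: "C \<ge> 0" using y0 norm_ge_zero[of y0] by linarith
  have "\<exists>Q R B. (\<forall>j. wd \<Omega> j Q (R j)) \<and> (\<forall>x. x \<in> \<Omega> \<longrightarrow> S x *v Q x = axis k 1) \<and>
    B \<ge> 0 \<and> (\<forall>x. norm (Q x) \<le> B) \<and> (\<forall>j x. norm (R j x) \<le> B * norm (T j x))" for k
  proof (rule inverse_columns_weakly_differentiable[OF \<Omega>(1,3) S(1) _ s(1) c(1)])
    show "norm (S x) \<le> C" "c \<le> s * det (S x)" if "x \<in> \<Omega>" for x using S(2)[OF that] by auto
  qed blast
  then have "\<forall>k. \<exists>Q R B. (\<forall>j. wd \<Omega> j Q (R j)) \<and> (\<forall>x. x \<in> \<Omega> \<longrightarrow> S x *v Q x = axis k 1) \<and>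
    B \<ge> 0 \<and> (\<forall>x. norm (Q x) \<le> B) \<and> (\<forall>j x. norm (R j x) \<le> B * norm (T j x))" ..
  then obtain Q R B where "\<forall>k. (\<forall>j. wd \<Omega> j (Q k) (R k j)) \<and> (\<forall>x. x \<in> \<Omega> \<longrightarrow> S x *v Q k x = axis k 1) \<and>
    B k \<ge> 0 \<and> (\<forall>x. norm (Q k x) \<le> B k) \<and> (\<forall>j x. norm (R k j x) \<le> B k * norm (T j x))"
    unfolding choice_iff by (elim exE) (rule that)
  then have Q: "wd \<Omega> j (Q k) (R k j)" "x \<in> \<Omega> \<Longrightarrow> S x *v Q k x = axis k 1"
    "B k \<ge> 0" "norm (Q k x) \<le> B k" "norm (R k j x) \<le> B k * norm (T j x)" for k j x by simp_all
  define b where "b k x = indicat_real \<Omega> x * (\<Sum>j\<in>UNIV. \<Sum>i\<in>UNIV. S x $ i $ j * R k j x $ i)" for k x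
  have [measurable]: "S \<in> borel_measurable borel" "\<And>k j. R k j \<in> borel_measurable borel" using wdD(3,4)[OF S(1)] wdD(4)[OF Q(1)] by auto
  have bm [measurable]: "b k \<in> borel_measurable borel" for k
    unfolding b_def by (intro borel_measurable_times borel_measurable_sum borel_measurable_indicator borel_measurable_component) measurable
  have b0: "b k x = 0" if "x \<notin> \<Omega>" for k x using that by (simp add: b_def)
  let ?D = "\<lambda>k. real CARD('d) * (C * B k)"
  have b_bound: "norm (b k x) \<le> ?D k * norm (\<Sum>j\<in>UNIV. norm (T j x))" for k x
  proof (cases "x \<in> \<Omega>")
    case True
    have "norm (b k x) \<le> (\<Sum>j\<in>UNIV. \<Sum>i\<in>UNIV. \<bar>S x $ i $ j\<bar> * \<bar>R k j x $ i\<bar>)"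
      using True by (simp add: b_def flip: abs_mult) (intro order_trans[OF sum_abs] sum_mono order_refl)
    also have "\<dots> \<le> (\<Sum>j\<in>UNIV. \<Sum>i\<in>(UNIV::'d set). C * (B k * norm (T j x)))"
    proof (intro sum_mono mult_mono)
      fix i j
      show "\<bar>S x $ i $ j\<bar> \<le> C"
        using component_le_norm_cart[of "S x $ i" j] Finite_Cartesian_Product.norm_nth_le[of "S x" i] S(2)[OF True] by linarith
      show "\<bar>R k j x $ i\<bar> \<le> B k * norm (T j x)"
        using component_le_norm_cart[of "R k j x" i] Q(5)[of k j x] by linarith
    qed (use C0 in auto)
    also have "\<dots> = ?D k * norm (\<Sum>j\<in>UNIV. norm (T j x))"
      by (simp add: sum_nonneg sum_distrib_left algebra_simps)
    finally show ?thesis .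
  qed (use Q(3) C0 in \<open>auto simp: b_def\<close>)
  have D0: "?D k \<ge> 0" for k using Q(3) C0 by simp
  have bq: "integrable lborel (\<lambda>x. norm (b k x) powr q)" for k
    by (rule power_integrable_bound[OF sum_norm_power_integrable[OF Tq T(1) q2(2)] bm b_bound D0 q2(2)])
  have b2: "integrable lborel (\<lambda>x. (b k x)\<^sup>2)" for k
    using integrable_lower_power[OF \<Omega>(3) \<Omega>m bm _ bq, of k 2] q2 by (simp add: powr_numeral b_def)
  have bLp: "b k \<in> Lp \<Omega> p" for k
  proof -
    have m: "b k \<in> borel_measurable (lebesgue_on \<Omega>)"
      by (rule lebesgue_on_measurable_AE_cong[OF \<Omega>(1) bm[of k]]) simp
    show ?thesis
    proof (cases "p = \<infinity>")
      case True
      have "\<forall>j. \<exists>A. AE x in lborel. x \<in> \<Omega> \<longrightarrow> norm (G j x) \<le> A"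
        using G(1) True by (auto simp: Lp_def AE_lebesgue_on_iff[OF \<Omega>(1)])
      then obtain A where A: "\<And>j. AE x in lborel. x \<in> \<Omega> \<longrightarrow> norm (G j x) \<le> A j" by metis
      have "AE x in lborel. \<forall>j\<in>UNIV. x \<in> \<Omega> \<longrightarrow> norm (T j x) \<le> A j"
      proof (rule AE_finite_allI)
        show "AE x in lborel. x \<in> \<Omega> \<longrightarrow> norm (T j x) \<le> A j" for j
          using A[of j] T(2)[of j] by eventually_elim auto
      qed simp
      then have "AE x in lborel. x \<in> \<Omega> \<longrightarrow> norm (b k x) \<le> ?D k * (\<Sum>j\<in>UNIV. A j)"
      proof eventually_elim
        case (elim x)
        show ?case
        proof
          assume "x \<in> \<Omega>"
          then have "norm (\<Sum>j\<in>UNIV. norm (T j x)) \<le> (\<Sum>j\<in>UNIV. A j)"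
            using elim by (simp add: sum_nonneg sum_mono)
          then show "norm (b k x) \<le> ?D k * (\<Sum>j\<in>UNIV. A j)"
            using b_bound[of k x] D0[of k] by (meson mult_left_mono order_trans)
        qed
      qed
      then show ?thesis using m True by (auto simp: Lp_def AE_lebesgue_on_iff[OF \<Omega>(1)])
    next
      case False
      have "integrable (lebesgue_on \<Omega>) (\<lambda>x. norm (b k x) powr q) \<longleftrightarrow> integrable lborel (\<lambda>x. norm (b k x) powr q)"
        by (rule integral_lebesgue_on_eq(2)[OF \<Omega>(1)]) (use b0 in auto)
      then show ?thesis using bq m False by (simp add: Lp_def q_def)
    qed
  qed
  show ?thesis
  proof (rule that[OF q bm bq bLp])
    fix \<mu> m k assume sol: "stress_solution \<Omega> u \<mu>" and m: "m \<in> borel_measurable borel"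
      "AE x in lborel. x \<in> \<Omega> \<longrightarrow> \<mu> x = m x" "\<forall>x. x \<notin> \<Omega> \<longrightarrow> m x = 0"
    show "wd \<Omega> k m (\<lambda>x. m x * b k x)"
      by (rule wd_stress_solution[OF \<Omega>(1,3) sol m(1,2) _ SS _ Q(1,2,4,5,3) T(1) T2 _ bm b2])
        (use S(2) m(3) in \<open>auto simp: b_def\<close>)
  qed
qed

section \<open>Harnack's inequality and the zero set\<close>

lemma volume_growth_dominated:
  fixes g :: "real^'d::finite \<Rightarrow> 'b::euclidean_space" and g' :: "real^'d \<Rightarrow> 'c::euclidean_space"
  assumes vg: "volume_growth q M g" and g [measurable]: "g \<in> borel_measurable borel" and L: "L \<ge> 0"
    and le: "AE x in lborel. norm (g' x) \<le> L * norm (g x)"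
  shows "volume_growth q (L * M) g'"
  unfolding volume_growth_def
proof (intro ballI impI)
  fix A :: "(real^'d) set" assume A [measurable]: "A \<in> sets borel" and fin: "emeasure lborel A < \<infinity>"
  have "(\<integral>\<^sup>+z. indicator A z * ennreal (norm (g' z)) \<partial>lborel) \<le> (\<integral>\<^sup>+z. ennreal L * (indicator A z * ennreal (norm (g z))) \<partial>lborel)"
  proof (rule nn_integral_mono_AE)
    show "AE z in lborel. indicator A z * ennreal (norm (g' z)) \<le> ennreal L * (indicator A z * ennreal (norm (g z)))"
      using le by eventually_elim (use L in \<open>auto simp: indicator_def simp flip: ennreal_mult intro!: ennreal_leI\<close>)
  qed
  also have "\<dots> = ennreal L * (\<integral>\<^sup>+z. indicator A z * ennreal (norm (g z)) \<partial>lborel)"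
    by (rule nn_integral_cmult) measurable
  also have "\<dots> \<le> ennreal L * ennreal (M * measure lborel A powr (1 - 1/q))"
    using vg A fin unfolding volume_growth_def by (intro mult_left_mono) auto
  also have "\<dots> = ennreal (L * M * measure lborel A powr (1 - 1/q))"
    using L by (simp add: ennreal_mult' mult.assoc)
  finally show "(\<integral>\<^sup>+z. indicator A z * ennreal (norm (g' z)) \<partial>lborel) \<le> ennreal (L * M * measure lborel A powr (1 - 1/q))" .
qed

text \<open>The functions \<open>ln (m\<^sup>2 + e) / 2\<close> have the gradients \<open>m\<^sup>2 b / (m\<^sup>2 + e)\<close>, which are bounded by
  \<open>\<bar>b\<bar>\<close> uniformly in \<open>e\<close>.  Morrey's estimate bounds the oscillation of these functions, that is, the
  quotients of the values of \<open>m\<^sup>2 + e\<close>.\<close>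

lemma harnack:
  fixes m :: "real^'d::finite \<Rightarrow> real"
  assumes \<Omega>: "open \<Omega>" "bounded \<Omega>" and mb: "\<And>k. wd \<Omega> k m (\<lambda>x. m x * b k x)"
    and bm: "\<And>k. b k \<in> borel_measurable borel" and q: "real CARD('d) < q" and M: "M \<ge> 0"
    and vg: "\<And>k. volume_growth q M (b k)"
  obtains N where "N \<in> null_sets lborel"
    "\<And>K x y. compact K \<Longrightarrow> convex K \<Longrightarrow> K \<subseteq> \<Omega> \<Longrightarrow> measure lborel K > 0 \<Longrightarrow> x \<in> K - N \<Longrightarrow> y \<in> K - N \<Longrightarrow>
      \<bar>m x\<bar> \<le> exp (morrey q M K) * \<bar>m y\<bar>"
proof -
  define e where "e n = inverse (real (Suc n))" for n
  have e: "e n > 0" for n by (simp add: e_def)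
  define F where "F n t = ln (t\<^sup>2 + e n) / 2" for n t
  have pos: "t\<^sup>2 + e n > 0" for n t using e by (simp add: add_nonneg_pos)
  have FD: "(F n has_derivative (\<lambda>h. t / (t\<^sup>2 + e n) * h)) (at t)" for n t
  proof -
    have "(F n has_real_derivative t / (t\<^sup>2 + e n)) (at t)"
    proof -
      have "((\<lambda>t. t\<^sup>2 + e n) has_real_derivative 2 * t) (at t)"
        by (auto intro!: derivative_eq_intros)
      from DERIV_chain2[OF DERIV_ln_divide[OF pos[of t n]] this]
      have "((\<lambda>t. ln (t\<^sup>2 + e n) / 2) has_real_derivative (1 / (t\<^sup>2 + e n) * (2 * t)) / 2) (at t)"
        by (rule DERIV_cdivide)
      moreover have "1 / p * (2 * t) / 2 = t / p" for p :: real by simp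
      ultimately show ?thesis unfolding F_def[abs_def] by (simp only:)
    qed
    then show ?thesis by (simp only: has_field_derivative_def)
  qed
  have "\<exists>N. N \<in> null_sets lborel \<and> (\<forall>K x y. compact K \<longrightarrow> convex K \<longrightarrow> K \<subseteq> \<Omega> \<longrightarrow> measure lborel K > 0 \<longrightarrow>
     x \<in> K - N \<longrightarrow> y \<in> K - N \<longrightarrow> \<bar>F n (m x) - F n (m y)\<bar> \<le> morrey q M K)" for n
  proof -
    define f where "f x = indicat_real \<Omega> x *\<^sub>R F n (m x)" for x
    define g where "g k x = indicat_real \<Omega> x *\<^sub>R (m x / ((m x)\<^sup>2 + e n) * (m x * b k x))" for k x
    have wd: "wd \<Omega> k f (g k)" for k
      unfolding f_def g_def
    proof (rule wd_chain[OF \<Omega> mb, where I=UNIV and B="1 + 1 / e n"])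
      show "(F n has_derivative (*) (t / (t\<^sup>2 + e n))) (at t)" for t by (rule FD)
      show "continuous_on UNIV (\<lambda>t. t / (t\<^sup>2 + e n) * h)" for h
        using pos by (intro continuous_intros) (auto simp: less_imp_neq[symmetric])
      show "norm (t / (t\<^sup>2 + e n) * h) \<le> (1 + 1 / e n) * norm h" for t h
      proof -
        have "\<bar>t / (t\<^sup>2 + e n)\<bar> \<le> 1 + 1 / e n"
        proof (cases "\<bar>t\<bar> \<le> 1")
          case True
          have "\<bar>t\<bar> / (t\<^sup>2 + e n) \<le> 1 / e n"
            using True e[of n] pos[of t n] by (intro frac_le) auto
          then show ?thesis using pos[of t n] by (simp add: abs_divide)
        next
          case False
          then have "\<bar>t\<bar> * 1 \<le> \<bar>t\<bar> * \<bar>t\<bar>" by (intro mult_left_mono) auto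
          then have "\<bar>t\<bar> \<le> t\<^sup>2 + e n" using e[of n] by (simp add: power2_eq_square)
          then have "\<bar>t\<bar> / (t\<^sup>2 + e n) \<le> 1" using pos[of t n] by simp
          then show ?thesis using pos[of t n] e[of n] by (simp add: abs_divide add_increasing2)
        qed
        then have "\<bar>t / (t\<^sup>2 + e n)\<bar> * \<bar>h\<bar> \<le> (1 + 1 / e n) * \<bar>h\<bar>" by (intro mult_right_mono) auto
        then show ?thesis by (simp only: real_norm_def abs_mult)
      qed
      show "F n \<in> borel_measurable borel" unfolding F_def by measurable
    qed auto
    have gb: "norm (g k x) \<le> 1 * norm (b k x)" for k x
    proof -
      have "(m x)\<^sup>2 / ((m x)\<^sup>2 + e n) \<le> 1" using pos[of "m x" n] e[of n] by simp
      moreover have "0 \<le> (m x)\<^sup>2 / ((m x)\<^sup>2 + e n)" using pos[of "m x" n] by simp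
      ultimately have "(m x)\<^sup>2 / ((m x)\<^sup>2 + e n) * \<bar>b k x\<bar> \<le> 1 * \<bar>b k x\<bar>" by (intro mult_right_mono) auto
      moreover have "\<bar>m x / ((m x)\<^sup>2 + e n) * (m x * b k x)\<bar> = (m x)\<^sup>2 / ((m x)\<^sup>2 + e n) * \<bar>b k x\<bar>"
        using pos[of "m x" n] by (simp add: abs_mult abs_divide power2_eq_square)
      ultimately show ?thesis by (cases "x \<in> \<Omega>") (simp_all add: g_def)
    qed
    have vg': "volume_growth q M (g k)" for k
      using volume_growth_dominated[OF vg bm, of 1 "g k" k] gb by simp
    obtain N where N: "N \<in> null_sets lborel"
      "\<And>K x y. compact K \<Longrightarrow> convex K \<Longrightarrow> K \<subseteq> \<Omega> \<Longrightarrow> measure lborel K > 0 \<Longrightarrow> x \<in> K - N \<Longrightarrow> y \<in> K - N \<Longrightarrow>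
        \<bar>f x - f y\<bar> \<le> morrey q M K"
      by (rule morrey_wd[OF \<Omega>(1) wd q M vg']) (rule that)
    have "\<bar>F n (m x) - F n (m y)\<bar> \<le> morrey q M K"
      if "compact K" "convex K" "K \<subseteq> \<Omega>" "measure lborel K > 0" "x \<in> K - N" "y \<in> K - N" for K x y
    proof -
      have "x \<in> \<Omega>" "y \<in> \<Omega>" using that by auto
      then show ?thesis using N(2)[OF that] by (simp add: f_def)
    qed
    with N(1) show ?thesis by blast
  qed
  then have "\<forall>n. \<exists>N. N \<in> null_sets lborel \<and> (\<forall>K x y. compact K \<longrightarrow> convex K \<longrightarrow> K \<subseteq> \<Omega> \<longrightarrow> measure lborel K > 0 \<longrightarrow>
     x \<in> K - N \<longrightarrow> y \<in> K - N \<longrightarrow> \<bar>F n (m x) - F n (m y)\<bar> \<le> morrey q M K)" ..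
  from choice[OF this] obtain N where N: "\<forall>n. N n \<in> null_sets lborel \<and> (\<forall>K x y. compact K \<longrightarrow> convex K \<longrightarrow> K \<subseteq> \<Omega> \<longrightarrow> measure lborel K > 0 \<longrightarrow>
     x \<in> K - N n \<longrightarrow> y \<in> K - N n \<longrightarrow> \<bar>F n (m x) - F n (m y)\<bar> \<le> morrey q M K)" ..
  show ?thesis
  proof (rule that[of "\<Union>n. N n"])
    show "(\<Union>n. N n) \<in> null_sets lborel" using N by (intro null_sets_UN) simp
    fix K x y assume K: "compact K" "convex K" "K \<subseteq> \<Omega>" "measure lborel K > 0" and x: "x \<in> K - (\<Union>n. N n)" and y: "y \<in> K - (\<Union>n. N n)"
    let ?c = "morrey q M K"
    have est: "(m x)\<^sup>2 + e n \<le> exp (2 * ?c) * ((m y)\<^sup>2 + e n)" for n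
    proof -
      have "\<bar>F n (m x) - F n (m y)\<bar> \<le> ?c"
        using N[THEN spec, THEN conjunct2, rule_format, of K x n y] K x y by simp
      then have "ln ((m x)\<^sup>2 + e n) \<le> 2 * ?c + ln ((m y)\<^sup>2 + e n)" by (simp add: F_def abs_le_iff)
      then have "exp (ln ((m x)\<^sup>2 + e n)) \<le> exp (2 * ?c + ln ((m y)\<^sup>2 + e n))" by simp
      then show ?thesis using pos[of "m x" n] pos[of "m y" n] by (simp add: exp_add)
    qed
    have e0: "e \<longlonglongrightarrow> 0" unfolding e_def by (rule LIMSEQ_inverse_real_of_nat)
    have "(m x)\<^sup>2 + 0 \<le> exp (2 * ?c) * ((m y)\<^sup>2 + 0)"
    proof (rule tendsto_le)
      show "(\<lambda>n. exp (2 * ?c) * ((m y)\<^sup>2 + e n)) \<longlonglongrightarrow> exp (2 * ?c) * ((m y)\<^sup>2 + 0)"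
        by (intro tendsto_intros e0)
      show "(\<lambda>n. (m x)\<^sup>2 + e n) \<longlonglongrightarrow> (m x)\<^sup>2 + 0" by (intro tendsto_intros e0)
    qed (use est in auto)
    also have "\<dots> = (exp ?c * m y)\<^sup>2" by (simp add: power_mult_distrib exp_double)
    finally have "\<bar>m x\<bar> \<le> \<bar>exp ?c * m y\<bar>" by (simp add: abs_le_square_iff)
    then show "\<bar>m x\<bar> \<le> exp ?c * \<bar>m y\<bar>" by (simp add: abs_mult)
  qed
qed

text \<open>Harnack's inequality makes \<open>m\<close> locally bounded.  Hence its gradient \<open>m b\<close> is locally in \<open>L\<^sup>q\<close>
  and \<open>m\<close> is continuous; its zero set is open by Harnack's inequality and closed by continuity.\<close>

lemma zero_or_nowhere_zero:
  fixes m :: "real^'d::finite \<Rightarrow> real"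
  assumes \<Omega>: "open \<Omega>" "bounded \<Omega>" "connected \<Omega>" and mb: "\<And>k. wd \<Omega> k m (\<lambda>x. m x * b k x)"
    and bm: "\<And>k. b k \<in> borel_measurable borel" and q: "real CARD('d) < q" and M: "M \<ge> 0"
    and vg: "\<And>k. volume_growth q M (b k)"
  obtains h where "continuous_on \<Omega> h" "AE x in lborel. x \<in> \<Omega> \<longrightarrow> m x = h x"
    "(\<forall>x\<in>\<Omega>. h x = 0) \<or> (\<forall>x\<in>\<Omega>. h x \<noteq> 0)"
proof -
  obtain N where N: "N \<in> null_sets lborel"
    and harn: "\<And>K x y. compact K \<Longrightarrow> convex K \<Longrightarrow> K \<subseteq> \<Omega> \<Longrightarrow> measure lborel K > 0 \<Longrightarrow> x \<in> K - N \<Longrightarrow> y \<in> K - N \<Longrightarrow>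
      \<bar>m x\<bar> \<le> exp (morrey q M K) * \<bar>m y\<bar>"
    by (rule harnack[OF \<Omega>(1,2) mb bm q M vg]) (rule that)
  have aeN: "AE x in lborel. x \<notin> N" by (rule AE_not_in[OF N])
  have Nm [measurable]: "N \<in> sets borel" using N by (auto dest: null_setsD2)
  have mm [measurable]: "m \<in> borel_measurable borel" using wdD(3)[OF mb] .
  note [measurable] = bm
  have mbi: "integrable lborel (\<lambda>x. m x * b k x)" for k using wdD(2)[OF mb] .
  have meas_pos: "measure lborel (cball x r) > 0" if "r > 0" for x :: "real^'d" and r
    using that by (simp add: content_cball_gt_0_iff)
  have loc: "\<exists>r>0. \<exists>h. continuous_on (ball x r) h \<and> (AE y in lborel. y \<in> ball x r \<longrightarrow> m y = h y)" if x: "x \<in> \<Omega>" for x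
  proof -
    obtain r where r: "r > 0" "cball x r \<subseteq> \<Omega>" using \<Omega>(1) x by (meson open_contains_cball)
    have V: "ball x r \<subseteq> \<Omega>" by (rule order_trans[OF ball_subset_cball r(2)])
    have ne: "ball x r \<noteq> {}" using r(1) by simp
    have "AE y in lborel. y \<in> ball x r \<longrightarrow> y \<notin> N" using aeN by eventually_elim simp
    then obtain y where y: "y \<in> ball x r" "y \<notin> N" by (rule AE_point_in_open[OF open_ball ne])
    define L where "L = exp (morrey q M (cball x r)) * \<bar>m y\<bar>"
    have L0: "L \<ge> 0" by (simp add: L_def)
    have L: "\<bar>m z\<bar> \<le> L" if "z \<in> ball x r" "z \<notin> N" for z
      unfolding L_def using that y r ball_subset_cball[of x r]
      by (intro harn[OF compact_cball convex_cball r(2) meas_pos[OF r(1)]]) auto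
    define g where "g k z = indicat_real (ball x r - N) z *\<^sub>R (m z * b k z)" for k z
    have gi: "integrable lborel (g k)" for k
      unfolding g_def using mbi by (intro integrable_mult_indicator) auto
    have wdV: "wd (ball x r) k m (g k)" for k
    proof (rule wd_cong[OF wd_subset[OF mb V] wdD(1)[OF mb] gi])
      show "AE z in lborel. z \<in> ball x r \<longrightarrow> m z * b k z = g k z"
        using aeN by eventually_elim (simp add: g_def)
    qed simp
    have "norm (g k z) \<le> L * norm (b k z)" for k z
      using L[of z] L0 by (auto simp: g_def indicator_def abs_mult intro!: mult_right_mono)
    then have vgL: "volume_growth q (L * M) (g k)" for k
      by (intro volume_growth_dominated[OF vg bm L0]) auto
    have LM: "L * M \<ge> 0" using L0 M by simp
    obtain h where "continuous_on (ball x r) h" "AE y in lborel. y \<in> ball x r \<longrightarrow> m y = h y"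
      by (rule wd_continuous_representative[OF open_ball wdV q LM vgL]) (rule that)
    then show ?thesis using r(1) by blast
  qed
  obtain h where h: "continuous_on \<Omega> h" "AE y in lborel. y \<in> \<Omega> \<longrightarrow> m y = h y"
    by (rule continuous_representative_glue[where U=\<Omega> and f=m, OF loc]) (assumption, erule (1) that)
  define Z where "Z = {x \<in> \<Omega>. h x = 0}"
  have "open Z"
    unfolding open_contains_ball
  proof
    fix x assume "x \<in> Z"
    then have x: "x \<in> \<Omega>" "h x = 0" by (auto simp: Z_def)
    obtain r where r: "r > 0" "cball x r \<subseteq> \<Omega>" using \<Omega>(1) x by (meson open_contains_cball)
    have V: "ball x r \<subseteq> \<Omega>" by (rule order_trans[OF ball_subset_cball r(2)])
    let ?c = "exp (morrey q M (cball x r))"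
    have hV: "continuous_on (ball x r) h" by (rule continuous_on_subset[OF h(1) V])
    have "AE y in lborel. y \<in> ball x r \<longrightarrow> h y = 0"
      using aeN h(2)
    proof eventually_elim
      case (elim y)
      show ?case
      proof (rule impI, rule ccontr)
        assume y: "y \<in> ball x r" and hy: "h y \<noteq> 0"
        \<comment> \<open>Near the zero \<open>x\<close> of \<open>h\<close> there are points at which \<open>h\<close> is too small for Harnack's inequality.\<close>
        let ?W = "ball x r \<inter> (\<lambda>z. \<bar>h z\<bar>) -` {..<\<bar>h y\<bar> / ?c}"
        have "continuous_on (ball x r) (\<lambda>z. \<bar>h z\<bar>)" using hV by (intro continuous_intros)
        then have "open ?W" by (simp add: continuous_on_open_vimage Int_commute)
        moreover have "x \<in> ?W" using r(1) x(2) hy by simp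
        then have "?W \<noteq> {}" by blast
        moreover have "AE z in lborel. z \<in> ?W \<longrightarrow> z \<notin> N \<and> m z = h z"
          using aeN h(2) by eventually_elim (use V in auto)
        ultimately obtain z where z: "z \<in> ?W" "z \<notin> N \<and> m z = h z" by (rule AE_point_in_open)
        have "\<bar>m y\<bar> \<le> ?c * \<bar>m z\<bar>"
          using y z elim(1) ball_subset_cball[of x r]
          by (intro harn[OF compact_cball convex_cball r(2) meas_pos[OF r(1)]]) auto
        moreover have "m y = h y" using elim(2) y V by auto
        ultimately have "\<bar>h y\<bar> \<le> ?c * \<bar>h z\<bar>" using z(2) by simp
        also have "?c * \<bar>h z\<bar> < ?c * (\<bar>h y\<bar> / ?c)" using z(1) by (intro mult_strict_left_mono) auto
        finally show False by simp
      qed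
    qed
    then have "h y = 0" if "y \<in> ball x r" for y
      using continuous_AE_eq_imp_eq[OF open_ball hV continuous_on_const, of 0 y] that by simp
    then show "\<exists>r>0. ball x r \<subseteq> Z" using r(1) V by (intro exI[of _ r]) (auto simp: Z_def)
  qed
  moreover have "open (\<Omega> \<inter> h -` (- {0}))"
    using h(1) \<Omega>(1) by (simp add: continuous_on_open_vimage Int_commute open_Compl)
  ultimately have "Z \<inter> \<Omega> = {} \<or> (\<Omega> \<inter> h -` (- {0})) \<inter> \<Omega> = {}"
    by (rule connectedD[OF \<Omega>(3)]) (auto simp: Z_def)
  then have "(\<forall>x\<in>\<Omega>. h x = 0) \<or> (\<forall>x\<in>\<Omega>. h x \<noteq> 0)" by (auto simp: Z_def)
  with h show ?thesis using that by blast
qed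

section \<open>Lipschitz domains\<close>

text \<open>The volume is positive because the cone contains a ball around \<open>(h / 2) *\<^sub>R n\<close>.\<close>

lemma truncated_cone:
  fixes n :: "'a::euclidean_space"
  assumes n: "norm n = 1" and L: "L \<ge> 0" and h: "h > 0"
  defines "K \<equiv> {z. norm z \<le> h \<and> L * norm (z - (z \<bullet> n) *\<^sub>R n) \<le> z \<bullet> n}"
  shows "compact K" "convex K" "0 \<in> K" "measure lborel K > 0"
proof -
  have cl: "closed {z. L * norm (z - (z \<bullet> n) *\<^sub>R n) \<le> z \<bullet> n}"
    by (intro closed_Collect_le continuous_intros)
  have "K = cball 0 h \<inter> {z. L * norm (z - (z \<bullet> n) *\<^sub>R n) \<le> z \<bullet> n}" by (auto simp: K_def)
  then show cK: "compact K" using cl by (simp add: compact_Int_closed)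
  show "0 \<in> K" using h by (simp add: K_def)
  have nn: "n \<bullet> n = 1" using n by (simp add: dot_square_norm)
  show "convex K"
  proof (rule convexI)
    fix x y u v assume xy: "x \<in> K" "y \<in> K" and uv: "(0::real) \<le> u" "0 \<le> v" "u + v = 1"
    let ?P = "\<lambda>z. z - (z \<bullet> n) *\<^sub>R n"
    have tri: "norm (u *\<^sub>R a + v *\<^sub>R b) \<le> u * norm a + v * norm b" for a b :: 'a
      using norm_triangle_ineq[of "u *\<^sub>R a" "v *\<^sub>R b"] uv by simp
    have "norm (u *\<^sub>R x + v *\<^sub>R y) \<le> u * norm x + v * norm y" by (rule tri)
    also have "\<dots> \<le> u * h + v * h" using xy uv by (intro add_mono mult_left_mono) (auto simp: K_def)
    also have "\<dots> = h" using uv by (simp flip: distrib_right)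
    finally have 1: "norm (u *\<^sub>R x + v *\<^sub>R y) \<le> h" .
    have "?P (u *\<^sub>R x + v *\<^sub>R y) = u *\<^sub>R ?P x + v *\<^sub>R ?P y" by (simp add: algebra_simps inner_add_left)
    then have "L * norm (?P (u *\<^sub>R x + v *\<^sub>R y)) \<le> L * (u * norm (?P x) + v * norm (?P y))"
      using tri[of "?P x" "?P y"] L by (simp only:) (rule mult_left_mono)
    also have "\<dots> = u * (L * norm (?P x)) + v * (L * norm (?P y))" by (simp add: algebra_simps)
    also have "\<dots> \<le> u * (x \<bullet> n) + v * (y \<bullet> n)" using xy uv by (intro add_mono mult_left_mono) (auto simp: K_def)
    also have "\<dots> = (u *\<^sub>R x + v *\<^sub>R y) \<bullet> n" by (simp add: inner_add_left)
    finally show "u *\<^sub>R x + v *\<^sub>R y \<in> K" using 1 by (simp add: K_def)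
  qed
  define \<delta> where "\<delta> = h / (2 * (2 * L + 1))"
  have \<delta>: "\<delta> > 0" "\<delta> * (2 * L + 1) = h / 2" using h L by (auto simp: \<delta>_def field_simps)
  have "\<delta> * 1 \<le> \<delta> * (2 * L + 1)" by (rule mult_left_mono) (use \<delta>(1) L in auto)
  then have \<delta>h: "\<delta> \<le> h / 2" using \<delta>(2) by linarith
  have "ball ((h / 2) *\<^sub>R n) \<delta> \<subseteq> K"
  proof
    fix z assume "z \<in> ball ((h / 2) *\<^sub>R n) \<delta>"
    moreover define d where "d = z - (h / 2) *\<^sub>R n"
    ultimately have z: "z = (h / 2) *\<^sub>R n + d" and d: "norm d < \<delta>"
      by (simp_all add: dist_norm norm_minus_commute)
    have dn: "\<bar>d \<bullet> n\<bar> \<le> \<delta>" using Cauchy_Schwarz_ineq2[of d n] n d by simp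
    have "norm z \<le> h / 2 + norm d" unfolding z using n h by (intro order_trans[OF norm_triangle_ineq]) simp
    then have 1: "norm z \<le> h" using d \<delta>h by linarith
    have "z - (z \<bullet> n) *\<^sub>R n = d - (d \<bullet> n) *\<^sub>R n" by (simp add: z nn inner_add_left algebra_simps)
    then have "norm (z - (z \<bullet> n) *\<^sub>R n) \<le> norm d + \<bar>d \<bullet> n\<bar>"
      using norm_triangle_ineq4[of d "(d \<bullet> n) *\<^sub>R n"] n by simp
    also have "\<dots> \<le> 2 * \<delta>" using d dn by simp
    finally have "L * norm (z - (z \<bullet> n) *\<^sub>R n) \<le> L * (2 * \<delta>)" using L by (rule mult_left_mono)
    also have "\<dots> = h / 2 - \<delta>" using \<delta>(2) by (simp add: algebra_simps)
    also have "\<dots> \<le> z \<bullet> n" using dn by (simp add: z nn inner_add_left)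
    finally show "z \<in> K" using 1 by (simp add: K_def)
  qed
  then have "measure lborel (ball ((h / 2) *\<^sub>R n) \<delta>) \<le> measure lborel K"
  proof (rule measure_mono_fmeasurable)
    have "emeasure lborel K < \<infinity>" using emeasure_bounded_finite[OF compact_imp_bounded[OF cK]] by simp
    then show "K \<in> fmeasurable lborel" using borel_compact[OF cK] by (intro fmeasurableI) auto
  qed simp
  moreover have "measure lborel (ball ((h / 2) *\<^sub>R n) \<delta>) > 0" using \<delta>(1) by (rule content_ball_pos)
  ultimately show "measure lborel K > 0" by linarith
qed

lemma measure_lborel_translation:
  fixes K :: "'a::euclidean_space set"
  assumes "compact K"
  shows "measure lborel ((+) x ` K) = measure lborel K"
proof -
  have "K \<in> sets lborel" "(+) x ` K \<in> sets lborel"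
    using assms by (auto intro!: borel_compact compact_translation)
  then show ?thesis using measure_translation[of x K] by (simp add: measure_completion)
qed

text \<open>Near a boundary point the domain is the epigraph of a Lipschitz function and contains, with \<open>x\<close>, a
  truncated cone with vertex \<open>x\<close>; elsewhere it contains a ball of fixed radius around \<open>x\<close>.  As the
  frontier is compact, finitely many shapes suffice and their volumes have a positive minimum.\<close>

lemma lipschitz_domain_cells:
  fixes \<Omega> :: "'a::euclidean_space set"
  assumes lip: "lipschitz_domain \<Omega>"
  obtains a where "a > 0"
    "\<And>x. x \<in> \<Omega> \<Longrightarrow> \<exists>K. compact K \<and> convex K \<and> x \<in> K \<and> K \<subseteq> \<Omega> \<and> a \<le> measure lborel K"
proof -
  have \<Omega>: "open \<Omega>" "bounded \<Omega>" using lip by (auto simp: lipschitz_domain_def)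
  have "\<exists>r c. r > 0 \<and> c > 0 \<and> (\<forall>x\<in>\<Omega> \<inter> ball z r. \<exists>K. compact K \<and> convex K \<and> x \<in> K \<and> K \<subseteq> \<Omega> \<and> c \<le> measure lborel K)"
    if "z \<in> frontier \<Omega>" for z
  proof -
    obtain r n g L where r: "r > 0" and n: "norm n = 1" and gL: "L-lipschitz_on {y. y \<bullet> n = 0} g"
      and epi: "\<And>y. y \<in> ball z r \<Longrightarrow> y \<in> \<Omega> \<longleftrightarrow> g (y - (y \<bullet> n) *\<^sub>R n) < y \<bullet> n"
      using lip \<open>z \<in> frontier \<Omega>\<close> unfolding lipschitz_domain_def by metis
    have L: "L \<ge> 0" using gL by (rule lipschitz_on_nonneg)
    have nn: "n \<bullet> n = 1" using n by (simp add: dot_square_norm)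
    define K where "K = {z. norm z \<le> r / 4 \<and> L * norm (z - (z \<bullet> n) *\<^sub>R n) \<le> z \<bullet> n}"
    have r4: "r / 4 > 0" using r by simp
    note K = truncated_cone[OF n L r4, folded K_def]
    show ?thesis
    proof (rule exI[of _ "r / 2"], rule exI[of _ "measure lborel K"], intro conjI ballI)
      fix x assume x: "x \<in> \<Omega> \<inter> ball z (r / 2)"
      have xr: "x \<in> ball z r" using x r by auto
      have gx: "g (x - (x \<bullet> n) *\<^sub>R n) < x \<bullet> n" using epi[OF xr] x by blast
      have "(+) x ` K \<subseteq> \<Omega>"
      proof
        fix y assume "y \<in> (+) x ` K"
        then obtain w where w: "y = x + w" "norm w \<le> r / 4" "L * norm (w - (w \<bullet> n) *\<^sub>R n) \<le> w \<bullet> n"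
          by (auto simp: K_def)
        have "dist z y \<le> dist z x + dist x y" by (rule dist_triangle)
        also have "\<dots> < r / 2 + r / 4" using x w by (simp add: dist_norm)
        finally have yr: "y \<in> ball z r" using r by simp
        let ?P = "\<lambda>z. z - (z \<bullet> n) *\<^sub>R n"
        have Pn: "?P v \<bullet> n = 0" for v by (simp add: inner_diff_left nn)
        have "dist (g (?P y)) (g (?P x)) \<le> L * dist (?P y) (?P x)"
          by (rule lipschitz_onD[OF gL]) (simp_all add: Pn)
        also have "dist (?P y) (?P x) = norm (?P w)"
          unfolding dist_norm w(1) by (rule arg_cong[where f=norm]) (simp add: algebra_simps inner_add_left)
        finally have "g (?P y) \<le> g (?P x) + L * norm (?P w)" by (simp add: dist_real_def abs_le_iff)
        also have "\<dots> < x \<bullet> n + w \<bullet> n" using gx w(3) by linarith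
        also have "\<dots> = y \<bullet> n" by (simp add: w(1) inner_add_left)
        finally show "y \<in> \<Omega>" using epi[OF yr] by simp
      qed
      moreover have "x \<in> (+) x ` K" using K(3) by (intro image_eqI[of _ _ 0]) auto
      ultimately show "\<exists>K'. compact K' \<and> convex K' \<and> x \<in> K' \<and> K' \<subseteq> \<Omega> \<and> measure lborel K \<le> measure lborel K'"
        using K(1,2) by (intro exI[of _ "(+) x ` K"]) (auto simp: measure_lborel_translation compact_translation convex_translation)
    qed (use r K(4) in auto)
  qed
  then have "\<forall>z. \<exists>r c. z \<in> frontier \<Omega> \<longrightarrow> r > 0 \<and> c > 0 \<and> (\<forall>x\<in>\<Omega> \<inter> ball z r. \<exists>K. compact K \<and> convex K \<and> x \<in> K \<and> K \<subseteq> \<Omega> \<and> c \<le> measure lborel K)"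
    by blast
  then obtain r c where "\<forall>z. z \<in> frontier \<Omega> \<longrightarrow> r z > 0 \<and> c z > 0 \<and> (\<forall>x\<in>\<Omega> \<inter> ball z (r z). \<exists>K. compact K \<and> convex K \<and> x \<in> K \<and> K \<subseteq> \<Omega> \<and> c z \<le> measure lborel K)"
    unfolding choice_iff by (elim exE) (rule that)
  then have rc: "r z > 0" "c z > 0" "x \<in> \<Omega> \<Longrightarrow> x \<in> ball z (r z) \<Longrightarrow> \<exists>K. compact K \<and> convex K \<and> x \<in> K \<and> K \<subseteq> \<Omega> \<and> c z \<le> measure lborel K"
    if "z \<in> frontier \<Omega>" for z x using that by blast+
  have comp: "compact (frontier \<Omega>)" using \<Omega>(2) by (simp add: compact_frontier_bounded)
  have cov: "frontier \<Omega> \<subseteq> (\<Union>z\<in>frontier \<Omega>. ball z (r z))" using rc(1) by force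
  obtain D where D: "D \<subseteq> frontier \<Omega>" "finite D" "frontier \<Omega> \<subseteq> (\<Union>z\<in>D. ball z (r z))"
    by (rule compactE_image[OF comp _ cov]) auto
  define V where "V = (\<Union>z\<in>D. ball z (r z))"
  have "open V" unfolding V_def by auto
  have eq: "\<Omega> - V = closure \<Omega> - V" using D(3) closure_Un_frontier[of \<Omega>] by (auto simp: V_def)
  have "compact (\<Omega> - V)"
    unfolding eq using \<Omega>(2) \<open>open V\<close> by (intro compact_diff) auto
  then obtain \<delta> where \<delta>: "\<delta> > 0" "(\<Union>x\<in>\<Omega> - V. cball x \<delta>) \<subseteq> \<Omega>"
    using compact_subset_open_imp_cball_epsilon_subset[of "\<Omega> - V" \<Omega>] \<Omega>(1) by blast
  define a where "a = Min (insert (measure lborel (cball (0::'a) \<delta>)) (c ` D))"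
  have "a > 0" unfolding a_def using D rc(2) \<delta>(1) by (subst Min_gr_iff) (auto simp: content_cball_gt_0_iff)
  have a_c: "a \<le> c z" if "z \<in> D" for z unfolding a_def using D(2) that by (intro Min_le) auto
  have a_\<delta>: "a \<le> measure lborel (cball x \<delta>)" for x :: 'a
  proof -
    have "a \<le> measure lborel (cball (0::'a) \<delta>)" unfolding a_def using D(2) by (intro Min_le) auto
    then show ?thesis using \<delta>(1) by (simp add: content_cball)
  qed
  show ?thesis
  proof (rule that[OF \<open>a > 0\<close>])
    fix x assume x: "x \<in> \<Omega>"
    show "\<exists>K. compact K \<and> convex K \<and> x \<in> K \<and> K \<subseteq> \<Omega> \<and> a \<le> measure lborel K"
    proof (cases "x \<in> V")
      case True
      then obtain z where z: "z \<in> D" "x \<in> ball z (r z)" by (auto simp: V_def)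
      then have "\<exists>K. compact K \<and> convex K \<and> x \<in> K \<and> K \<subseteq> \<Omega> \<and> c z \<le> measure lborel K"
        using rc(3)[OF _ x] D(1) by blast
      then show ?thesis using a_c[OF z(1)] order_trans by blast
    next
      case False
      then have "cball x \<delta> \<subseteq> \<Omega>" using \<delta>(2) x by blast
      then show ?thesis using \<delta>(1) a_\<delta>[of x] by (intro exI[of _ "cball x \<delta>"]) auto
    qed
  qed
qed

text \<open>Harnack's inequality, squared and integrated over a cell that contains \<open>x\<close>, bounds \<open>m x\<close> by the
  \<open>L\<^sup>2\<close> norm of \<open>m\<close>.\<close>

lemma lipschitz_domain_bounded:
  fixes m :: "real^'d::finite \<Rightarrow> real"
  assumes lip: "lipschitz_domain \<Omega>" and mb: "\<And>k. wd \<Omega> k m (\<lambda>x. m x * b k x)"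
    and bm: "\<And>k. b k \<in> borel_measurable borel" and q: "real CARD('d) < q" and M: "M \<ge> 0"
    and vg: "\<And>k. volume_growth q M (b k)" and m2: "integrable lborel (\<lambda>x. (m x)\<^sup>2)"
  obtains L where "L \<ge> 0" "AE x in lborel. x \<in> \<Omega> \<longrightarrow> \<bar>m x\<bar> \<le> L"
proof -
  have \<Omega>: "open \<Omega>" "bounded \<Omega>" using lip by (auto simp: lipschitz_domain_def)
  have q0: "q > 0" using q by (meson less_trans of_nat_0_less_iff zero_less_card_finite)
  obtain N where N: "N \<in> null_sets lborel"
    and harn: "\<And>K x y. compact K \<Longrightarrow> convex K \<Longrightarrow> K \<subseteq> \<Omega> \<Longrightarrow> measure lborel K > 0 \<Longrightarrow> x \<in> K - N \<Longrightarrow> y \<in> K - N \<Longrightarrow>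
      \<bar>m x\<bar> \<le> exp (morrey q M K) * \<bar>m y\<bar>"
    by (rule harnack[OF \<Omega> mb bm q M vg]) (rule that)
  have aeN: "AE x in lborel. x \<notin> N" by (rule AE_not_in[OF N])
  obtain a where a: "a > 0"
    "\<And>x. x \<in> \<Omega> \<Longrightarrow> \<exists>K. compact K \<and> convex K \<and> x \<in> K \<and> K \<subseteq> \<Omega> \<and> a \<le> measure lborel K"
    by (rule lipschitz_domain_cells[OF lip]) (rule that)
  have [measurable]: "m \<in> borel_measurable borel" using wdD(3)[OF mb] .
  define c where "c = 2 * real CARD('d) / (1 - real CARD('d) / q) * diameter \<Omega> * M * a powr (- 1/q)"
  define I where "I = (LBINT x. (m x)\<^sup>2)"
  have I0: "I \<ge> 0" unfolding I_def by (intro Bochner_Integration.integral_nonneg) auto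
  define L where "L = sqrt (exp (2 * c) * I / a)"
  have bound: "\<bar>m x\<bar> \<le> L" if x: "x \<in> \<Omega>" "x \<notin> N" for x
  proof -
    obtain K where K: "compact K" "convex K" "x \<in> K" "K \<subseteq> \<Omega>" "a \<le> measure lborel K" using a(2)[OF x(1)] by blast
    have Kpos: "measure lborel K > 0" using K(5) a(1) by linarith
    have [measurable]: "K \<in> sets borel" using K(1) by (rule borel_compact)
    have finK: "emeasure lborel K < \<infinity>" using emeasure_bounded_finite[OF compact_imp_bounded[OF K(1)]] by simp
    have fac: "2 * real CARD('d) / (1 - real CARD('d) / q) \<ge> 0" using q q0 by (intro divide_nonneg_nonneg) auto
    have d\<Omega>: "diameter \<Omega> \<ge> 0" by (rule diameter_ge_0[OF \<Omega>(2)])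
    have dK: "diameter K \<ge> 0" by (rule diameter_ge_0[OF compact_imp_bounded[OF K(1)]])
    have "morrey q M K \<le> c"
      unfolding morrey_def c_def
    proof (intro mult_mono)
      show "diameter K \<le> diameter \<Omega>" by (rule diameter_subset[OF K(4) \<Omega>(2)])
      show "measure lborel K powr (- 1/q) \<le> a powr (- 1/q)" using a(1) K(5) q0 by (intro powr_mono2') auto
    qed (rule fac M d\<Omega> dK order_refl powr_ge_zero mult_nonneg_nonneg)+
    then have "exp (morrey q M K) * \<bar>m y\<bar> \<le> exp c * \<bar>m y\<bar>" for y by (intro mult_right_mono) auto
    then have "\<bar>m x\<bar> \<le> exp c * \<bar>m y\<bar>" if "y \<in> K" "y \<notin> N" for y
      using harn[OF K(1,2,4) Kpos, of x y] that x K(3) by (meson DiffI order_trans)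
    then have sq: "(m x)\<^sup>2 \<le> exp (2 * c) * (m y)\<^sup>2" if "y \<in> K" "y \<notin> N" for y
      using power_mono[of "\<bar>m x\<bar>" "exp c * \<bar>m y\<bar>" 2] that by (simp add: power_mult_distrib exp_double)
    have "(m x)\<^sup>2 * a \<le> (m x)\<^sup>2 * measure lborel K" using K(5) by (intro mult_left_mono) auto
    also have "\<dots> = (LBINT y. (m x)\<^sup>2 * indicat_real K y)" using finK by simp
    also have "\<dots> \<le> (LBINT y. exp (2 * c) * (m y)\<^sup>2)"
    proof (rule integral_mono_AE)
      show "integrable lborel (\<lambda>y. (m x)\<^sup>2 * indicat_real K y)" using finK by auto
      show "AE y in lborel. (m x)\<^sup>2 * indicat_real K y \<le> exp (2 * c) * (m y)\<^sup>2"
        using aeN by eventually_elim (use sq in \<open>auto simp: indicator_def\<close>)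
    qed (use m2 in auto)
    also have "\<dots> = exp (2 * c) * I" by (simp add: I_def)
    finally have "(m x)\<^sup>2 \<le> exp (2 * c) * I / a" using a(1) by (simp add: pos_le_divide_eq)
    then have "sqrt ((m x)\<^sup>2) \<le> L" unfolding L_def by (rule real_sqrt_le_mono)
    then show ?thesis by simp
  qed
  show ?thesis
  proof (rule that)
    show "L \<ge> 0" unfolding L_def using I0 a(1) by simp
    show "AE x in lborel. x \<in> \<Omega> \<longrightarrow> \<bar>m x\<bar> \<le> L" using aeN by eventually_elim (use bound in auto)
  qed
qed

section \<open>The solution space\<close>

lemma Lp_measurable: "f \<in> Lp U p \<Longrightarrow> f \<in> borel_measurable (lebesgue_on U)"
  by (simp add: Lp_def)

lemma Lp_dominated:
  fixes f :: "'a::euclidean_space \<Rightarrow> 'b::euclidean_space" and g :: "'a \<Rightarrow> 'c::euclidean_space"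
  assumes f: "f \<in> Lp U p" and g: "g \<in> borel_measurable (lebesgue_on U)" and L: "L \<ge> 0"
    and le: "AE x in lebesgue_on U. norm (g x) \<le> L * norm (f x)"
  shows "g \<in> Lp U p"
proof (cases "p = \<infinity>")
  case True
  then obtain C where "AE x in lebesgue_on U. norm (f x) \<le> C" using f by (auto simp: Lp_def)
  with le have "AE x in lebesgue_on U. norm (g x) \<le> L * C"
    by eventually_elim (meson L mult_left_mono order_trans)
  then show ?thesis using g True by (auto simp: Lp_def)
next
  case False
  have fi: "integrable (lebesgue_on U) (\<lambda>x. norm (f x) powr enn2real p)" and fm: "f \<in> borel_measurable (lebesgue_on U)"
    using f False by (auto simp: Lp_def)
  have "integrable (lebesgue_on U) (\<lambda>x. norm (g x) powr enn2real p)"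
  proof (rule Bochner_Integration.integrable_bound)
    show "integrable (lebesgue_on U) (\<lambda>x. L powr enn2real p * norm (f x) powr enn2real p)" using fi by simp
    show "(\<lambda>x. norm (g x) powr enn2real p) \<in> borel_measurable (lebesgue_on U)" using g by measurable
    show "AE x in lebesgue_on U. norm (norm (g x) powr enn2real p) \<le> norm (L powr enn2real p * norm (f x) powr enn2real p)"
      using le
    proof eventually_elim
      case (elim x)
      then have "norm (g x) powr enn2real p \<le> (L * norm (f x)) powr enn2real p" by (intro powr_mono2) auto
      then show ?case by (simp add: powr_mult)
    qed
  qed
  then show ?thesis using g False by (auto simp: Lp_def)
qed

lemma Lp_const:
  assumes "open U" "bounded U"
  shows "(\<lambda>x. c) \<in> Lp U p"
proof -
  have "integrable (lebesgue_on U) (\<lambda>x. norm c powr enn2real p)"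
  proof -
    have "emeasure lborel U < \<infinity>" using emeasure_bounded_finite[OF assms(2)] by simp
    then have "integrable lborel (\<lambda>x. norm c powr enn2real p * indicat_real U x)" using assms(1) by auto
    moreover have "integrable (lebesgue_on U) (\<lambda>x. norm c powr enn2real p) \<longleftrightarrow> integrable lborel (\<lambda>x. norm c powr enn2real p * indicat_real U x)"
      by (rule integral_lebesgue_on_eq(2)[OF assms(1)]) (use assms(1) in auto)
    ultimately show ?thesis by simp
  qed
  then show ?thesis by (auto simp: Lp_def)
qed

lemma Lp_2_linear_combination:
  fixes f g :: "'a::euclidean_space \<Rightarrow> real"
  assumes "f \<in> Lp U 2" "g \<in> Lp U 2"
  shows "(\<lambda>x. a * f x + b * g x) \<in> Lp U 2"
proof -
  have m [measurable]: "f \<in> borel_measurable (lebesgue_on U)" "g \<in> borel_measurable (lebesgue_on U)"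
    using assms by (auto simp: Lp_def)
  have i: "integrable (lebesgue_on U) (\<lambda>x. norm (f x) powr 2)" "integrable (lebesgue_on U) (\<lambda>x. norm (g x) powr 2)"
    using assms by (auto simp: Lp_def)
  have "integrable (lebesgue_on U) (\<lambda>x. norm (a * f x + b * g x) powr 2)"
  proof (rule Bochner_Integration.integrable_bound)
    show "integrable (lebesgue_on U) (\<lambda>x. 3 * (a\<^sup>2 * norm (f x) powr 2 + b\<^sup>2 * norm (g x) powr 2))" using i by auto
    show "AE x in lebesgue_on U. norm (norm (a * f x + b * g x) powr 2) \<le> norm (3 * (a\<^sup>2 * norm (f x) powr 2 + b\<^sup>2 * norm (g x) powr 2))"
    proof (rule AE_I2)
      fix x
      show "norm (norm (a * f x + b * g x) powr 2) \<le> norm (3 * (a\<^sup>2 * norm (f x) powr 2 + b\<^sup>2 * norm (g x) powr 2))"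
        using norm_three_squares[of "a * f x" "b * g x" 0] by (simp add: powr_numeral power_mult_distrib)
    qed
  qed measurable
  then show ?thesis by (simp add: Lp_def)
qed

lemma Lp_2_representative:
  fixes f :: "real^'d::finite \<Rightarrow> 'b::euclidean_space"
  assumes U: "open U" and f: "f \<in> Lp U 2"
  obtains g where "g \<in> borel_measurable borel" "AE x in lborel. x \<in> U \<longrightarrow> f x = g x"
    "\<And>x. x \<notin> U \<Longrightarrow> g x = 0" "integrable lborel (\<lambda>x. (norm (g x))\<^sup>2)"
proof -
  obtain g where g: "g \<in> borel_measurable borel" "AE x in lborel. x \<in> U \<longrightarrow> f x = g x" "\<And>x. x \<notin> U \<Longrightarrow> g x = 0"
    by (rule borel_representative[OF U Lp_measurable[OF f]]) (rule that)
  have [measurable]: "g \<in> borel_measurable borel" by fact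
  have "integrable (lebesgue_on U) (\<lambda>x. norm (f x) powr 2)" using f by (simp add: Lp_def)
  moreover have "integrable (lebesgue_on U) (\<lambda>x. norm (f x) powr 2) \<longleftrightarrow> integrable lborel (\<lambda>x. (norm (g x))\<^sup>2)"
    by (rule integral_lebesgue_on_eq(2)[OF U]) (use g in \<open>auto simp: powr_numeral elim: eventually_mono\<close>)
  ultimately show ?thesis using that g by blast
qed

text \<open>Needed for the linearity of the equation in \<open>\<mu>\<close>.\<close>

lemma energy_integrable:
  fixes \<Omega> :: "(real^'d::finite) set" and S :: "real^'d \<Rightarrow> real^'d^'d"
  assumes \<Omega>: "open \<Omega>" and \<mu>: "\<mu> \<in> Lp \<Omega> 2" and S: "S \<in> Lp \<Omega> \<infinity>" and v: "v \<in> H10 \<Omega>"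
  shows "integrable (lebesgue_on \<Omega>) (\<lambda>x. (\<mu> x *\<^sub>R S x) \<bullet> sym_grad \<Omega> v x)"
proof -
  obtain m where m: "m \<in> borel_measurable borel" "AE x in lborel. x \<in> \<Omega> \<longrightarrow> \<mu> x = m x"
    "\<And>x. x \<notin> \<Omega> \<Longrightarrow> m x = 0" "integrable lborel (\<lambda>x. (norm (m x))\<^sup>2)"
    by (rule Lp_2_representative[OF \<Omega> \<mu>]) (rule that)
  obtain A where A: "A \<in> borel_measurable borel" "AE x in lborel. x \<in> \<Omega> \<longrightarrow> S x = A x" "\<And>x. x \<notin> \<Omega> \<Longrightarrow> A x = 0"
    by (rule borel_representative[OF \<Omega> Lp_measurable[OF S]]) (rule that)
  obtain C where C: "AE x in lborel. x \<in> \<Omega> \<longrightarrow> norm (S x) \<le> C"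
    using S by (auto simp: Lp_def AE_lebesgue_on_iff[OF \<Omega>])
  have "\<exists>w. w \<in> borel_measurable borel \<and> (AE x in lborel. x \<in> \<Omega> \<longrightarrow> weak_partial \<Omega> j v x = w x) \<and>
      integrable lborel (\<lambda>x. (norm (w x))\<^sup>2)" for j
  proof -
    obtain g where g: "g \<in> Lp \<Omega> 2" "has_weak_partial \<Omega> j v g" using v by (auto simp: H10_def W1p_def)
    from g(2) have "has_weak_partial \<Omega> j v (weak_partial \<Omega> j v)"
      unfolding weak_partial_def by (rule someI[of "has_weak_partial \<Omega> j v"])
    from has_weak_partial_unique[OF \<Omega> this g(2)]
    have eq: "AE x in lborel. x \<in> \<Omega> \<longrightarrow> weak_partial \<Omega> j v x = g x" .
    obtain w where w: "w \<in> borel_measurable borel" "AE x in lborel. x \<in> \<Omega> \<longrightarrow> g x = w x"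
      "\<And>x. x \<notin> \<Omega> \<Longrightarrow> w x = 0" "integrable lborel (\<lambda>x. (norm (w x))\<^sup>2)"
      by (rule Lp_2_representative[OF \<Omega> g(1)]) (rule that)
    have "AE x in lborel. x \<in> \<Omega> \<longrightarrow> weak_partial \<Omega> j v x = w x" using eq w(2) by eventually_elim simp
    with w show ?thesis by blast
  qed
  then have "\<forall>j. \<exists>w. w \<in> borel_measurable borel \<and> (AE x in lborel. x \<in> \<Omega> \<longrightarrow> weak_partial \<Omega> j v x = w x) \<and>
      integrable lborel (\<lambda>x. (norm (w x))\<^sup>2)" ..
  from choice[OF this] obtain w where "\<forall>j. w j \<in> borel_measurable borel \<and> (AE x in lborel. x \<in> \<Omega> \<longrightarrow> weak_partial \<Omega> j v x = w j x) \<and>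
      integrable lborel (\<lambda>x. (norm (w j x))\<^sup>2)" ..
  then have w: "w j \<in> borel_measurable borel" "AE x in lborel. x \<in> \<Omega> \<longrightarrow> weak_partial \<Omega> j v x = w j x"
      "integrable lborel (\<lambda>x. (norm (w j x))\<^sup>2)" for j by simp_all
  note [measurable] = m(1) A(1) w(1)
  define E where "E x = m x * (\<Sum>j\<in>UNIV. \<Sum>i\<in>UNIV. A x $ i $ j * ((w j x $ i + w i x $ j) / 2))" for x
  have E [measurable]: "E \<in> borel_measurable borel"
    unfolding E_def by (intro borel_measurable_times borel_measurable_sum borel_measurable_divide borel_measurable_add borel_measurable_component borel_measurable_const m(1) A(1) w(1))
  have "AE x in lborel. \<forall>j\<in>UNIV. x \<in> \<Omega> \<longrightarrow> weak_partial \<Omega> j v x = w j x"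
    using w(2) by (intro AE_finite_allI) auto
  then have eq: "AE x in lborel. x \<in> \<Omega> \<longrightarrow> (\<mu> x *\<^sub>R S x) \<bullet> sym_grad \<Omega> v x = E x"
    using m(2) A(2)
  proof eventually_elim
    case (elim x)
    show ?case
    proof
      assume x: "x \<in> \<Omega>"
      have "S x \<bullet> sym_grad \<Omega> v x = (\<Sum>i\<in>UNIV. \<Sum>j\<in>UNIV. A x $ i $ j * ((w j x $ i + w i x $ j) / 2))"
        using elim x by (simp add: sym_grad_def inner_vec_def)
      also have "\<dots> = (\<Sum>j\<in>UNIV. \<Sum>i\<in>UNIV. A x $ i $ j * ((w j x $ i + w i x $ j) / 2))" by (rule sum.swap)
      finally show "(\<mu> x *\<^sub>R S x) \<bullet> sym_grad \<Omega> v x = E x" using elim x by (simp add: E_def)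
    qed
  qed
  have "integrable lborel E"
  proof (rule Bochner_Integration.integrable_bound)
    let ?R = "\<lambda>x. \<Sum>j\<in>(UNIV::'d set). \<Sum>i\<in>(UNIV::'d set). \<bar>C\<bar> * ((norm (m x))\<^sup>2 + (norm (w j x))\<^sup>2 + (norm (w i x))\<^sup>2)"
    show "integrable lborel ?R" using m(4) w(3) by auto
    have A_C: "AE x in lborel. x \<in> \<Omega> \<longrightarrow> norm (A x) \<le> C" using A(2) C by eventually_elim auto
    then show "AE x in lborel. norm (E x) \<le> norm (?R x)"
    proof eventually_elim
      case (elim x)
      show ?case
      proof (cases "x \<in> \<Omega>")
        case True
        have t: "\<bar>m x\<bar> * \<bar>A x $ i $ j * ((w j x $ i + w i x $ j) / 2)\<bar> \<le> \<bar>C\<bar> * ((norm (m x))\<^sup>2 + (norm (w j x))\<^sup>2 + (norm (w i x))\<^sup>2)" for i j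
        proof -
          have a: "\<bar>A x $ i $ j\<bar> \<le> \<bar>C\<bar>"
            using component_le_norm_cart[of "A x $ i" j] Finite_Cartesian_Product.norm_nth_le[of "A x" i] elim True by linarith
          have ww: "\<bar>(w j x $ i + w i x $ j) / 2\<bar> \<le> (norm (w j x) + norm (w i x)) / 2"
          proof -
            have "\<bar>(w j x $ i + w i x $ j) / 2\<bar> = \<bar>w j x $ i + w i x $ j\<bar> / 2" by simp
            also have "\<dots> \<le> (\<bar>w j x $ i\<bar> + \<bar>w i x $ j\<bar>) / 2"
              by (intro divide_right_mono abs_triangle_ineq) simp
            also have "\<dots> \<le> (norm (w j x) + norm (w i x)) / 2"
              by (intro divide_right_mono add_mono component_le_norm_cart) simp
            finally show ?thesis .
          qed
          have sq: "\<bar>m x\<bar> * n \<le> ((norm (m x))\<^sup>2 + n\<^sup>2) / 2" for n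
            using sum_squares_bound[of "\<bar>m x\<bar>" n] by simp
          have "\<bar>m x\<bar> * \<bar>(w j x $ i + w i x $ j) / 2\<bar> \<le> \<bar>m x\<bar> * ((norm (w j x) + norm (w i x)) / 2)"
            by (rule mult_left_mono[OF ww]) simp
          also have "\<dots> = (\<bar>m x\<bar> * norm (w j x) + \<bar>m x\<bar> * norm (w i x)) / 2" by (simp add: algebra_simps)
          also have "\<dots> \<le> (((norm (m x))\<^sup>2 + (norm (w j x))\<^sup>2) / 2 + ((norm (m x))\<^sup>2 + (norm (w i x))\<^sup>2) / 2) / 2"
            by (intro divide_right_mono add_mono sq) simp
          also have "\<dots> \<le> (norm (m x))\<^sup>2 + (norm (w j x))\<^sup>2 + (norm (w i x))\<^sup>2"
          proof -
            have "((a + b) / 2 + (a + c) / 2) / 2 \<le> a + b + c" if "0 \<le> a" "0 \<le> b" "0 \<le> c" for a b c :: real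
              using that by (simp add: field_simps)
            then show ?thesis by simp
          qed
          finally have "\<bar>A x $ i $ j\<bar> * (\<bar>m x\<bar> * \<bar>(w j x $ i + w i x $ j) / 2\<bar>) \<le> \<bar>C\<bar> * ((norm (m x))\<^sup>2 + (norm (w j x))\<^sup>2 + (norm (w i x))\<^sup>2)"
            by (intro mult_mono a) auto
          then show ?thesis by (simp only: abs_mult mult.left_commute)
        qed
        have "norm (E x) = \<bar>m x\<bar> * \<bar>\<Sum>j\<in>UNIV. \<Sum>i\<in>UNIV. A x $ i $ j * ((w j x $ i + w i x $ j) / 2)\<bar>"
          by (simp only: E_def real_norm_def abs_mult)
        also have "\<dots> \<le> \<bar>m x\<bar> * (\<Sum>j\<in>UNIV. \<Sum>i\<in>UNIV. \<bar>A x $ i $ j * ((w j x $ i + w i x $ j) / 2)\<bar>)"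
          by (intro mult_left_mono order_trans[OF sum_abs] sum_mono) auto
        also have "\<dots> = (\<Sum>j\<in>UNIV. \<Sum>i\<in>UNIV. \<bar>m x\<bar> * \<bar>A x $ i $ j * ((w j x $ i + w i x $ j) / 2)\<bar>)"
          by (simp only: sum_distrib_left)
        also have "\<dots> \<le> ?R x" by (intro sum_mono t)
        also have "\<dots> \<le> norm (?R x)" by simp
        finally show ?thesis .
      qed (simp add: E_def m(3))
    qed
  qed measurable
  moreover have E0: "E x = 0" if "x \<notin> \<Omega>" for x using m(3)[OF that] by (simp add: E_def)
  ultimately show ?thesis
    using integral_lebesgue_on_eq(2)[OF \<Omega> E eq E0] by blast
qed

lemma stress_solution_linear_combination:
  fixes \<Omega> :: "(real^'d::finite) set"
  assumes \<Omega>: "open \<Omega>" and S: "sym_grad \<Omega> u \<in> Lp \<Omega> \<infinity>"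
    and sol: "stress_solution \<Omega> u \<mu>" "stress_solution \<Omega> u \<nu>"
  shows "stress_solution \<Omega> u (\<lambda>x. a * \<mu> x + b * \<nu> x)"
  unfolding stress_solution_def
proof (intro conjI ballI)
  have L: "\<mu> \<in> Lp \<Omega> 2" "\<nu> \<in> Lp \<Omega> 2" using sol by (auto simp: stress_solution_def)
  show "(\<lambda>x. a * \<mu> x + b * \<nu> x) \<in> Lp \<Omega> 2" by (rule Lp_2_linear_combination[OF L])
  fix v :: "real^'d \<Rightarrow> real^'d" assume v: "v \<in> H10 \<Omega>"
  let ?e = "\<lambda>\<mu> x. (\<mu> x *\<^sub>R sym_grad \<Omega> u x) \<bullet> sym_grad \<Omega> v x"
  have "(LINT x|lebesgue_on \<Omega>. ?e (\<lambda>x. a * \<mu> x + b * \<nu> x) x) = (LINT x|lebesgue_on \<Omega>. a * ?e \<mu> x + b * ?e \<nu> x)"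
    by (intro Bochner_Integration.integral_cong) (auto simp: algebra_simps inner_add_left)
  also have "\<dots> = a * (LINT x|lebesgue_on \<Omega>. ?e \<mu> x) + b * (LINT x|lebesgue_on \<Omega>. ?e \<nu> x)"
    using energy_integrable[OF \<Omega> L(1) S v] energy_integrable[OF \<Omega> L(2) S v] by simp
  also have "\<dots> = 0" using sol v by (simp add: stress_solution_def)
  finally show "(LINT x|lebesgue_on \<Omega>. ?e (\<lambda>x. a * \<mu> x + b * \<nu> x) x) = 0" .
qed

lemma ae_class_eq_iff:
  assumes "open \<Omega>"
  shows "ae_class \<Omega> f = ae_class \<Omega> g \<longleftrightarrow> (AE x in lborel. x \<in> \<Omega> \<longrightarrow> f x = g x)"
proof -
  have "ae_class \<Omega> f = ae_class \<Omega> g \<longleftrightarrow> (AE x in lborel. (if x \<in> \<Omega> then f x else 0) = (if x \<in> \<Omega> then g x else 0))"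
    by (simp add: ae_class_def ae_fun.abs_eq_iff AE_completion_iff)
  also have "\<dots> \<longleftrightarrow> (AE x in lborel. x \<in> \<Omega> \<longrightarrow> f x = g x)"
    by (intro eventually_cong) auto
  finally show ?thesis .
qed

lemma ae_class_add: "ae_class \<Omega> f + ae_class \<Omega> g = ae_class \<Omega> (\<lambda>x. f x + g x)"
  unfolding ae_class_def plus_ae_fun.abs_eq by (rule arg_cong[where f=abs_ae_fun]) auto

lemma ae_class_scaleR: "c *\<^sub>R ae_class \<Omega> f = ae_class \<Omega> (\<lambda>x. c * f x)"
  unfolding ae_class_def scaleR_ae_fun.abs_eq by (rule arg_cong[where f=abs_ae_fun]) auto

lemma ae_class_zero: "ae_class \<Omega> (\<lambda>x. 0) = 0"
  unfolding ae_class_def zero_ae_fun_def by simp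

lemma K_space_eq: "K_space \<Omega> u = {ae_class \<Omega> \<mu> | \<mu>. stress_solution \<Omega> u \<mu>}"
  by (simp add: K_space_def stress_solution_def)

lemma stress_solution_zero: "stress_solution \<Omega> u (\<lambda>x. 0)"
  by (simp add: stress_solution_def Lp_def)

lemma subspace_K_space:
  assumes \<Omega>: "open \<Omega>" and S: "sym_grad \<Omega> u \<in> Lp \<Omega> \<infinity>"
  shows "subspace (K_space \<Omega> u)"
proof (rule subspaceI)
  show "0 \<in> K_space \<Omega> u"
    unfolding K_space_eq using stress_solution_zero ae_class_zero[of \<Omega>, symmetric] by blast
next
  fix x y assume "x \<in> K_space \<Omega> u" "y \<in> K_space \<Omega> u"
  then obtain \<mu> \<nu> where \<mu>: "x = ae_class \<Omega> \<mu>" "stress_solution \<Omega> u \<mu>" and \<nu>: "y = ae_class \<Omega> \<nu>" "stress_solution \<Omega> u \<nu>"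
    unfolding K_space_eq by blast
  have "x + y = ae_class \<Omega> (\<lambda>x. \<mu> x + \<nu> x)" using \<mu> \<nu> by (simp add: ae_class_add)
  moreover have "stress_solution \<Omega> u (\<lambda>x. \<mu> x + \<nu> x)"
    using stress_solution_linear_combination[OF \<Omega> S \<mu>(2) \<nu>(2), of 1 1] by simp
  ultimately show "x + y \<in> K_space \<Omega> u" unfolding K_space_eq by blast
next
  fix c x assume "x \<in> K_space \<Omega> u"
  then obtain \<mu> where \<mu>: "x = ae_class \<Omega> \<mu>" "stress_solution \<Omega> u \<mu>" unfolding K_space_eq by blast
  have "c *\<^sub>R x = ae_class \<Omega> (\<lambda>x. c * \<mu> x)" using \<mu> by (simp add: ae_class_scaleR)
  moreover have "stress_solution \<Omega> u (\<lambda>x. c * \<mu> x)"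
    using stress_solution_linear_combination[OF \<Omega> S \<mu>(2) \<mu>(2), of c 0] by simp
  ultimately show "c *\<^sub>R x \<in> K_space \<Omega> u" unfolding K_space_eq by blast
qed

lemma has_dim_zero_space: "has_dim {0::'v::real_vector} n \<longleftrightarrow> n = 0"
proof -
  have "dim {0::'v} = 0" using dim_span[of "{}::'v set"] dim_eq_card_independent[of "{}::'v set"] by (simp add: independent_empty)
  then show ?thesis unfolding has_dim_def by (auto intro!: exI[of _ "{}"])
qed

lemma has_dim_line:
  assumes "a \<noteq> (0::'v::real_vector)"
  shows "has_dim (span {a}) 1"
proof -
  have "independent {a}" using assms by simp
  then have "dim (span {a}) = 1" using dim_eq_card_independent[of "{a}"] by simp
  then show ?thesis unfolding has_dim_def by (auto intro!: exI[of _ "{a}"])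
qed

theorem theorem2:
  fixes \<Omega> :: "(real^'d::finite) set"
    and u :: "real^'d \<Rightarrow> real^'d"
    and p :: ennreal
    and c :: real
  assumes "CARD('d) \<in> {2, 3}"
    and "open \<Omega>" and "connected \<Omega>" and "bounded \<Omega>"
    and "u \<in> H1 \<Omega>"
    and "of_nat CARD('d) < p"
    and "sym_grad \<Omega> u \<in> Lp \<Omega> \<infinity> \<inter> W1p \<Omega> p"
    and "c > 0"
    and "AE x in lebesgue_on \<Omega>. \<bar>det (sym_grad \<Omega> u x)\<bar> \<ge> c"
  shows "(has_dim (K_space \<Omega> u) 0 \<or> has_dim (K_space \<Omega> u) 1) \<and>
    (has_dim (K_space \<Omega> u) 1 \<longrightarrow>
      (\<exists>\<mu>0. continuous_on \<Omega> \<mu>0 \<and> (\<forall>x\<in>\<Omega>. \<mu>0 x > 0) \<and>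
        K_space \<Omega> u = span {ae_class \<Omega> \<mu>0} \<and>
        (lipschitz_domain \<Omega> \<longrightarrow> \<mu>0 \<in> W1p \<Omega> p)))"
proof (cases "\<forall>\<mu>. stress_solution \<Omega> u \<mu> \<longrightarrow> (AE x in lborel. x \<in> \<Omega> \<longrightarrow> \<mu> x = 0)")
  case True
  have "K_space \<Omega> u = {0}"
  proof
    show "K_space \<Omega> u \<subseteq> {0}"
      using True ae_class_eq_iff[OF assms(2), of _ "\<lambda>x. 0"] by (auto simp: K_space_eq ae_class_zero)
    show "{0} \<subseteq> K_space \<Omega> u"
      unfolding K_space_eq using stress_solution_zero ae_class_zero[of \<Omega>, symmetric] by blast
  qed
  then show ?thesis by (simp add: has_dim_zero_space)
next
  case False
  note \<Omega> = assms(2,4,3)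
  have S: "sym_grad \<Omega> u \<in> Lp \<Omega> \<infinity>" using assms(7) by simp
  obtain \<mu> where sol: "stress_solution \<Omega> u \<mu>" and nz: "\<not> (AE x in lborel. x \<in> \<Omega> \<longrightarrow> \<mu> x = 0)" using False by blast
  have ne: "\<Omega> \<noteq> {}" using nz by auto
  have d2: "CARD('d) \<ge> 2" using assms(1) by auto
  obtain b q where q: "real CARD('d) < q" and bm: "\<And>k. b k \<in> borel_measurable borel"
    and bq: "\<And>k. integrable lborel (\<lambda>x. norm (b k x) powr q)" and bp: "\<And>k. b k \<in> Lp \<Omega> p"
    and grad: "\<And>\<mu> m k. stress_solution \<Omega> u \<mu> \<Longrightarrow> m \<in> borel_measurable borel \<Longrightarrow> AE x in lborel. x \<in> \<Omega> \<longrightarrow> \<mu> x = m x \<Longrightarrow>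
       \<forall>x. x \<notin> \<Omega> \<longrightarrow> m x = 0 \<Longrightarrow> wd \<Omega> k m (\<lambda>x. m x * b k x)"
    by (rule stress_solution_gradient[OF d2 assms(2,3,4) ne assms(6,7,8,9)]) (rule that)
  have q1: "q > 1" using q d2 by linarith
  obtain M where M0: "M \<ge> 0" and vg: "\<And>k. volume_growth q M (b k)"
    using volume_growth_family[of b q, OF bm bq q1] by blast
  have rep: "\<exists>m. m \<in> borel_measurable borel \<and> (AE x in lborel. x \<in> \<Omega> \<longrightarrow> \<nu> x = m x) \<and>
      integrable lborel (\<lambda>x. (m x)\<^sup>2) \<and> (\<forall>k. wd \<Omega> k m (\<lambda>x. m x * b k x))" if \<nu>: "stress_solution \<Omega> u \<nu>" for \<nu>
  proof -
    have "\<nu> \<in> Lp \<Omega> 2" using \<nu> by (simp add: stress_solution_def)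
    then obtain m where m: "m \<in> borel_measurable borel" "AE x in lborel. x \<in> \<Omega> \<longrightarrow> \<nu> x = m x"
      "\<And>x. x \<notin> \<Omega> \<Longrightarrow> m x = 0" "integrable lborel (\<lambda>x. (norm (m x))\<^sup>2)"
      by (rule Lp_2_representative[OF assms(2)]) (rule that)
    have "wd \<Omega> k m (\<lambda>x. m x * b k x)" for k by (rule grad[OF \<nu> m(1,2)]) (use m(3) in blast)
    with m show ?thesis by (intro exI[of _ m]) simp
  qed
  have cont: "\<exists>h. continuous_on \<Omega> h \<and> (AE x in lborel. x \<in> \<Omega> \<longrightarrow> \<nu> x = h x) \<and> ((\<forall>x\<in>\<Omega>. h x = 0) \<or> (\<forall>x\<in>\<Omega>. h x \<noteq> 0))"
    if \<nu>: "stress_solution \<Omega> u \<nu>" for \<nu>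
  proof -
    obtain m where m: "AE x in lborel. x \<in> \<Omega> \<longrightarrow> \<nu> x = m x" "\<And>k. wd \<Omega> k m (\<lambda>x. m x * b k x)"
      using rep[OF \<nu>] by blast
    obtain h where h: "continuous_on \<Omega> h" "AE x in lborel. x \<in> \<Omega> \<longrightarrow> m x = h x" "(\<forall>x\<in>\<Omega>. h x = 0) \<or> (\<forall>x\<in>\<Omega>. h x \<noteq> 0)"
      by (rule zero_or_nowhere_zero[OF \<Omega> m(2) bm q M0 vg]) (rule that)
    have "AE x in lborel. x \<in> \<Omega> \<longrightarrow> \<nu> x = h x" using m(1) h(2) by eventually_elim auto
    with h show ?thesis by blast
  qed
  obtain h where h: "continuous_on \<Omega> h" "AE x in lborel. x \<in> \<Omega> \<longrightarrow> \<mu> x = h x" "(\<forall>x\<in>\<Omega>. h x = 0) \<or> (\<forall>x\<in>\<Omega>. h x \<noteq> 0)"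
    using cont[OF sol] by blast
  have h0: "\<forall>x\<in>\<Omega>. h x \<noteq> 0"
  proof (rule ccontr)
    assume "\<not> (\<forall>x\<in>\<Omega>. h x \<noteq> 0)"
    then have "\<forall>x\<in>\<Omega>. h x = 0" using h(3) by blast
    then have "AE x in lborel. x \<in> \<Omega> \<longrightarrow> \<mu> x = 0" using h(2) by (auto elim: eventually_mono)
    then show False using nz by blast
  qed
  obtain s :: real where s: "s \<in> {1, -1}" "\<And>x. x \<in> \<Omega> \<Longrightarrow> s * h x > 0"
    by (rule continuous_nonzero_constant_sign[OF assms(3) h(1) h0]) (rule that)
  define \<mu>0 where "\<mu>0 x = s * h x" for x
  have class0: "ae_class \<Omega> \<mu>0 = s *\<^sub>R ae_class \<Omega> \<mu>"
    unfolding ae_class_scaleR ae_class_eq_iff[OF assms(2)] \<mu>0_def using h(2) by (auto elim: eventually_mono)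
  have in_K: "ae_class \<Omega> \<mu> \<in> K_space \<Omega> u" unfolding K_space_eq using sol by blast
  have sub: "subspace (K_space \<Omega> u)" by (rule subspace_K_space[OF assms(2) S])
  have K_eq: "K_space \<Omega> u = span {ae_class \<Omega> \<mu>0}"
  proof
    have "ae_class \<Omega> \<mu>0 \<in> K_space \<Omega> u" unfolding class0 by (rule subspace_scale[OF sub in_K])
    then show "span {ae_class \<Omega> \<mu>0} \<subseteq> K_space \<Omega> u" using sub by (intro span_minimal) auto
    show "K_space \<Omega> u \<subseteq> span {ae_class \<Omega> \<mu>0}"
    proof
      fix y assume "y \<in> K_space \<Omega> u"
      then obtain \<nu> where \<nu>: "y = ae_class \<Omega> \<nu>" "stress_solution \<Omega> u \<nu>" unfolding K_space_eq by blast
      obtain k where k: "continuous_on \<Omega> k" "AE x in lborel. x \<in> \<Omega> \<longrightarrow> \<nu> x = k x" using cont[OF \<nu>(2)] by blast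
      obtain x0 where x0: "x0 \<in> \<Omega>" using ne by blast
      \<comment> \<open>The combination that vanishes at a point of the domain vanishes identically.\<close>
      obtain l where l: "continuous_on \<Omega> l" "AE x in lborel. x \<in> \<Omega> \<longrightarrow> h x0 * \<nu> x + (- k x0) * \<mu> x = l x"
        "(\<forall>x\<in>\<Omega>. l x = 0) \<or> (\<forall>x\<in>\<Omega>. l x \<noteq> 0)"
        using cont[OF stress_solution_linear_combination[OF assms(2) S \<nu>(2) sol]] by blast
      have "l x0 = h x0 * k x0 + (- k x0) * h x0"
      proof (rule continuous_AE_eq_imp_eq[where W=\<Omega> and h=l and k="\<lambda>x. h x0 * k x + (- k x0) * h x", OF assms(2) l(1)])
        show "continuous_on \<Omega> (\<lambda>x. h x0 * k x + (- k x0) * h x)" by (intro continuous_intros h(1) k(1))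
        show "AE x in lborel. x \<in> \<Omega> \<longrightarrow> l x = h x0 * k x + (- k x0) * h x"
          using l(2) k(2) h(2) by eventually_elim auto
      qed (rule x0)
      then have l0: "\<forall>x\<in>\<Omega>. l x = 0" using l(3) x0 by auto
      have "AE x in lborel. x \<in> \<Omega> \<longrightarrow> \<nu> x = (s * k x0 / h x0) * \<mu>0 x"
        using l(2) h(2)
      proof eventually_elim
        case (elim x)
        show ?case
        proof
          assume x: "x \<in> \<Omega>"
          have ss: "s * s = 1" using s(1) by auto
          have hx0: "h x0 \<noteq> 0" using h0 x0 by blast
          have "h x0 * \<nu> x = k x0 * h x" using elim x l0 by simp
          then have "\<nu> x = (s * s) * (k x0 * h x) / h x0" using hx0 by (simp add: ss nonzero_eq_divide_eq mult.commute)
          then show "\<nu> x = (s * k x0 / h x0) * \<mu>0 x" by (simp add: \<mu>0_def ac_simps)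
        qed
      qed
      then have "y = (s * k x0 / h x0) *\<^sub>R ae_class \<Omega> \<mu>0"
        unfolding \<nu>(1) ae_class_scaleR ae_class_eq_iff[OF assms(2)] .
      then show "y \<in> span {ae_class \<Omega> \<mu>0}" by (simp add: span_base span_scale)
    qed
  qed
  have "ae_class \<Omega> \<mu> \<noteq> 0"
    using nz ae_class_eq_iff[OF assms(2), of \<mu> "\<lambda>x. 0"] by (simp add: ae_class_zero)
  then have "ae_class \<Omega> \<mu>0 \<noteq> 0" using s(1) unfolding class0 by auto
  then have dim1: "has_dim (K_space \<Omega> u) 1" unfolding K_eq by (rule has_dim_line)
  have c0: "continuous_on \<Omega> \<mu>0" unfolding \<mu>0_def by (intro continuous_intros h(1))
  have "\<mu>0 \<in> W1p \<Omega> p" if lip: "lipschitz_domain \<Omega>"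
  proof -
    obtain m where m: "m \<in> borel_measurable borel" "AE x in lborel. x \<in> \<Omega> \<longrightarrow> \<mu> x = m x"
      "integrable lborel (\<lambda>x. (m x)\<^sup>2)" "\<And>k. wd \<Omega> k m (\<lambda>x. m x * b k x)"
      using rep[OF sol] by blast
    obtain L where L: "L \<ge> 0" "AE x in lborel. x \<in> \<Omega> \<longrightarrow> \<bar>m x\<bar> \<le> L"
      by (rule lipschitz_domain_bounded[OF lip m(4) bm q M0 vg m(3)]) (rule that)
    have \<mu>m: "AE x in lborel. x \<in> \<Omega> \<longrightarrow> \<mu>0 x = s * m x"
      using h(2) m(2) by eventually_elim (auto simp: \<mu>0_def)
    have abs_s: "\<bar>s\<bar> = 1" using s(1) by auto
    have wds: "wd \<Omega> k (\<lambda>x. s * m x) (\<lambda>x. s * (m x * b k x))" for k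
      by (rule wd_bounded_linear[OF bounded_linear_mult_right m(4)])
    have meas: "(\<lambda>x. s * (m x * b k x)) \<in> borel_measurable (lebesgue_on \<Omega>)" for k
      by (rule lebesgue_on_measurable_AE_cong[OF assms(2) wdD(4)[OF wds[of k]]]) simp
    show ?thesis
      unfolding W1p_def
    proof (intro CollectI conjI allI)
      show "\<mu>0 \<in> Lp \<Omega> p"
      proof (rule Lp_dominated[OF Lp_const[OF assms(2,4), of "1::real"] _ L(1)])
        show "\<mu>0 \<in> borel_measurable (lebesgue_on \<Omega>)"
          by (rule lebesgue_on_measurable_AE_cong[OF assms(2) wdD(3)[OF wds]]) (use \<mu>m in \<open>auto elim: eventually_mono\<close>)
        show "AE x in lebesgue_on \<Omega>. norm (\<mu>0 x) \<le> L * norm (1::real)"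
          unfolding AE_lebesgue_on_iff[OF assms(2)] using \<mu>m L(2) by eventually_elim (auto simp: abs_mult abs_s)
      qed
      fix k
      have "(\<lambda>x. s * (m x * b k x)) \<in> Lp \<Omega> p"
      proof (rule Lp_dominated[OF bp meas L(1)])
        show "AE x in lebesgue_on \<Omega>. norm (s * (m x * b k x)) \<le> L * norm (b k x)"
          unfolding AE_lebesgue_on_iff[OF assms(2)] using L(2)
          by eventually_elim (auto simp: abs_mult abs_s intro!: mult_right_mono)
      qed
      moreover have "has_weak_partial \<Omega> k \<mu>0 (\<lambda>x. s * (m x * b k x))"
        by (rule has_weak_partial_iff_wd[OF assms(2) wdD(1,2)[OF wds] \<mu>m, THEN iffD2]) (use wds in auto)
      ultimately show "\<exists>g\<in>Lp \<Omega> p. has_weak_partial \<Omega> k \<mu>0 g" by blast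
    qed
  qed
  then show ?thesis
    using dim1 c0 K_eq s(2) by (auto simp: \<mu>0_def intro!: exI[of _ \<mu>0])
qed

end
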